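(* Let $K\geq 1$, $M\ge 2$, $p\ge 1$ be integers, $\sigma>0$, $\bar\Delta>0$, and set $\lambda^2=\bar\Delta^2\sigma^2/p$. Let $(\pi^*,\mu,Y)$ be distributed according to the multiple feature matching prior described in the context. Let $D\in\mathbb{N}$ be such that $K\geq 2(D+2)^2$, and suppose that $$\zeta:=64\,D^{40}\,\frac{\lambda^4}{\sigma^4}\,p\,\max\left(1,\frac{M}{K}\right)<1 .$$ Then $$MMSE_{\leq D}\ \geq\ \frac{1}{K}-\frac{1}{K^2}\left(1+64(D+1)D^{36}\,\frac{\zeta}{1-\sqrt{\zeta}}\right).$$
   Context: Prior. Let $\mathcal{S}_K$ be the set of permutations of $[K]=\{1,\dots,K\}$. Draw $\pi^*_1,\ldots,\pi^*_M$ independently and uniformly in $\mathcal{S}_K$. Independently of these, draw $\mu_1,\ldots,\mu_K\in\mathbb{R}^p$ i.i.d. with law $\mathcal{N}(0,\lambda^2 I_p)$, where $\lambda^2=\bar\Delta^2\sigma^2/p$. Conditionally on $\pi^*=(\pi^*_1,\dots,\pi^*_M)$ and $\mu=(\mu_1,\dots,\mu_K)$, draw independently, for $k\in[K]$ and $m\in[M]$, $Y^{(m)}_k\sim\mathcal{N}(\mu_{\pi^*_m(k)},\sigma^2I_p)$. The observed tensor is $Y\in\mathbb{R}^{K\times M\times p}$ with $Y_{k,m,d}=(Y^{(m)}_k)_d$. Target. $\Gamma^*\in\mathbb{R}^{(K\times M)\times(K\times M)}$ is the matrix with entries $\Gamma^*_{(k,m),(k',m')}=\mathbf{1}\{\pi^*_m(k)=\pi^*_{m'}(k')\}$.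 Low-degree risk. $$MMSE_{\leq D}:=\inf_{\hat\Gamma}\ \frac{1}{M(M-1)K^2}\,\mathbb{E}\left[\|\hat\Gamma-\Gamma^*\|_F^2\right],$$ where the infimum is over all matrices $\hat\Gamma=\hat\Gamma(Y)$ each of whose entries is a real multivariate polynomial in the entries of $Y$ of degree at most $D$, and $\|\cdot\|_F$ is the Frobenius norm. *)

theory Defs
  imports "HOL-Probability.Probability" "HOL-Combinatorics.Combinatorics"
begin

type_synonym perms = "nat \<Rightarrow> nat \<Rightarrow> nat"          (* m \<mapsto> \<pi>*_m *)
type_synonym centres = "nat \<times> nat \<Rightarrow> real"        (* (k, d) \<mapsto> (\<mu>_k)_d *)
type_synonym tensor = "nat \<times> nat \<times> nat \<Rightarrow> real"   (* (k, m, d) \<mapsto> Y_{k,m,d} *)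

text \<open>\<open>gaussian a s\<close> is \<open>N(a, s^2)\<close>: the second argument is the standard deviation. An isotropic
  Gaussian vector is the product of its coordinate laws.\<close>

definition gaussian :: "real \<Rightarrow> real \<Rightarrow> real measure" where
  "gaussian a s = density lborel (\<lambda>x. ennreal (normal_density a s x))"

definition perms_law :: "nat \<Rightarrow> nat \<Rightarrow> perms measure" where
  "perms_law K M = (\<Pi>\<^sub>M m\<in>{1..M}. uniform_count_measure {\<pi>. \<pi> permutes {1..K}})"

definition centres_law :: "nat \<Rightarrow> nat \<Rightarrow> real \<Rightarrow> centres measure" where
  "centres_law K p lam = (\<Pi>\<^sub>M i\<in>{1..K} \<times> {1..p}. gaussian 0 lam)"

definition entries :: "nat \<Rightarrow> nat \<Rightarrow> nat \<Rightarrow> (nat \<times> nat \<times> nat) set" where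
  "entries K M p = {1..K} \<times> {1..M} \<times> {1..p}"

definition obs_law :: "nat \<Rightarrow> nat \<Rightarrow> nat \<Rightarrow> real \<Rightarrow> perms \<Rightarrow> centres \<Rightarrow> tensor measure" where
  "obs_law K M p \<sigma> \<pi> \<mu> =
     (\<Pi>\<^sub>M (k, m, d)\<in>entries K M p. gaussian (\<mu> (\<pi> m k, d)) \<sigma>)"

text \<open>\<open>distr\<close> only attaches \<open>(\<pi>, \<mu>)\<close> to the observation drawn from the kernel \<open>obs_law\<close>, so that the
  result is the joint law of \<open>(\<pi>*, \<mu>, Y)\<close>.\<close>

definition matching_prior ::
  "nat \<Rightarrow> nat \<Rightarrow> nat \<Rightarrow> real \<Rightarrow> real \<Rightarrow> (perms \<times> centres \<times> tensor) measure" where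
  "matching_prior K M p lam \<sigma> =
     (perms_law K M \<Otimes>\<^sub>M centres_law K p lam) \<bind>
       (\<lambda>(\<pi>, \<mu>). distr (obs_law K M p \<sigma> \<pi> \<mu>)
          (perms_law K M \<Otimes>\<^sub>M (centres_law K p lam \<Otimes>\<^sub>M (\<Pi>\<^sub>M i\<in>entries K M p. borel)))
          (\<lambda>Y. (\<pi>, \<mu>, Y)))"

text \<open>\<open>obs_law\<close> is a measurable kernel, so the \<open>bind\<close> above is meaningful and yields a probability
  measure.\<close>

lemma prob_space_gaussian: "s > 0 \<Longrightarrow> prob_space (gaussian a s)"
  unfolding gaussian_def by (rule prob_space_normal_density)

lemma sets_gaussian[simp, measurable_cong]: "sets (gaussian a s) = sets borel"
  by (simp add: gaussian_def)
lemma space_gaussian[simp]: "space (gaussian a s) = UNIV"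
  by (simp add: gaussian_def)

lemma measurable_emeasure_gaussian: 
  assumes [measurable]: "A \<in> sets borel"
  shows "(\<lambda>a. emeasure (gaussian a s) A) \<in> borel_measurable borel"
proof -
  have "(\<lambda>a. emeasure (gaussian a s) A) = (\<lambda>a. \<integral>\<^sup>+x. ennreal (normal_density a s x) * indicator A x \<partial>lborel)"
    by (auto simp: gaussian_def emeasure_density)
  also have "\<dots> \<in> borel_measurable borel"
    unfolding normal_density_def by measurable
  finally show ?thesis .
qed

lemma finite_sets_perms_law: "finite (space (perms_law K M))" "sets (perms_law K M) = Pow (space (perms_law K M))"
proof -
  let ?S = "{\<pi>. \<pi> permutes {1..K}}"
  show fin: "finite (space (perms_law K M))"
    by (auto simp: perms_law_def space_PiM space_uniform_count_measure intro!: finite_PiE finite_permutations)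
  have sg: "{f} \<in> sets (perms_law K M)" if f: "f \<in> space (perms_law K M)" for f
  proof -
    have e: "f \<in> {1..M} \<rightarrow>\<^sub>E ?S" using f by (simp add: perms_law_def space_PiM space_uniform_count_measure)
    then have "{f} = (\<Pi>\<^sub>E m\<in>{1..M}. {f m})"
      using PiE_singleton[of f "{1..M}"] by (simp add: PiE_iff)
    also have "\<dots> \<in> sets (perms_law K M)"
      unfolding perms_law_def
      by (rule sets_PiM_I_finite) (use e in \<open>auto simp: sets_uniform_count_measure PiE_iff\<close>)
    finally show ?thesis .
  qed
  have "A \<in> sets (perms_law K M)" if A: "A \<subseteq> space (perms_law K M)" for A
  proof -
    have "(\<Union>f\<in>A. {f}) \<in> sets (perms_law K M)" 
      by (rule sets.finite_UN) (use A fin sg in \<open>auto intro: finite_subset\<close>)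
    then show ?thesis by simp
  qed
  then show "sets (perms_law K M) = Pow (space (perms_law K M))" using sets.sets_into_space by blast
qed

lemma prob_space_perms_law: "prob_space (perms_law K M)"
  unfolding perms_law_def
proof (rule prob_space_PiM, rule prob_space_uniform_count_measure)
  show "{\<pi>. \<pi> permutes {1..K}} \<noteq> {}" using permutes_id by blast
qed (auto intro: finite_permutations)

lemma prob_space_centres_law: "l > 0 \<Longrightarrow> prob_space (centres_law K p l)"
  unfolding centres_law_def by (intro prob_space_PiM prob_space_gaussian)

lemma measurable_conditional_mean:
  assumes "k \<in> {1..K}" "m \<in> {1..M}" "d \<in> {1..p}"
  shows "(\<lambda>(\<pi>, \<mu>). \<mu> (\<pi> m k, d)) \<in> borel_measurable (perms_law K M \<Otimes>\<^sub>M centres_law K p l)"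
proof -
  have s: "sets (perms_law K M \<Otimes>\<^sub>M centres_law K p l) = sets (count_space (space (perms_law K M)) \<Otimes>\<^sub>M centres_law K p l)"
    by (intro sets_pair_measure_cong) (simp_all add: finite_sets_perms_law)
  have "(\<lambda>x. (\<lambda>\<pi> \<mu>. \<mu> (\<pi> m k, d)) (fst x) (snd x)) \<in> borel_measurable (count_space (space (perms_law K M)) \<Otimes>\<^sub>M centres_law K p l)"
  proof (rule measurable_compose_countable'[where I="space (perms_law K M)" and g=fst and f="\<lambda>\<pi> x. snd x (\<pi> m k, d)"])
    fix \<pi> assume "\<pi> \<in> space (perms_law K M)"
    then have "\<pi> m permutes {1..K}"
      using assms by (auto simp: perms_law_def space_PiM space_uniform_count_measure)
    then have "\<pi> m k \<in> {1..K}" using assms permutes_in_image by metis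
    then have "(\<lambda>\<mu>. \<mu> (\<pi> m k, d)) \<in> borel_measurable (centres_law K p l)"
      using assms unfolding centres_law_def
      using measurable_component_singleton[of "(\<pi> m k, d)" "{1..K} \<times> {1..p}" "\<lambda>i. gaussian 0 l"]
      by (simp add: measurable_cong_sets[OF refl sets_gaussian])
    then show "(\<lambda>x. snd x (\<pi> m k, d)) \<in> borel_measurable (count_space (space (perms_law K M)) \<Otimes>\<^sub>M centres_law K p l)"
      by (rule measurable_compose[OF measurable_snd])
  qed (auto simp: finite_sets_perms_law countable_finite)
  then show ?thesis by (simp add: measurable_cong_sets[OF s refl] split_beta)
qed

lemma prob_space_obs_law: "s > 0 \<Longrightarrow> prob_space (obs_law K M p s \<pi> \<mu>)"
  unfolding obs_law_def by (auto intro!: prob_space_PiM prob_space_gaussian split: prod.splits)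

lemma sets_obs_law: "sets (obs_law K M p s \<pi> \<mu>) = sets (\<Pi>\<^sub>M i\<in>entries K M p. borel)"
  unfolding obs_law_def by (intro sets_PiM_cong) (auto split: prod.splits)

lemma measurable_obs_law:
  assumes s: "s > 0"
  shows "(\<lambda>(\<pi>, \<mu>). obs_law K M p s \<pi> \<mu>) \<in> (perms_law K M \<Otimes>\<^sub>M centres_law K p l) \<rightarrow>\<^sub>M subprob_algebra (\<Pi>\<^sub>M i\<in>entries K M p. borel)"
proof (rule measurable_subprob_algebra_generated[OF sets_PiM Int_stable_prod_algebra prod_algebra_sets_into_space])
  fix a assume "a \<in> space (perms_law K M \<Otimes>\<^sub>M centres_law K p l)"
  show "subprob_space (case a of (\<pi>, \<mu>) \<Rightarrow> obs_law K M p s \<pi> \<mu>)"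
    using prob_space_obs_law[OF s] by (auto split: prod.splits intro: prob_space_imp_subprob_space)
  show "sets (case a of (\<pi>, \<mu>) \<Rightarrow> obs_law K M p s \<pi> \<mu>) = sets (\<Pi>\<^sub>M i\<in>entries K M p. borel)"
    by (auto split: prod.splits simp: sets_obs_law)
next
  have fin: "finite (entries K M p)" by (simp add: entries_def)
  let ?c = "\<lambda>\<pi> (\<mu>::centres) (k,m,d). gaussian (\<mu> (\<pi> m k, d)) s"
  have em: "emeasure (obs_law K M p s \<pi> \<mu>) (Pi\<^sub>E (entries K M p) A) = (\<Prod>i\<in>entries K M p. emeasure (?c \<pi> \<mu> i) (A i))"
    if "\<And>i. i \<in> entries K M p \<Longrightarrow> A i \<in> sets borel" for \<pi> \<mu> A
  proof -
    interpret product_prob_space "?c \<pi> \<mu>"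
      using prob_space_gaussian[OF s] by (intro product_prob_spaceI) (auto split: prod.splits)
    show ?thesis unfolding obs_law_def
      by (rule emeasure_PiM[OF fin]) (use that in \<open>auto split: prod.splits\<close>)
  qed
  have main: "(\<lambda>a. emeasure (case a of (\<pi>, \<mu>) \<Rightarrow> obs_law K M p s \<pi> \<mu>) (Pi\<^sub>E (entries K M p) A)) \<in> borel_measurable (perms_law K M \<Otimes>\<^sub>M centres_law K p l)"
    if A: "\<And>i. i \<in> entries K M p \<Longrightarrow> A i \<in> sets borel" for A
  proof -
    have eq: "(\<lambda>a. emeasure (case a of (\<pi>, \<mu>) \<Rightarrow> obs_law K M p s \<pi> \<mu>) (Pi\<^sub>E (entries K M p) A)) =
       (\<lambda>a. \<Prod>i\<in>entries K M p. emeasure (gaussian ((\<lambda>(\<pi>,\<mu>). \<mu> (\<pi> (fst (snd i)) (fst i), snd (snd i))) a) s) (A i))"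
      by (auto simp: fun_eq_iff em[OF A] split_beta)
    show ?thesis unfolding eq
    proof (rule borel_measurable_prod_ennreal)
      fix i assume i: "i \<in> entries K M p"
      show "(\<lambda>a. emeasure (gaussian ((\<lambda>(\<pi>,\<mu>). \<mu> (\<pi> (fst (snd i)) (fst i), snd (snd i))) a) s) (A i)) \<in> borel_measurable (perms_law K M \<Otimes>\<^sub>M centres_law K p l)"
        by (rule measurable_compose[OF measurable_conditional_mean measurable_emeasure_gaussian]) (use i A in \<open>auto simp: entries_def\<close>)
    qed
  qed
  fix X assume "X \<in> prod_algebra (entries K M p) (\<lambda>i. borel :: real measure)"
  then obtain A where "X = Pi\<^sub>E (entries K M p) A" "\<And>i. i \<in> entries K M p \<Longrightarrow> A i \<in> sets borel"
    using prod_algebra_eq_finite[OF fin, of "\<lambda>i. borel :: real measure"] by (auto simp: Pi_iff)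
  with main show "(\<lambda>a. emeasure (case a of (\<pi>, \<mu>) \<Rightarrow> obs_law K M p s \<pi> \<mu>) X) \<in> borel_measurable (perms_law K M \<Otimes>\<^sub>M centres_law K p l)"
    by simp
next
  have fin: "finite (entries K M p)" by (simp add: entries_def)
  have sp: "space (\<Pi>\<^sub>M i\<in>entries K M p. (borel :: real measure)) = Pi\<^sub>E (entries K M p) (\<lambda>_. UNIV)" by (simp add: space_PiM)
  have "emeasure (case a of (\<pi>, \<mu>) \<Rightarrow> obs_law K M p s \<pi> \<mu>) (Pi\<^sub>E (entries K M p) (\<lambda>i. space borel)) = 1" for a
  proof -
    obtain \<pi> \<mu> where a: "a = (\<pi>,\<mu>)" by (cases a)
    have "space (obs_law K M p s \<pi> \<mu>) = Pi\<^sub>E (entries K M p) (\<lambda>_. space borel)"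
      using sets_eq_imp_space_eq[OF sets_obs_law] sp by simp
    then show ?thesis using prob_space.emeasure_space_1[OF prob_space_obs_law[OF s, of K M p \<pi> \<mu>]] a by simp
  qed
  then show "(\<lambda>a. emeasure (case a of (\<pi>, \<mu>) \<Rightarrow> obs_law K M p s \<pi> \<mu>) (Pi\<^sub>E (entries K M p) (\<lambda>i. space borel))) \<in> borel_measurable (perms_law K M \<Otimes>\<^sub>M centres_law K p l)"
    by simp
qed

lemma prob_space_matching_prior:
  assumes "l > 0" "s > 0"
  shows "prob_space (matching_prior K M p l s)"
proof -
  let ?P = "perms_law K M \<Otimes>\<^sub>M centres_law K p l"
  let ?Y = "(\<Pi>\<^sub>M i\<in>entries K M p. (borel :: real measure))"
  let ?N = "perms_law K M \<Otimes>\<^sub>M (centres_law K p l \<Otimes>\<^sub>M ?Y)"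
  interpret P: pair_prob_space "perms_law K M" "centres_law K p l"
    using prob_space_perms_law prob_space_centres_law[OF assms(1)] by (simp add: pair_prob_space_def pair_sigma_finite_def prob_space_imp_sigma_finite)
  have g: "(\<lambda>(x, Y). (fst x, snd x, Y)) \<in> ?P \<Otimes>\<^sub>M ?Y \<rightarrow>\<^sub>M ?N" by measurable
  have "(\<lambda>x. distr ((\<lambda>(\<pi>, \<mu>). obs_law K M p s \<pi> \<mu>) x) ?N (\<lambda>Y. (fst x, snd x, Y))) \<in> ?P \<rightarrow>\<^sub>M subprob_algebra ?N"
    by (rule measurable_distr2[OF g measurable_obs_law[OF assms(2)]])
  then have k: "(\<lambda>(\<pi>, \<mu>). distr (obs_law K M p s \<pi> \<mu>) ?N (\<lambda>Y. (\<pi>, \<mu>, Y))) \<in> ?P \<rightarrow>\<^sub>M subprob_algebra ?N"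
    by (simp add: split_beta)
  show ?thesis unfolding matching_prior_def
  proof (rule prob_space.prob_space_bind[OF _ _ k])
    show "prob_space ?P" by (rule P.prob_space_axioms)
    have "prob_space (distr (obs_law K M p s \<pi> \<mu>) ?N (\<lambda>Y. (\<pi>, \<mu>, Y)))" if "(\<pi>,\<mu>) \<in> space ?P" for \<pi> \<mu>
    proof (rule prob_space.prob_space_distr[OF prob_space_obs_law[OF assms(2)]])
      have [simp]: "\<pi> \<in> space (perms_law K M)" "\<mu> \<in> space (centres_law K p l)" using that by (auto simp: space_pair_measure)
      show "(\<lambda>Y. (\<pi>, \<mu>, Y)) \<in> obs_law K M p s \<pi> \<mu> \<rightarrow>\<^sub>M ?N"
        unfolding measurable_cong_sets[OF sets_obs_law refl] by simp
    qed
    then show "AE x in ?P. prob_space ((\<lambda>(\<pi>, \<mu>). distr (obs_law K M p s \<pi> \<mu>) ?N (\<lambda>Y. (\<pi>, \<mu>, Y))) x)"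
      by (intro AE_I2) auto
  qed
qed

definition Gamma_star :: "perms \<Rightarrow> nat \<times> nat \<Rightarrow> nat \<times> nat \<Rightarrow> real" where
  "Gamma_star \<pi> = (\<lambda>(k, m) (k', m'). if \<pi> m k = \<pi> m' k' then 1 else 0)"

definition multi_indices :: "'i set \<Rightarrow> nat \<Rightarrow> ('i \<Rightarrow> nat) set" where
  "multi_indices I D = {\<alpha> \<in> I \<rightarrow>\<^sub>E UNIV. (\<Sum>i\<in>I. \<alpha> i) \<le> D}"

text \<open>For finite \<open>I\<close>: the polynomial functions of total degree at most \<open>D\<close> in \<open>(x i)\<close>, \<open>i \<in> I\<close>. Multi-indices
  are extensional functions, so there are finitely many of them and each monomial occurs once.\<close>

definition is_poly_deg_le :: "'i set \<Rightarrow> nat \<Rightarrow> (('i \<Rightarrow> real) \<Rightarrow> real) \<Rightarrow> bool" where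
  "is_poly_deg_le I D f \<longleftrightarrow>
     (\<exists>c. \<forall>x. f x = (\<Sum>\<alpha>\<in>multi_indices I D. c \<alpha> * (\<Prod>i\<in>I. x i ^ \<alpha> i)))"

lemma finite_multi_indices:
  assumes "finite I" shows "finite (multi_indices I D)"
proof (rule finite_subset)
  show "multi_indices I D \<subseteq> (I \<rightarrow>\<^sub>E {..D})"
  proof
    fix a assume a: "a \<in> multi_indices I D"
    have "a i \<le> D" if "i \<in> I" for i
      using member_le_sum[of i I a] a assms that by (auto simp: multi_indices_def)
    with a show "a \<in> I \<rightarrow>\<^sub>E {..D}" by (auto simp: multi_indices_def PiE_iff)
  qed
  show "finite (I \<rightarrow>\<^sub>E {..D})" using assms by (intro finite_PiE) auto
qed

definition frob_norm :: "'i set \<Rightarrow> ('i \<Rightarrow> 'i \<Rightarrow> real) \<Rightarrow> real" where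
  "frob_norm I A = L2_set (\<lambda>(i, j). A i j) (I \<times> I)"

definition low_degree_estimators ::
  "nat \<Rightarrow> nat \<Rightarrow> nat \<Rightarrow> nat \<Rightarrow> (tensor \<Rightarrow> nat \<times> nat \<Rightarrow> nat \<times> nat \<Rightarrow> real) set" where
  "low_degree_estimators K M p D =
     {G. \<forall>i \<in> {1..K} \<times> {1..M}. \<forall>j \<in> {1..K} \<times> {1..M}.
           is_poly_deg_le (entries K M p) D (\<lambda>Y. G Y i j)}"

definition estimation_risk ::
  "nat \<Rightarrow> nat \<Rightarrow> nat \<Rightarrow> real \<Rightarrow> real \<Rightarrow> (tensor \<Rightarrow> nat \<times> nat \<Rightarrow> nat \<times> nat \<Rightarrow> real) \<Rightarrow> real" where
  "estimation_risk K M p lam \<sigma> G =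
     1 / (real M * (real M - 1) * (real K)\<^sup>2) *
       (\<integral>(\<pi>, \<mu>, Y). (frob_norm ({1..K} \<times> {1..M}) (\<lambda>i j. G Y i j - Gamma_star \<pi> i j))\<^sup>2
          \<partial>matching_prior K M p lam \<sigma>)"

text \<open>The infimum is over a nonempty set of nonnegative reals, and the integrand of the risk is a
  polynomial in jointly Gaussian variables given \<open>\<pi>\<close>, hence integrable: neither the real \<open>INF\<close> nor
  the Bochner integral takes a default value.\<close>

definition MMSE :: "nat \<Rightarrow> nat \<Rightarrow> nat \<Rightarrow> real \<Rightarrow> real \<Rightarrow> nat \<Rightarrow> real" where
  "MMSE K M p lam \<sigma> D =
     (INF G\<in>low_degree_estimators K M p D. estimation_risk K M p lam \<sigma> G)"

end

theory Submission
  imports Defs "HOL-Computational_Algebra.Polynomial"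
begin

text \<open>It suffices to bound from below the risk of estimating one entry
  \<open>x = 1{\<pi>\<^sub>m(k) = \<pi>\<^sub>m\<^sub>'(k')}\<close> with \<open>m \<noteq> m'\<close> by a polynomial \<open>f(Y)\<close> of degree at most \<open>D\<close>. If a random variable
  \<open>W\<close>, a polynomial of the noise \<open>Y - E[Y | \<pi>, \<mu>]\<close>, satisfies \<open>E[W f(Y)] = E[x f(Y)]\<close> for all such \<open>f\<close>, then
  \<open>E[(f - x)^2] = E[(f - W)^2] + E[x^2] - E[W^2] \<ge> 1/K - E[W^2]\<close>. Expanding in Hermite polynomials, the
  coefficients of \<open>W\<close> are forced to be joint cumulants of \<open>x\<close> and the signal. Given \<open>\<pi>\<close> the signal is
  Gaussian, so by Isserlis' formula they are sums, over multigraphs on the vertices \<open>(k, m)\<close>, of joint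
  cumulants of \<open>x\<close> and the matching indicators along the edges.

  For independent uniform labels such a cumulant vanishes unless the graph is connected. The labels of a
  permutation differ from independent ones only by the prohibition of coincidences inside a layer.
  Switching this prohibition on and off between the connected components and taking the alternating sum
  shows that every component beyond the first costs a factor \<open>K^(1/2)\<close>, because each component has to take
  part in a forbidden coincidence and one coincidence serves at most two components. With the independence of
  the layers this makes the squared cumulant of a graph with \<open>v\<close> vertices on \<open>t\<close> layers of order
  \<open>K^(2 - v - t)\<close>, which is summable over all graphs.\<close>


section \<open>Counting labellings with prescribed coincidences\<close>

text \<open>\<open>W\<close> is a polynomial of the noise, hence not a function of \<open>Y\<close>;
  but only \<open>E[W f(Y)]\<close> and \<open>E[W^2]\<close> enter, and given \<open>\<pi>\<close>
  and the centres the Hermite polynomials of the noise are orthogonal, which makes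
  \<open>E[W^2]\<close> explicit. The condition on \<open>W\<close> is a convolution equation
  between moments divided by factorials, that is, a product of formal power series. The noise is a
  common factor of both sides and cancels, and Isserlis' formula is a substitution of variables,
  which is multiplicative; so solving the equation for the matching indicators solves it for
  \<open>Y\<close>.

  The exponent \<open>2 - v - t\<close> has this origin. For a graph with \<open>q\<close>
  components besides that of \<open>x\<close>, the cumulant is of order
  \<open>K^(-q/2 - v) N\<close>, where \<open>N\<close> counts the labellings constant on
  components. One factor of \<open>N^2\<close> is at most \<open>K^(q+1)\<close>. The other is at
  most \<open>K^(1+v-t)\<close>, because a nonzero cumulant forces the graph to become connected
  once the vertices of each layer are merged. The condition \<open>K >= 2 (D+2)^2\<close> makes at
  least half of all labellings of a graph free of coincidences.\<close>

definition sat :: "('v \<Rightarrow> nat) \<Rightarrow> ('v \<times> 'v) set \<Rightarrow> bool" where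
  "sat \<phi> S \<longleftrightarrow> (\<forall>(u, w)\<in>S. \<phi> u = \<phi> w)"

lemma sat_insert [simp]: "sat \<phi> (insert (u, w) S) \<longleftrightarrow> \<phi> u = \<phi> w \<and> sat \<phi> S"
  by (auto simp: sat_def)

lemma sat_empty [simp]: "sat \<phi> {}"
  by (simp add: sat_def)

lemma sat_Un: "sat \<phi> (S \<union> T) \<longleftrightarrow> sat \<phi> S \<and> sat \<phi> T"
  by (auto simp: sat_def)

definition labellings :: "'v set \<Rightarrow> nat \<Rightarrow> ('v \<times> 'v) set \<Rightarrow> ('v \<Rightarrow> nat) set" where
  "labellings V K S = {\<phi> \<in> V \<rightarrow>\<^sub>E {1..K}. sat \<phi> S}"

definition label_count :: "'v set \<Rightarrow> nat \<Rightarrow> ('v \<times> 'v) set \<Rightarrow> real" where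
  "label_count V K S = real (card (labellings V K S))"

lemma finite_labellings [simp]: "finite V \<Longrightarrow> finite (labellings V K S)"
  unfolding labellings_def by (rule finite_subset[of _ "V \<rightarrow>\<^sub>E {1..K}"]) (auto intro: finite_PiE)

lemma label_count_nonneg [simp]: "label_count V K S \<ge> 0"
  by (simp add: label_count_def)

lemma label_count_mono: "finite V \<Longrightarrow> S \<subseteq> T \<Longrightarrow> label_count V K T \<le> label_count V K S"
  unfolding label_count_def of_nat_le_iff by (rule card_mono[OF finite_labellings]) (auto simp: labellings_def sat_def)

lemma label_count_empty: "finite V \<Longrightarrow> label_count V K {} = real K ^ card V"
  by (simp add: label_count_def labellings_def card_PiE)

definition cyc_shift :: "nat \<Rightarrow> nat \<Rightarrow> nat \<Rightarrow> nat" where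
  "cyc_shift K s a = (if a + s \<le> K then a + s else a + s - K)"

lemma cyc_shift_in: "a \<in> {1..K} \<Longrightarrow> s < K \<Longrightarrow> cyc_shift K s a \<in> {1..K}"
  by (auto simp: cyc_shift_def)

lemma cyc_shift_inj: "a \<in> {1..K} \<Longrightarrow> b \<in> {1..K} \<Longrightarrow> s < K \<Longrightarrow> cyc_shift K s a = cyc_shift K s b \<Longrightarrow> a = b"
  by (auto simp: cyc_shift_def split: if_splits)

lemma card_cyc_shift:
  assumes "a \<in> {1..K}" "b \<in> {1..K}"
  shows "card {s \<in> {..<K}. cyc_shift K s a = b} = 1"
proof -
  have "{s \<in> {..<K}. cyc_shift K s a = b} = {if a \<le> b then b - a else b + K - a}"
    using assms by (auto simp: cyc_shift_def split: if_splits)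
  then show ?thesis by simp
qed

text \<open>Shifting all labels on one side of the cut by a constant modulo \<open>K\<close> preserves the
  constraints in \<open>S\<close> and makes the two labels at the new edge agree for exactly one shift.\<close>

lemma label_count_insert_cut:
  assumes V: "finite V" and S: "S \<subseteq> V \<times> V" and cl: "\<And>a b. (a, b) \<in> S \<Longrightarrow> a \<in> X \<longleftrightarrow> b \<in> X"
    and e: "u \<in> V" "w \<in> V" "(u \<in> X) \<noteq> (w \<in> X)"
  shows "label_count V K (insert (u, w) S) * real K = label_count V K S"
proof -
  have main: "label_count V K (insert (u, w) S) * real K = label_count V K S"
    if e: "u \<in> V" "w \<in> V" "u \<notin> X" "w \<in> X" for u w
  proof -
    define F where "F s \<phi> = (\<lambda>z. if z \<in> X \<inter> V then cyc_shift K s (\<phi> z) else \<phi> z)" for s and \<phi> :: "'a \<Rightarrow> nat"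
    let ?A = "labellings V K S"
    have into: "F s ` ?A \<subseteq> ?A" if s: "s < K" for s
    proof
      fix \<psi> assume "\<psi> \<in> F s ` ?A"
      then obtain \<phi> where \<phi>: "\<phi> \<in> ?A" "\<psi> = F s \<phi>" by auto
      have "\<psi> \<in> V \<rightarrow>\<^sub>E {1..K}"
        using \<phi> cyc_shift_in[OF _ s] by (auto simp: F_def labellings_def PiE_iff extensional_def)
      moreover have "sat \<psi> S"
        unfolding sat_def
      proof clarify
        fix a b assume ab: "(a, b) \<in> S"
        then have "\<phi> a = \<phi> b" using \<phi> by (auto simp: labellings_def sat_def)
        moreover have "a \<in> V" "b \<in> V" using S ab by auto
        ultimately show "\<psi> a = \<psi> b" using cl[OF ab] by (auto simp: \<phi> F_def)
      qed
      ultimately show "\<psi> \<in> ?A" by (simp add: labellings_def)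
    qed
    have inj: "inj_on (F s) ?A" if s: "s < K" for s
    proof (rule inj_onI, rule ext)
      fix \<phi> \<psi> z assume p: "\<phi> \<in> ?A" "\<psi> \<in> ?A" "F s \<phi> = F s \<psi>"
      have Fz: "F s \<phi> z = F s \<psi> z" using p by simp
      show "\<phi> z = \<psi> z"
      proof (cases "z \<in> X \<inter> V")
        case True
        then have "\<phi> z \<in> {1..K}" "\<psi> z \<in> {1..K}" using p unfolding labellings_def by blast+
        moreover have "cyc_shift K s (\<phi> z) = cyc_shift K s (\<psi> z)" using Fz True by (simp add: F_def)
        ultimately show ?thesis using cyc_shift_inj s by blast
      qed (use Fz in \<open>auto simp: F_def\<close>)
    qed
    have bij: "bij_betw (F s) ?A ?A" if "s < K" for s
      using endo_inj_surj[OF finite_labellings[OF V] into[OF that] inj[OF that]] inj[OF that]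
      by (simp add: bij_betw_def)
    have eq: "label_count V K (insert (u, w) S) = (\<Sum>\<phi>\<in>?A. of_bool (F s \<phi> u = F s \<phi> w))" if s: "s < K" for s
    proof -
      have "label_count V K (insert (u, w) S) = (\<Sum>\<phi>\<in>?A. of_bool (\<phi> u = \<phi> w))"
      proof -
        have "labellings V K (insert (u, w) S) = ?A \<inter> {\<phi>. \<phi> u = \<phi> w}" by (auto simp: labellings_def)
        then show ?thesis using V by (simp add: label_count_def of_bool_def sum.If_cases)
      qed
      also have "\<dots> = (\<Sum>\<phi>\<in>?A. of_bool (F s \<phi> u = F s \<phi> w))"
        by (rule sum.reindex_bij_betw[OF bij[OF s], symmetric])
      finally show ?thesis .
    qed
    have "label_count V K (insert (u, w) S) * real K = (\<Sum>s<K. label_count V K (insert (u, w) S))"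
      by simp
    also have "\<dots> = (\<Sum>s<K. \<Sum>\<phi>\<in>?A. of_bool (F s \<phi> u = F s \<phi> w))"
      using eq by (intro sum.cong refl) blast
    also have "\<dots> = (\<Sum>\<phi>\<in>?A. \<Sum>s<K. of_bool (F s \<phi> u = F s \<phi> w))"
      by (rule sum.swap)
    also have "\<dots> = (\<Sum>\<phi>\<in>?A. 1)"
    proof (rule sum.cong[OF refl])
      fix \<phi> assume "\<phi> \<in> ?A"
      then have r: "\<phi> u \<in> {1..K}" "\<phi> w \<in> {1..K}" using e unfolding labellings_def by blast+
      have "(\<Sum>s<K. of_bool (F s \<phi> u = F s \<phi> w)) = real (card {s \<in> {..<K}. cyc_shift K s (\<phi> w) = \<phi> u})"
        using e by (simp add: F_def of_bool_def sum.If_cases eq_commute Int_def conj_commute)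
      then show "(\<Sum>s<K. of_bool (F s \<phi> u = F s \<phi> w)) = (1::real)"
        using card_cyc_shift[OF r(2,1)] by simp
    qed
    finally show ?thesis by (simp add: label_count_def)
  qed
  show ?thesis
  proof (cases "u \<in> X")
    case True
    have "labellings V K (insert (u, w) S) = labellings V K (insert (w, u) S)"
      by (auto simp: labellings_def)
    then have "label_count V K (insert (u, w) S) = label_count V K (insert (w, u) S)"
      by (simp add: label_count_def)
    then show ?thesis using main[of w u] e True by simp
  qed (use main e in blast)
qed

lemma sat_connected:
  assumes "(u, w) \<in> (S \<union> S\<inverse>)\<^sup>*" "sat \<phi> S" shows "\<phi> u = \<phi> w"
  using assms by (induction rule: rtrancl_induct) (auto simp: sat_def)

text \<open>The connected component of \<open>u\<close> in the undirected graph of \<open>S\<close>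
  either contains \<open>w\<close> or is a cut that no edge of \<open>S\<close> crosses. In matroid
  terms \<open>label_count V K S\<close> is \<open>K\<close> to the power \<open>card V\<close>
  minus the rank of \<open>S\<close>, and one edge raises the rank by zero or one.\<close>

lemma label_count_insert_dichotomy:
  assumes V: "finite V" and S: "S \<subseteq> V \<times> V" and e: "u \<in> V" "w \<in> V"
  shows "(\<forall>\<phi>. sat \<phi> S \<longrightarrow> \<phi> u = \<phi> w) \<or> (label_count V K (insert (u, w) S) * real K = label_count V K S)"
proof (cases "(u, w) \<in> (S \<union> S\<inverse>)\<^sup>*")
  case True
  then show ?thesis by (intro disjI1 allI impI) (rule sat_connected)
next
  case False
  define X where "X = {z. (u, z) \<in> (S \<union> S\<inverse>)\<^sup>*}"
  have "a \<in> X \<longleftrightarrow> b \<in> X" if "(a, b) \<in> S" for a b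
    unfolding X_def using that by (auto intro: rtrancl_into_rtrancl)
  moreover have "u \<in> X" "w \<notin> X" using False by (auto simp: X_def)
  ultimately show ?thesis using label_count_insert_cut[OF V S, of X u w K] e by auto
qed

lemma label_count_insert_implied:
  assumes "\<forall>\<phi>. sat \<phi> S \<longrightarrow> \<phi> u = \<phi> w"
  shows "label_count V K (insert (u, w) S) = label_count V K S"
proof -
  have "labellings V K (insert (u, w) S) = labellings V K S" using assms by (auto simp: labellings_def)
  then show ?thesis by (simp add: label_count_def)
qed

lemma label_count_insert_ge:
  assumes V: "finite V" and S: "S \<subseteq> V \<times> V" and e: "u \<in> V" "w \<in> V" and K: "K \<ge> 1"
  shows "label_count V K S \<le> label_count V K (insert (u, w) S) * real K"
proof -
  have "label_count V K (insert (u, w) S) * 1 \<le> label_count V K (insert (u, w) S) * real K"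
    using K by (intro mult_left_mono) auto
  moreover have "label_count V K (insert (u, w) S) = label_count V K S" if "\<forall>\<phi>. sat \<phi> S \<longrightarrow> \<phi> u = \<phi> w"
    using that by (rule label_count_insert_implied)
  ultimately show ?thesis using label_count_insert_dichotomy[OF V S e, of K] by force
qed

text \<open>Subadditivity of the rank of a graph. When \<open>T\<close> grows by an edge that
  \<open>S \<union> T\<close> implies, the right side does not change and the left side does not
  grow. An edge that \<open>S \<union> T\<close> does not imply is not implied by \<open>T\<close>
  either, so the left side loses exactly a factor \<open>K\<close> and the right side at most
  that.\<close>

lemma label_count_supermodular:
  assumes V: "finite V" and S: "S \<subseteq> V \<times> V" and T: "T \<subseteq> V \<times> V" and K: "K \<ge> 1"
  shows "label_count V K S * label_count V K T \<le> label_count V K (S \<union> T) * real K ^ card V"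
proof -
  have "finite T" by (rule finite_subset[OF T]) (simp add: V)
  then show ?thesis using T
  proof (induction T rule: finite_induct)
    case empty
    then show ?case by (simp add: label_count_empty[OF V])
  next
    case (insert e T)
    obtain u w where e: "e = (u, w)" by (cases e)
    have uw: "u \<in> V" "w \<in> V" and TV: "T \<subseteq> V \<times> V" and STV: "S \<union> T \<subseteq> V \<times> V" using insert e S by auto
    note IH = insert.IH[OF TV]
    have K0: "real K > 0" using K by simp
    consider "\<forall>\<phi>. sat \<phi> (S \<union> T) \<longrightarrow> \<phi> u = \<phi> w" | "\<not> (\<forall>\<phi>. sat \<phi> T \<longrightarrow> \<phi> u = \<phi> w)"
      by (auto simp: sat_Un)
    then show ?case
    proof cases
      case 1
      then have "label_count V K (S \<union> insert e T) = label_count V K (S \<union> T)"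
        using label_count_insert_implied[of "S \<union> T" u w] e by simp
      moreover have "label_count V K S * label_count V K (insert e T) \<le> label_count V K S * label_count V K T"
        by (intro mult_left_mono label_count_mono[OF V]) auto
      ultimately show ?thesis using IH by (metis order_trans)
    next
      case 2
      then have a: "label_count V K (insert e T) * real K = label_count V K T"
        using label_count_insert_dichotomy[OF V TV uw, of K] e by blast
      have "label_count V K (S \<union> T) \<le> label_count V K (S \<union> insert e T) * real K"
        using label_count_insert_ge[OF V STV uw K] e by simp
      note ge = mult_right_mono[OF this, of "real K ^ card V"]
      have "(label_count V K S * label_count V K (insert e T)) * real K = label_count V K S * label_count V K T"
        by (simp add: a[symmetric])
      also note IH
      also have "label_count V K (S \<union> T) * real K ^ card V \<le> (label_count V K (S \<union> insert e T) * real K ^ card V) * real K"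
        using ge by (simp add: mult.commute mult.left_commute)
      finally have "(label_count V K S * label_count V K (insert e T)) * real K \<le> (label_count V K (S \<union> insert e T) * real K ^ card V) * real K" .
      then show ?thesis using K0 by simp
    qed
  qed
qed

text \<open>Merging the class of \<open>i\<close> with the class its edge leads to uses up at most two elements of \<open>Q\<close>,
  while it divides the number of labellings by \<open>K\<close>.\<close>

lemma label_count_crossing_edges:
  fixes c :: "'v \<Rightarrow> 'c"
  assumes V: "finite V" and S: "S \<subseteq> V \<times> V" and cl: "\<And>a b. (a, b) \<in> S \<Longrightarrow> c a = c b"
    and Q: "finite Q" and f: "\<And>i. i \<in> Q \<Longrightarrow> f i \<in> V \<times> V \<and> c (fst (f i)) = i \<and> c (snd (f i)) \<noteq> i"
    and K: "K \<ge> 1"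
  shows "(label_count V K (S \<union> f ` Q))\<^sup>2 * real K ^ card Q \<le> (label_count V K S)\<^sup>2"
  using S cl Q f
proof (induction "card Q" arbitrary: Q S c rule: less_induct)
  case less
  show ?case
  proof (cases "Q = {}")
    case False
    then obtain i where i: "i \<in> Q" by auto
    obtain u w where uw: "f i = (u, w)" by (cases "f i")
    have uwV: "u \<in> V" "w \<in> V" "c u = i" "c w \<noteq> i" using less.prems(4)[OF i] uw by auto
    define j where "j = c w"
    define Q' where "Q' = Q - {i, j}"
    \<comment> \<open>Class \<open>j\<close> is merged into \<open>i\<close>. The edges of
      \<open>S'\<close> stay inside classes, and an element of \<open>Q'\<close> is neither
      \<open>i\<close> nor \<open>j\<close>, so its edge still leaves its class.\<close>
    define c' where "c' z = (if c z = j then i else c z)" for z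
    define S' where "S' = insert (u, w) S"
    have fin: "finite Q'" using less.prems by (simp add: Q'_def)
    have "Q' \<subset> Q" using i by (auto simp: Q'_def)
    then have lt: "card Q' < card Q" using less.prems by (simp add: psubset_card_mono)
    have "card {i, j} \<le> 2" by (simp add: card_insert_if)
    moreover have "card Q - card {i,j} \<le> card Q'" unfolding Q'_def using less.prems by (intro diff_card_le_card_Diff) auto
    ultimately have cardQ: "card Q \<le> card Q' + 2" by linarith
    have IH: "(label_count V K (S' \<union> f ` Q'))\<^sup>2 * real K ^ card Q' \<le> (label_count V K S')\<^sup>2"
    proof (rule less.hyps[OF lt, of S' c'])
      show "S' \<subseteq> V \<times> V" using less.prems uwV by (auto simp: S'_def)
      show "c' a = c' b" if "(a, b) \<in> S'" for a b
        using that less.prems(2)[of a b] uwV by (auto simp: S'_def c'_def j_def)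
      show "f i' \<in> V \<times> V \<and> c' (fst (f i')) = i' \<and> c' (snd (f i')) \<noteq> i'" if "i' \<in> Q'" for i'
        using that less.prems(4)[of i'] by (auto simp: Q'_def c'_def)
    qed (rule fin)
    have cut: "label_count V K S' * real K = label_count V K S"
      unfolding S'_def using less.prems(2) uwV
      by (intro label_count_insert_cut[OF V less.prems(1), of "{z. c z = i}"]) auto
    have sub: "S' \<union> f ` Q' \<subseteq> S \<union> f ` Q" using i uw by (auto simp: S'_def Q'_def image_iff intro!: bexI[of _ i])
    \<comment> \<open>Since \<open>card Q\<close> may drop by two, two powers of \<open>K\<close>
      have to be recovered. The single cut along \<open>(u, w)\<close> supplies them because the
      counts are squared.\<close>
    have "(label_count V K (S \<union> f ` Q))\<^sup>2 * real K ^ card Q \<le> (label_count V K (S' \<union> f ` Q'))\<^sup>2 * real K ^ (card Q' + 2)"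
      using K by (intro mult_mono power_mono label_count_mono[OF V sub] power_increasing cardQ) auto
    also have "\<dots> = ((label_count V K (S' \<union> f ` Q'))\<^sup>2 * real K ^ card Q') * (real K)\<^sup>2"
      by (simp add: power_add power2_eq_square)
    also have "\<dots> \<le> (label_count V K S')\<^sup>2 * (real K)\<^sup>2"
      by (intro mult_right_mono IH) auto
    also have "\<dots> = (label_count V K S)\<^sup>2" by (simp add: cut[symmetric] power_mult_distrib)
    finally show ?thesis .
  qed simp
qed

section \<open>Uniform tuples of permutations\<close>

lemma inj_on_extend_permutes:
  fixes f :: "nat \<Rightarrow> nat"
  assumes "A \<subseteq> {1..K}" "f ` A \<subseteq> {1..K}" "inj_on f A"
  shows "\<exists>\<rho>. \<rho> permutes {1..K} \<and> (\<forall>a\<in>A. \<rho> a = f a)"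
proof -
  have fA: "finite A" using assms(1) finite_subset by blast
  have "card ({1..K} - A) = card ({1..K} - f ` A)"
    using assms fA by (simp add: card_Diff_subset card_image)
  then obtain g where g: "bij_betw g ({1..K} - A) ({1..K} - f ` A)"
    using finite_same_card_bij[of "{1..K} - A" "{1..K} - f ` A"] by auto
  define \<rho> where "\<rho> x = (if x \<in> A then f x else if x \<in> {1..K} then g x else x)" for x
  have "bij_betw \<rho> A (f ` A)"
    using assms(3) by (simp add: bij_betw_def \<rho>_def inj_on_def)
  moreover have "bij_betw \<rho> ({1..K} - A) ({1..K} - f ` A)"
    using g by (subst bij_betw_cong[of _ _ g]) (auto simp: \<rho>_def)
  ultimately have "bij_betw \<rho> (A \<union> ({1..K} - A)) (f ` A \<union> ({1..K} - f ` A))"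
    by (rule bij_betw_combine) auto
  moreover have "A \<union> ({1..K} - A) = {1..K}" "f ` A \<union> ({1..K} - f ` A) = {1..K}" using assms by auto
  ultimately have "bij_betw \<rho> {1..K} {1..K}" by simp
  then have "\<rho> permutes {1..K}" using assms(1)
    by (intro bij_imp_permutes) (auto simp: \<rho>_def)
  then show ?thesis by (auto simp: \<rho>_def)
qed

definition label_of :: "perms \<Rightarrow> nat \<times> nat \<Rightarrow> nat" where
  "label_of \<pi> = (\<lambda>(k, m). \<pi> m k)"

definition perm_space :: "nat \<Rightarrow> nat \<Rightarrow> perms set" where
  "perm_space K M = {1..M} \<rightarrow>\<^sub>E {\<pi>. \<pi> permutes {1..K}}"

text \<open>The expectation over the permutations of the prior, kept as a finite sum;
  \<open>nn_integral_perms_law\<close> makes the link with \<open>perms_law\<close>.\<close>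

definition avg :: "nat \<Rightarrow> nat \<Rightarrow> (perms \<Rightarrow> real) \<Rightarrow> real" where
  "avg K M h = (\<Sum>\<pi>\<in>perm_space K M. h \<pi>) / real (card (perm_space K M))"

lemma finite_perm_space [simp]: "finite (perm_space K M)"
  by (auto simp: perm_space_def intro!: finite_PiE finite_permutations)

lemma card_perm_space_pos: "card (perm_space K M) > 0"
proof -
  have "(\<lambda>m\<in>{1..M}. id) \<in> perm_space K M" by (auto simp: perm_space_def permutes_id)
  then show ?thesis by (auto simp: card_gt_0_iff)
qed

lemma card_perm_space_nz: "real (card (perm_space K M)) \<noteq> 0"
  using card_perm_space_pos[of K M] by linarith

lemma avg_const [simp]: "avg K M (\<lambda>_. c) = c"
  using card_perm_space_pos[of K M] by (auto simp: avg_def)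

lemma avg_cong: "(\<And>\<pi>. \<pi> \<in> perm_space K M \<Longrightarrow> f \<pi> = g \<pi>) \<Longrightarrow> avg K M f = avg K M g"
  unfolding avg_def by (intro arg_cong2[where f="(/)"] sum.cong) auto

lemma label_of_in: "\<pi> \<in> perm_space K M \<Longrightarrow> u \<in> {1..K} \<times> {1..M} \<Longrightarrow> label_of \<pi> u \<in> {1..K}"
proof -
  assume a: "\<pi> \<in> perm_space K M" "u \<in> {1..K} \<times> {1..M}"
  obtain k m where u: "u = (k, m)" by (cases u)
  have "\<pi> m permutes {1..K}" using a u unfolding perm_space_def PiE_iff by auto
  then show ?thesis using a u permutes_in_image[of "\<pi> m" "{1..K}" k] by (auto simp: label_of_def)
qed

lemma avg_reindex:
  assumes "F ` perm_space K M \<subseteq> perm_space K M" "inj_on F (perm_space K M)"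
  shows "(\<Sum>\<pi>\<in>perm_space K M. h (F \<pi>)) = (\<Sum>\<pi>\<in>perm_space K M. h \<pi>)"
proof -
  have "bij_betw F (perm_space K M) (perm_space K M)"
    using endo_inj_surj[OF finite_perm_space] assms by (auto simp: bij_betw_def)
  then show ?thesis by (rule sum.reindex_bij_betw)
qed

lemma perm_space_compose:
  assumes \<rho>: "\<rho> \<in> perm_space K M"
  shows "(\<lambda>\<tau>. \<lambda>m\<in>{1..M}. \<tau> m \<circ> \<rho> m) ` perm_space K M \<subseteq> perm_space K M"
    and "inj_on (\<lambda>\<tau>. \<lambda>m\<in>{1..M}. \<tau> m \<circ> \<rho> m) (perm_space K M)"
proof -
  have r: "\<rho> m permutes {1..K}" if "m \<in> {1..M}" for m using \<rho> that unfolding perm_space_def PiE_iff by auto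
  show "(\<lambda>\<tau>. \<lambda>m\<in>{1..M}. \<tau> m \<circ> \<rho> m) ` perm_space K M \<subseteq> perm_space K M"
    unfolding perm_space_def using r by (auto simp: PiE_iff intro!: permutes_compose)
  show "inj_on (\<lambda>\<tau>. \<lambda>m\<in>{1..M}. \<tau> m \<circ> \<rho> m) (perm_space K M)"
  proof (rule inj_onI)
    fix \<tau> \<tau>' assume a: "\<tau> \<in> perm_space K M" "\<tau>' \<in> perm_space K M"
      "(\<lambda>m\<in>{1..M}. \<tau> m \<circ> \<rho> m) = (\<lambda>m\<in>{1..M}. \<tau>' m \<circ> \<rho> m)"
    have "\<tau> m = \<tau>' m" if m: "m \<in> {1..M}" for m
    proof
      fix x
      obtain y where y: "\<rho> m y = x" using permutes_surj[OF r[OF m]] by (metis surjD)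
      have "(\<lambda>m\<in>{1..M}. \<tau> m \<circ> \<rho> m) m y = (\<lambda>m\<in>{1..M}. \<tau>' m \<circ> \<rho> m) m y" using a(3) by metis
      then show "\<tau> m x = \<tau>' m x" using m y by simp
    qed
    moreover have "\<tau> \<in> extensional {1..M}" "\<tau>' \<in> extensional {1..M}"
      using a(1,2) by (auto simp: perm_space_def PiE_def)
    ultimately show "\<tau> = \<tau>'" by (metis extensionalityI)
  qed
qed

definition act :: "(nat \<times> nat) set \<Rightarrow> perms \<Rightarrow> (nat \<times> nat \<Rightarrow> nat) \<Rightarrow> nat \<times> nat \<Rightarrow> nat" where
  "act U \<tau> \<phi> = (\<lambda>u. if u \<in> U then \<tau> (snd u) (\<phi> u) else \<phi> u)"

text \<open>Letting a uniformly random tuple of label permutations act on the labels of \<open>U\<close> turns any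
  labelling that is injective on the layers of \<open>U\<close> into a uniformly random one.\<close>

lemma relabelling_average:
  fixes wt h1 h2 :: "(nat \<times> nat \<Rightarrow> nat) \<Rightarrow> real"
  assumes V: "V \<subseteq> {1..K} \<times> {1..M}" and U: "U \<subseteq> V"
    and h1: "\<And>\<phi> \<psi>. (\<And>u. u \<in> U \<Longrightarrow> \<phi> u = \<psi> u) \<Longrightarrow> h1 \<phi> = h1 \<psi>"
    and h2: "\<And>\<phi> \<psi>. (\<And>u. u \<in> V - U \<Longrightarrow> \<phi> u = \<psi> u) \<Longrightarrow> h2 \<phi> = h2 \<psi>"
    and wt: "\<And>\<tau> \<phi>. \<tau> \<in> perm_space K M \<Longrightarrow> \<phi> \<in> V \<rightarrow>\<^sub>E {1..K} \<Longrightarrow> wt (act U \<tau> \<phi>) = wt \<phi>"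
    and inj: "\<And>\<phi> u w. \<phi> \<in> V \<rightarrow>\<^sub>E {1..K} \<Longrightarrow> wt \<phi> \<noteq> 0 \<Longrightarrow> u \<in> U \<Longrightarrow> w \<in> U \<Longrightarrow> snd u = snd w \<Longrightarrow> \<phi> u = \<phi> w \<Longrightarrow> u = w"
  shows "(\<Sum>\<phi>\<in>V \<rightarrow>\<^sub>E {1..K}. wt \<phi> * h1 \<phi> * h2 \<phi>)
    = avg K M (\<lambda>\<pi>. h1 (label_of \<pi>)) * (\<Sum>\<phi>\<in>V \<rightarrow>\<^sub>E {1..K}. wt \<phi> * h2 \<phi>)"
proof -
  let ?\<Phi> = "V \<rightarrow>\<^sub>E {1..K}" and ?P = "perm_space K M"
  have finV: "finite V" using V finite_subset by blast
  then have fin: "finite ?\<Phi>" by (intro finite_PiE) auto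
  have Tm: "\<tau> (snd u) permutes {1..K}" if "\<tau> \<in> ?P" "u \<in> V" for \<tau> u
    using that V unfolding perm_space_def PiE_iff by auto
  have into: "act U \<tau> ` ?\<Phi> \<subseteq> ?\<Phi>" if t: "\<tau> \<in> ?P" for \<tau>
  proof
    fix \<psi> assume "\<psi> \<in> act U \<tau> ` ?\<Phi>"
    then obtain \<phi> where \<phi>: "\<phi> \<in> ?\<Phi>" "\<psi> = act U \<tau> \<phi>" by auto
    have "\<psi> u \<in> {1..K}" if u: "u \<in> V" for u
    proof -
      have "\<phi> u \<in> {1..K}" using \<phi> u by (auto simp: PiE_iff)
      then show ?thesis using permutes_in_image[OF Tm[OF t u], of "\<phi> u"] by (simp add: \<phi> act_def)
    qed
    moreover have "\<psi> u = undefined" if "u \<notin> V" for u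
      using \<phi> that U by (cases u) (auto simp: act_def PiE_iff extensional_def)
    ultimately show "\<psi> \<in> ?\<Phi>" by (simp add: PiE_iff extensional_def)
  qed
  have injA: "inj_on (act U \<tau>) ?\<Phi>" if t: "\<tau> \<in> ?P" for \<tau>
  proof (rule inj_onI, rule ext)
    fix \<phi> \<psi> u assume a: "\<phi> \<in> ?\<Phi>" "\<psi> \<in> ?\<Phi>" "act U \<tau> \<phi> = act U \<tau> \<psi>"
    have e: "act U \<tau> \<phi> u = act U \<tau> \<psi> u" using a by simp
    show "\<phi> u = \<psi> u"
    proof (cases "u \<in> U")
      case True
      then have "\<tau> (snd u) (\<phi> u) = \<tau> (snd u) (\<psi> u)" using e by (simp add: act_def)
      then show ?thesis using permutes_inj[OF Tm[OF t]] True U by (meson injD subsetD)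
    qed (use e in \<open>simp add: act_def\<close>)
  qed
  have bij: "bij_betw (act U \<tau>) ?\<Phi> ?\<Phi>" if t: "\<tau> \<in> ?P" for \<tau>
    using endo_inj_surj[OF fin into[OF t] injA[OF t]] injA[OF t] by (simp add: bij_betw_def)
  have h2act: "h2 (act U \<tau> \<phi>) = h2 \<phi>" for \<tau> \<phi>
    by (rule h2) (simp add: act_def)
  have one: "(\<Sum>\<phi>\<in>?\<Phi>. wt \<phi> * h1 \<phi> * h2 \<phi>) = (\<Sum>\<phi>\<in>?\<Phi>. wt \<phi> * h2 \<phi> * h1 (act U \<tau> \<phi>))" if t: "\<tau> \<in> ?P" for \<tau>
  proof -
    have "(\<Sum>\<phi>\<in>?\<Phi>. wt \<phi> * h1 \<phi> * h2 \<phi>) = (\<Sum>\<phi>\<in>?\<Phi>. wt (act U \<tau> \<phi>) * h1 (act U \<tau> \<phi>) * h2 (act U \<tau> \<phi>))"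
      by (rule sum.reindex_bij_betw[OF bij[OF t], symmetric])
    also have "\<dots> = (\<Sum>\<phi>\<in>?\<Phi>. wt \<phi> * h2 \<phi> * h1 (act U \<tau> \<phi>))"
      by (intro sum.cong refl) (simp add: wt[OF t] h2act)
    finally show ?thesis .
  qed
  have avgt: "(\<Sum>\<tau>\<in>?P. h1 (act U \<tau> \<phi>)) = (\<Sum>\<pi>\<in>?P. h1 (label_of \<pi>))"
    if \<phi>: "\<phi> \<in> ?\<Phi>" and nz: "wt \<phi> \<noteq> 0" for \<phi>
  proof -
    have "\<exists>\<rho>. \<rho> permutes {1..K} \<and> (\<forall>k. (k, m) \<in> U \<longrightarrow> \<rho> k = \<phi> (k, m))" for m
    proof -
      let ?A = "{k. (k, m) \<in> U}"
      have UV: "(k, m) \<in> V" if "(k, m) \<in> U" for k using that U by auto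
      have "?A \<subseteq> {1..K}" using UV V by blast
      moreover have "(\<lambda>k. \<phi> (k, m)) ` ?A \<subseteq> {1..K}" using UV \<phi> by (auto simp: PiE_iff)
      moreover have "inj_on (\<lambda>k. \<phi> (k, m)) ?A"
      proof (rule inj_onI)
        fix k k' assume "k \<in> ?A" "k' \<in> ?A" "\<phi> (k, m) = \<phi> (k', m)"
        then show "k = k'" using inj[OF \<phi> nz, of "(k, m)" "(k', m)"] by simp
      qed
      ultimately show ?thesis using inj_on_extend_permutes[of ?A K "\<lambda>k. \<phi> (k, m)"] by auto
    qed
    then obtain r where r: "\<And>m. r m permutes {1..K}" "\<And>k m. (k, m) \<in> U \<Longrightarrow> r m k = \<phi> (k, m)" by metis
    \<comment> \<open>On \<open>U\<close> the labelling \<open>\<phi>\<close> is that of the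
      permutation tuple \<open>\<rho>\<close>, so \<open>act U \<tau> \<phi>\<close> is there the
      labelling of the composite of \<open>\<tau>\<close> and \<open>\<rho>\<close>, which runs
      through all tuples as \<open>\<tau>\<close> does.\<close>
    define \<rho> where "\<rho> = (\<lambda>m\<in>{1..M}. r m)"
    have \<rho>: "\<rho> \<in> ?P" using r by (auto simp: perm_space_def \<rho>_def)
    have "(\<Sum>\<tau>\<in>?P. h1 (act U \<tau> \<phi>)) = (\<Sum>\<tau>\<in>?P. h1 (label_of (\<lambda>m\<in>{1..M}. \<tau> m \<circ> \<rho> m)))"
    proof (intro sum.cong refl h1)
      fix \<tau> u assume u: "u \<in> U"
      obtain k m where km: "u = (k, m)" by (cases u)
      have "m \<in> {1..M}" using u km U V by auto
      then show "act U \<tau> \<phi> u = label_of (\<lambda>m\<in>{1..M}. \<tau> m \<circ> \<rho> m) u"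
        using u r(2)[of k m] by (simp add: act_def label_of_def km \<rho>_def)
    qed
    also have "\<dots> = (\<Sum>\<pi>\<in>?P. h1 (label_of \<pi>))"
      by (rule avg_reindex[OF perm_space_compose[OF \<rho>], of "\<lambda>\<pi>. h1 (label_of \<pi>)"])
    finally show ?thesis .
  qed
  have "real (card ?P) * (\<Sum>\<phi>\<in>?\<Phi>. wt \<phi> * h1 \<phi> * h2 \<phi>) = (\<Sum>\<tau>\<in>?P. \<Sum>\<phi>\<in>?\<Phi>. wt \<phi> * h1 \<phi> * h2 \<phi>)"
    by simp
  also have "\<dots> = (\<Sum>\<tau>\<in>?P. \<Sum>\<phi>\<in>?\<Phi>. wt \<phi> * h2 \<phi> * h1 (act U \<tau> \<phi>))"
    by (intro sum.cong refl one)
  also have "\<dots> = (\<Sum>\<phi>\<in>?\<Phi>. \<Sum>\<tau>\<in>?P. wt \<phi> * h2 \<phi> * h1 (act U \<tau> \<phi>))"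
    by (rule sum.swap)
  also have "\<dots> = (\<Sum>\<phi>\<in>?\<Phi>. wt \<phi> * h2 \<phi> * (\<Sum>\<tau>\<in>?P. h1 (act U \<tau> \<phi>)))"
    by (simp add: sum_distrib_left)
  also have "\<dots> = (\<Sum>\<phi>\<in>?\<Phi>. wt \<phi> * h2 \<phi> * (\<Sum>\<pi>\<in>?P. h1 (label_of \<pi>)))"
  proof (intro sum.cong refl)
    fix \<phi> assume "\<phi> \<in> ?\<Phi>"
    then show "wt \<phi> * h2 \<phi> * (\<Sum>\<tau>\<in>?P. h1 (act U \<tau> \<phi>)) = wt \<phi> * h2 \<phi> * (\<Sum>\<pi>\<in>?P. h1 (label_of \<pi>))"
      using avgt[of \<phi>] by (cases "wt \<phi> = 0") auto
  qed
  also have "\<dots> = (\<Sum>\<pi>\<in>?P. h1 (label_of \<pi>)) * (\<Sum>\<phi>\<in>?\<Phi>. wt \<phi> * h2 \<phi>)"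
    by (subst sum_distrib_right[symmetric]) (rule mult.commute)
  finally have e: "real (card ?P) * (\<Sum>\<phi>\<in>?\<Phi>. wt \<phi> * h1 \<phi> * h2 \<phi>)
    = (\<Sum>\<pi>\<in>?P. h1 (label_of \<pi>)) * (\<Sum>\<phi>\<in>?\<Phi>. wt \<phi> * h2 \<phi>)" .
  have d: "x = a / n * b" if "n * x = a * b" "n \<noteq> 0" for n x a b :: real
    using that by (auto simp: divide_simps mult.commute)
  show ?thesis unfolding avg_def by (rule d[OF e card_perm_space_nz])
qed

text \<open>Exchanging the layers outside \<open>L\<close> between two independent copies of the
  tuple is an involution of the pairs; it turns a pair of values taken from two copies into values
  of the same copy.\<close>

lemma avg_indep_layers:
  assumes a: "\<And>\<pi> \<pi>'. (\<And>m. m \<in> L \<Longrightarrow> \<pi> m = \<pi>' m) \<Longrightarrow> a \<pi> = a \<pi>'"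
    and b: "\<And>\<pi> \<pi>'. (\<And>m. m \<notin> L \<Longrightarrow> \<pi> m = \<pi>' m) \<Longrightarrow> b \<pi> = b \<pi>'"
  shows "avg K M (\<lambda>\<pi>. a \<pi> * b \<pi>) = avg K M a * avg K M b"
proof -
  let ?P = "perm_space K M"
  define mix :: "perms \<Rightarrow> perms \<Rightarrow> perms" where "mix \<pi> \<pi>' = (\<lambda>m. if m \<in> L then \<pi> m else \<pi>' m)" for \<pi> \<pi>'
  have mixP: "mix \<pi> \<pi>' \<in> ?P" if "\<pi> \<in> ?P" "\<pi>' \<in> ?P" for \<pi> \<pi>'
    using that by (auto simp: perm_space_def PiE_iff mix_def extensional_def)
  have "(\<Sum>\<pi>\<in>?P. a \<pi>) * (\<Sum>\<pi>\<in>?P. b \<pi>) = (\<Sum>(\<pi>, \<pi>')\<in>?P \<times> ?P. a \<pi> * b \<pi>')"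
    by (simp add: sum_product sum.cartesian_product)
  also have "\<dots> = (\<Sum>(\<pi>, \<pi>')\<in>?P \<times> ?P. a \<pi> * b \<pi>)"
  proof (rule sum.reindex_bij_witness[of _ "\<lambda>(\<pi>, \<pi>'). (mix \<pi> \<pi>', mix \<pi>' \<pi>)" "\<lambda>(\<pi>, \<pi>'). (mix \<pi> \<pi>', mix \<pi>' \<pi>)"])
    fix q assume "q \<in> ?P \<times> ?P"
    then show "(case case q of (\<pi>, \<pi>') \<Rightarrow> (mix \<pi> \<pi>', mix \<pi>' \<pi>) of (\<pi>, \<pi>') \<Rightarrow> a \<pi> * b \<pi>)
      = (case q of (\<pi>, \<pi>') \<Rightarrow> a \<pi> * b \<pi>')"
      by (auto simp: mix_def split: prod.splits intro!: arg_cong2[where f="(*)"] a b)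
  qed (auto simp: mix_def mixP fun_eq_iff intro: mixP[unfolded mix_def])
  also have "\<dots> = real (card ?P) * (\<Sum>\<pi>\<in>?P. a \<pi> * b \<pi>)"
    by (simp add: sum.cartesian_product[symmetric] sum_distrib_left)
  finally show ?thesis using card_perm_space_pos[of K M] by (simp add: avg_def field_simps)
qed

text \<open>Composing layer \<open>m2\<close> with a transposition shows that the number of matching
  tuples does not depend on \<open>k2\<close>, and every tuple matches for exactly one choice of
  \<open>k2\<close> in \<open>{1..K}\<close>.\<close>

lemma avg_match:
  assumes "k1 \<in> {1..K}" "k2 \<in> {1..K}" "m1 \<in> {1..M}" "m2 \<in> {1..M}" "m1 \<noteq> m2"
  shows "avg K M (\<lambda>\<pi>. of_bool (\<pi> m1 k1 = \<pi> m2 k2)) = 1 / real K"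
proof -
  let ?P = "perm_space K M"
  have eq: "(\<Sum>\<pi>\<in>?P. of_bool (\<pi> m1 k1 = \<pi> m2 j)) = (\<Sum>\<pi>\<in>?P. of_bool (\<pi> m1 k1 = \<pi> m2 k2) :: real)"
    if j: "j \<in> {1..K}" for j
  proof -
    define \<rho> where "\<rho> = (\<lambda>m\<in>{1..M}. if m = m2 then Transposition.transpose k2 j else id)"
    have \<rho>: "\<rho> \<in> ?P" using permutes_swap_id[of k2 "{1..K}" j] assms j
      by (auto simp: \<rho>_def perm_space_def permutes_id)
    have "(\<Sum>\<pi>\<in>?P. of_bool (\<pi> m1 k1 = \<pi> m2 j)) = (\<Sum>\<pi>\<in>?P. of_bool ((\<lambda>m\<in>{1..M}. \<pi> m \<circ> \<rho> m) m1 k1 = (\<lambda>m\<in>{1..M}. \<pi> m \<circ> \<rho> m) m2 k2) :: real)"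
      using assms by (intro sum.cong refl) (simp add: \<rho>_def)
    also have "\<dots> = (\<Sum>\<pi>\<in>?P. of_bool (\<pi> m1 k1 = \<pi> m2 k2))"
      by (rule avg_reindex[OF perm_space_compose[OF \<rho>], of "\<lambda>\<pi>. of_bool (\<pi> m1 k1 = \<pi> m2 k2)"])
    finally show ?thesis .
  qed
  have "real K * (\<Sum>\<pi>\<in>?P. of_bool (\<pi> m1 k1 = \<pi> m2 k2)) = (\<Sum>j\<in>{1..K}. \<Sum>\<pi>\<in>?P. of_bool (\<pi> m1 k1 = \<pi> m2 k2))"
    by simp
  also have "\<dots> = (\<Sum>j\<in>{1..K}. \<Sum>\<pi>\<in>?P. of_bool (\<pi> m1 k1 = \<pi> m2 j))"
    by (intro sum.cong refl eq[symmetric])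
  also have "\<dots> = (\<Sum>\<pi>\<in>?P. \<Sum>j\<in>{1..K}. of_bool (\<pi> m1 k1 = \<pi> m2 j))" by (rule sum.swap)
  also have "\<dots> = (\<Sum>\<pi>\<in>?P. 1)"
  proof (intro sum.cong refl)
    fix \<pi> assume p: "\<pi> \<in> ?P"
    have p2: "\<pi> m2 permutes {1..K}" and "\<pi> m1 permutes {1..K}" using p assms unfolding perm_space_def PiE_iff by auto
    then have "\<pi> m1 k1 \<in> {1..K}" using permutes_in_image assms by metis
    then obtain j0 where j0: "j0 \<in> {1..K}" "\<pi> m2 j0 = \<pi> m1 k1" using permutes_image[OF p2] by (metis imageE)
    have "(\<pi> m1 k1 = \<pi> m2 j) = (j = j0)" for j
      using j0 permutes_inj[OF p2] by (metis injD)
    then show "(\<Sum>j\<in>{1..K}. of_bool (\<pi> m1 k1 = \<pi> m2 j)) = (1::real)"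
      using j0 by (simp add: of_bool_def)
  qed
  finally have e: "real K * (\<Sum>\<pi>\<in>?P. of_bool (\<pi> m1 k1 = \<pi> m2 k2)) = real (card ?P)" by simp
  have d: "s / n = 1 / k" if "k * s = n" "n \<noteq> 0" "k \<noteq> 0" for s n k :: real
    using that by (auto simp: divide_simps)
  have K0: "real K \<noteq> 0" using assms(1) by simp
  show ?thesis unfolding avg_def by (rule d[OF e card_perm_space_nz K0])
qed

section \<open>Multisets and alternating sums\<close>

text \<open>The factorial of a multi-index; multisets play the part of multi-indices.\<close>

definition mfact :: "'a multiset \<Rightarrow> real" where
  "mfact A = (\<Prod>x\<in>set_mset A. fact (count A x))"

lemma mfact_superset:
  assumes "finite X" "set_mset A \<subseteq> X"
  shows "mfact A = (\<Prod>x\<in>X. fact (count A x))"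
  unfolding mfact_def using assms by (intro prod.mono_neutral_left) (auto simp: not_in_iff)

lemma mfact_empty [simp]: "mfact {#} = 1"
  by (simp add: mfact_def)

lemma mfact_ge_1: "mfact A \<ge> 1"
  unfolding mfact_def by (intro prod_ge_1) (auto simp: fact_ge_1)

lemma mfact_pos [simp]: "mfact A > 0"
  using mfact_ge_1[of A] by linarith

lemma mfact_nz [simp]: "mfact A \<noteq> 0"
  using mfact_pos[of A] by linarith

lemma mfact_add_mset: "mfact (add_mset x A) = real (count A x + 1) * mfact A"
proof -
  let ?X = "insert x (set_mset A)"
  have "mfact (add_mset x A) = (\<Prod>y\<in>?X. fact (count (add_mset x A) y))"
    by (rule mfact_superset) auto
  also have "\<dots> = fact (count A x + 1) * (\<Prod>y\<in>?X - {x}. fact (count (add_mset x A) y))"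
    by (subst prod.remove[of _ x]) auto
  also have "(\<Prod>y\<in>?X - {x}. fact (count (add_mset x A) y)) = (\<Prod>y\<in>?X - {x}. (fact (count A y) :: real))"
    by (intro prod.cong) auto
  also have "fact (count A x + 1) * \<dots> = real (count A x + 1) * (fact (count A x) * (\<Prod>y\<in>?X - {x}. fact (count A y)))"
    by simp
  also have "(fact (count A x) * (\<Prod>y\<in>?X - {x}. (fact (count A y) :: real))) = (\<Prod>y\<in>?X. fact (count A y))"
    by (subst (2) prod.remove[of _ x]) auto
  also have "\<dots> = mfact A" by (rule mfact_superset[symmetric]) auto
  finally show ?thesis .
qed

lemma mfact_union_disjoint:
  assumes "set_mset A \<inter> set_mset B = {}"
  shows "mfact (A + B) = mfact A * mfact B"
proof -
  have "mfact (A + B) = (\<Prod>x\<in>set_mset A \<union> set_mset B. fact (count (A + B) x))"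
    by (rule mfact_superset) auto
  also have "\<dots> = (\<Prod>x\<in>set_mset A. fact (count (A + B) x)) * (\<Prod>x\<in>set_mset B. fact (count (A + B) x))"
    by (rule prod.union_disjoint) (use assms in auto)
  also have "(\<Prod>x\<in>set_mset A. fact (count (A + B) x)) = mfact A"
    unfolding mfact_def
  proof (intro prod.cong refl)
    fix x assume "x \<in># A"
    then have "count B x = 0" using assms by (auto simp: count_eq_zero_iff)
    then show "fact (count (A + B) x) = (fact (count A x) :: real)" by simp
  qed
  also have "(\<Prod>x\<in>set_mset B. fact (count (A + B) x)) = mfact B"
    unfolding mfact_def
  proof (intro prod.cong refl)
    fix x assume "x \<in># B"
    then have "count A x = 0" using assms by (auto simp: count_eq_zero_iff)
    then show "fact (count (A + B) x) = (fact (count B x) :: real)" by simp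
  qed
  finally show ?thesis .
qed

lemma mfact_le: "mfact A \<le> fact (size A)"
proof (induction A)
  case (add x A)
  have "mfact (add_mset x A) \<le> real (size A + 1) * fact (size A)"
    unfolding mfact_add_mset using add count_le_size[of A x] by (intro mult_mono) (auto simp: less_imp_le)
  then show ?case by simp
qed simp

lemma submultisets_add_mset:
  "{B. B \<subseteq># add_mset x A} \<subseteq> {B. B \<subseteq># A} \<union> add_mset x ` {B. B \<subseteq># A}"
proof
  fix B assume "B \<in> {B. B \<subseteq># add_mset x A}"
  then have B: "B \<subseteq># add_mset x A" by simp
  show "B \<in> {B. B \<subseteq># A} \<union> add_mset x ` {B. B \<subseteq># A}"
  proof (cases "x \<in># B")
    case True
    then obtain C where C: "B = add_mset x C" by (metis multi_member_split)
    then show ?thesis using B by auto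
  next
    case False
    then have "B \<subseteq># A" using B by (metis diff_single_trivial subset_eq_diff_conv add_mset_add_single)
    then show ?thesis by simp
  qed
qed

lemma finite_submultisets [simp]: "finite {B. B \<subseteq># A}"
proof (induction A)
  case (add x A)
  then show ?case by (intro finite_subset[OF submultisets_add_mset]) auto
qed simp

lemma finite_strict_submultisets [simp]: "finite {B. B \<subset># A}"
  by (rule finite_subset[OF _ finite_submultisets[of A]]) (auto simp: subset_mset.less_imp_le)

text \<open>The binomial theorem, as an inequality because a submultiset is counted once although
  repeated elements allow several ways to choose it.\<close>

lemma sum_submultisets_power_le:
  assumes "(x::real) \<ge> 0"
  shows "(\<Sum>B\<in>{B. B \<subseteq># A}. x ^ size B) \<le> (1 + x) ^ size A"
proof (induction A)
  case (add a A)
  have "(\<Sum>B\<in>{B. B \<subseteq># add_mset a A}. x ^ size B)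
      \<le> (\<Sum>B\<in>{B. B \<subseteq># A} \<union> add_mset a ` {B. B \<subseteq># A}. x ^ size B)"
    using assms by (intro sum_mono2 submultisets_add_mset) auto
  also have "\<dots> \<le> (\<Sum>B\<in>{B. B \<subseteq># A}. x ^ size B) + (\<Sum>B\<in>add_mset a ` {B. B \<subseteq># A}. x ^ size B)"
    using assms by (subst sum.union_inter[symmetric]) (auto intro!: sum_nonneg)
  also have "(\<Sum>B\<in>add_mset a ` {B. B \<subseteq># A}. x ^ size B) = x * (\<Sum>B\<in>{B. B \<subseteq># A}. x ^ size B)"
    by (subst sum.reindex) (auto simp: inj_on_def sum_distrib_left)
  also have "(\<Sum>B\<in>{B. B \<subseteq># A}. x ^ size B) + x * (\<Sum>B\<in>{B. B \<subseteq># A}. x ^ size B)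
      = (1 + x) * (\<Sum>B\<in>{B. B \<subseteq># A}. x ^ size B)" by (simp add: algebra_simps)
  also have "\<dots> \<le> (1 + x) * (1 + x) ^ size A" using assms add by (intro mult_left_mono) auto
  finally show ?case by simp
qed simp

lemma double_diff_mset: "B \<subseteq># A \<Longrightarrow> A - (A - B) = B"
  by (simp add: multiset_eq_iff subseteq_mset_def)

text \<open>Complements turn the sum into one over nonempty submultisets, at most
  \<open>(1 + x) ^ size A - 1\<close>. As \<open>size A * x\<close> is at most \<open>1 / 4\<close>,
  Bernoulli's inequality gives \<open>(1 - x) ^ size A >= 3 / 4\<close>, and its inverse bounds
  \<open>(1 + x) ^ size A\<close> by \<open>4 / 3\<close>. The value \<open>1 / 3\<close> is what
  closes the induction in \<open>cumulant_bound\<close>.\<close>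

lemma sum_strict_submultisets_power_le:
  assumes "(x::real) \<ge> 0" "4 * real n * x \<le> 1" "size A \<le> n"
  shows "(\<Sum>B\<in>{B. B \<subset># A}. x ^ (size (A - B))) \<le> 1 / 3"
proof -
  have "(\<Sum>B\<in>{B. B \<subset># A}. x ^ (size (A - B))) = (\<Sum>B\<in>{B. B \<subseteq># A} - {{#}}. x ^ size B)"
  proof (rule sum.reindex_bij_witness[of _ "\<lambda>B. A - B" "\<lambda>B. A - B"])
    fix B assume "B \<in> {B. B \<subset># A}"
    then have B: "B \<subseteq># A" "B \<noteq> A" by (auto simp: subset_mset.less_le)
    then show "A - (A - B) = B" by (intro double_diff_mset) simp
    have "A - B \<noteq> {#}" using B by (metis Diff_eq_empty_iff_mset subset_mset.antisym)
    then show "A - B \<in> {B. B \<subseteq># A} - {{#}}" by simp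
  next
    fix B assume B: "B \<in> {B. B \<subseteq># A} - {{#}}"
    then show "A - (A - B) = B" by (intro double_diff_mset) simp
    have "size (A - B) < size A" using B size_Diff_submset[of B A] size_mset_mono[of B A]
      by (auto simp: nonempty_has_size)
    then have "A - B \<noteq> A" by auto
    then show "A - B \<in> {B. B \<subset># A}" by (simp add: subset_mset.less_le)
  qed simp
  also have "\<dots> = (\<Sum>B\<in>{B. B \<subseteq># A}. x ^ size B) - 1"
    by (subst sum_diff1) auto
  also have "\<dots> \<le> (1 + x) ^ size A - 1" using sum_submultisets_power_le[OF assms(1), of A] by simp
  also have "\<dots> \<le> 1 / 3"
  proof -
    have x1: "real (size A) * x \<le> 1 / 4" using assms mult_right_mono[of "real (size A)" "real n" x] by simp
    show ?thesis
    proof (cases "size A = 0")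
      case False
      then have "1 \<le> size A" by linarith
      then have "1 * x \<le> real (size A) * x" using assms(1) by (intro mult_right_mono) auto
      then have x4: "x \<le> 1 / 4" using x1 by linarith
      have a: "3 / 4 \<le> (1 - x) ^ size A"
        using Bernoulli_inequality[of "- x" "size A"] x4 x1 by simp
      have "((1 + x) * (1 - x)) ^ size A \<le> 1"
        using x4 assms(1) by (intro power_le_one) (auto simp: algebra_simps mult_le_one)
      then have b: "(1 + x) ^ size A * (1 - x) ^ size A \<le> 1" by (simp add: power_mult_distrib)
      have "(1 + x) ^ size A * (3 / 4) \<le> (1 + x) ^ size A * (1 - x) ^ size A"
        using a assms(1) by (intro mult_left_mono) auto
      then show ?thesis using b by linarith
    qed simp
  qed
  finally show ?thesis .
qed

lemma card_set_mset_le_size: "card (set_mset A) \<le> size A"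
proof -
  have "card (set_mset A) = (\<Sum>x\<in>set_mset A. 1)" by simp
  also have "\<dots> \<le> size A" unfolding size_multiset_overloaded_eq
    by (intro sum_mono) (simp add: Suc_le_eq)
  finally show ?thesis .
qed

text \<open>The product of formal power series whose monomials are indexed by multisets. Moments
  divided by \<open>mfact\<close> are the coefficients of their exponential generating
  functions.\<close>

definition conv :: "('a multiset \<Rightarrow> real) \<Rightarrow> ('a multiset \<Rightarrow> real) \<Rightarrow> 'a multiset \<Rightarrow> real" where
  "conv f g A = (\<Sum>B\<in>{B. B \<subseteq># A}. f B * g (A - B))"

text \<open>Adding or removing \<open>i\<close> is a sign-reversing involution of the sets between
  \<open>B\<close> and \<open>A\<close> that preserves \<open>g\<close>.\<close>

lemma alternating_sum_eq_0:
  fixes g :: "'c set \<Rightarrow> real"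
  assumes A: "finite A" and i: "i \<in> A - B" and g: "\<And>D. D \<subseteq> A \<Longrightarrow> i \<notin> D \<Longrightarrow> g (insert i D) = g D"
  shows "(\<Sum>D\<in>{D. B \<subseteq> D \<and> D \<subseteq> A}. (-1) ^ card (A - D) * g D) = 0"
proof -
  let ?I = "{D. B \<subseteq> D \<and> D \<subseteq> A}" and ?h = "\<lambda>D. (-1) ^ card (A - D) * g D"
  define F where "F D = (if i \<in> D then D - {i} else insert i D)" for D
  have neg: "?h (insert i D) = - ?h D" if D: "D \<subseteq> A" "i \<notin> D" for D
  proof -
    have "A - D = insert i (A - insert i D)" using i D by auto
    then have "card (A - D) = card (insert i (A - insert i D))" by (rule arg_cong)
    also have "\<dots> = Suc (card (A - insert i D))" using A by (subst card_insert_disjoint) auto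
    finally have "card (A - D) = Suc (card (A - insert i D))" .
    then show ?thesis using g[OF D] by simp
  qed
  have "(\<Sum>D\<in>?I. ?h D) = (\<Sum>D\<in>?I. - ?h D)"
  proof (rule sum.reindex_bij_witness[of _ F F])
    fix D assume D: "D \<in> ?I"
    show "F (F D) = D" by (auto simp: F_def)
    show "F D \<in> ?I" using D i by (auto simp: F_def)
    show "- ?h (F D) = ?h D"
    proof (cases "i \<in> D")
      case True
      then have "?h (insert i (D - {i})) = - ?h (D - {i})" using D by (intro neg) auto
      moreover have "insert i (D - {i}) = D" using True by auto
      ultimately have "?h D = - ?h (D - {i})" by (simp only:)
      then show ?thesis using True unfolding F_def by simp
    qed (use neg[of D] D in \<open>auto simp: F_def\<close>)
    show "F D \<in> ?I" using D i by (auto simp: F_def)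
  qed (auto simp: F_def)
  then show ?thesis by (simp add: sum_negf)
qed

lemma abs_alternating_sum_le:
  fixes g :: "'c set \<Rightarrow> real"
  assumes A: "finite A" "B \<subseteq> A" and g: "\<And>D. \<bar>g D\<bar> \<le> 1"
  shows "\<bar>\<Sum>D\<in>{D. B \<subseteq> D \<and> D \<subseteq> A}. (-1) ^ card (A - D) * g D\<bar> \<le> 2 ^ card (A - B)"
proof -
  let ?I = "{D. B \<subseteq> D \<and> D \<subseteq> A}"
  have "\<bar>\<Sum>D\<in>?I. (-1) ^ card (A - D) * g D\<bar> \<le> (\<Sum>D\<in>?I. \<bar>(-1) ^ card (A - D) * g D\<bar>)"
    by (rule sum_abs)
  also have "\<dots> \<le> (\<Sum>D\<in>?I. 1)"
    using g by (intro sum_mono) (simp add: abs_mult)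
  also have "\<dots> = real (card ?I)" by simp
  also have "card ?I \<le> card (Pow (A - B))"
    by (rule card_inj_on_le[of "\<lambda>D. D - B"]) (use A in \<open>auto simp: inj_on_def\<close>)
  also have "real (card (Pow (A - B))) = 2 ^ card (A - B)"
    using A by (simp add: card_Pow)
  finally show ?thesis by simp
qed

section \<open>Joint cumulants of the matching indicators\<close>

type_synonym vertex = "nat \<times> nat"

definition edges_of :: "((vertex \<times> vertex) \<times> 'd) multiset \<Rightarrow> (vertex \<times> vertex) set" where
  "edges_of \<theta> = fst ` set_mset \<theta>"

lemma edges_of_empty [simp]: "edges_of {#} = {}" by (simp add: edges_of_def)
lemma edges_of_union [simp]: "edges_of (A + B) = edges_of A \<union> edges_of B" by (simp add: edges_of_def image_Un)
lemma edges_of_mono: "A \<subseteq># B \<Longrightarrow> edges_of A \<subseteq> edges_of B" unfolding edges_of_def by (intro image_mono set_mset_mono)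
lemma finite_edges_of [simp]: "finite (edges_of A)" by (simp add: edges_of_def)

text \<open>Moments and cumulants are divided by the factorial of the multigraph, so that the defining
  relation between them becomes the convolution identity \<open>cumulant_conv\<close>. The second component of an edge is
  the coordinate \<open>d\<close> of the entries that it pairs; it has no influence on the moments.\<close>

definition match_moment :: "nat \<Rightarrow> nat \<Rightarrow> ((vertex \<times> vertex) \<times> 'd) multiset \<Rightarrow> real" where
  "match_moment K M \<theta> = avg K M (\<lambda>\<pi>. of_bool (sat (label_of \<pi>) (edges_of \<theta>))) / mfact \<theta>"

definition match_moment_at :: "nat \<Rightarrow> nat \<Rightarrow> vertex \<times> vertex \<Rightarrow> ((vertex \<times> vertex) \<times> 'd) multiset \<Rightarrow> real" where
  "match_moment_at K M e0 \<theta> = avg K M (\<lambda>\<pi>. of_bool (sat (label_of \<pi>) (insert e0 (edges_of \<theta>)))) / mfact \<theta>"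

lemma match_moment_empty [simp]: "match_moment K M {#} = 1"
  by (simp add: match_moment_def)

text \<open>The quotient of the power series \<open>E[x exp(sum t_e 1_e)]\<close> and
  \<open>E[exp(sum t_e 1_e)]\<close>, where \<open>x\<close> is the indicator of \<open>e0\<close>
  and \<open>1_e\<close> that of the edge \<open>e\<close>. This is the derivative of the
  logarithmic moment generating function in the direction of \<open>x\<close>, so its coefficients
  are the joint cumulants that contain \<open>x\<close> once.\<close>

function cumulant :: "nat \<Rightarrow> nat \<Rightarrow> vertex \<times> vertex \<Rightarrow> ((vertex \<times> vertex) \<times> 'd) multiset \<Rightarrow> real" where
  "cumulant K M e0 \<theta> = match_moment_at K M e0 \<theta> - (\<Sum>\<eta>\<in>{\<eta>. \<eta> \<subset># \<theta>}. cumulant K M e0 \<eta> * match_moment K M (\<theta> - \<eta>))"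
  by auto
termination
  by (relation "Wellfounded.measure (\<lambda>(_, _, _, \<theta>). size \<theta>)") (auto intro: mset_subset_size)

declare cumulant.simps [simp del]

lemma submultisets_split: "{B. B \<subseteq># A} = insert A {B. B \<subset># A}"
  by (auto simp: subset_mset.le_less)

lemma cumulant_conv: "conv (cumulant K M e0) (match_moment K M) \<theta> = match_moment_at K M e0 \<theta>"
  unfolding conv_def submultisets_split
  by (subst sum.insert) (auto simp: cumulant.simps[of K M e0 \<theta>])

lemma sat_cong: "(\<And>u. u \<in> fst ` S \<union> snd ` S \<Longrightarrow> \<phi> u = \<psi> u) \<Longrightarrow> sat \<phi> S = sat \<psi> S"
proof -
  assume a: "\<And>u. u \<in> fst ` S \<union> snd ` S \<Longrightarrow> \<phi> u = \<psi> u"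
  have "\<phi> (fst e) = \<psi> (fst e)" "\<phi> (snd e) = \<psi> (snd e)" if "e \<in> S" for e
    using that by (blast intro: a)+
  then show ?thesis unfolding sat_def case_prod_beta by (intro ball_cong refl) simp
qed

lemma submultisets_filter:
  assumes "\<And>e. e \<in># R \<Longrightarrow> \<not> P e" "\<And>e. e \<in># A \<Longrightarrow> P e"
  shows "{B. B \<subseteq># A + R \<and> (\<forall>e\<in>#B. P e)} = {B. B \<subseteq># A}"
proof (intro set_eqI iffI)
  fix B assume "B \<in> {B. B \<subseteq># A + R \<and> (\<forall>e\<in>#B. P e)}"
  then have B: "B \<subseteq># A + R" "\<forall>e\<in>#B. P e" by auto
  have "count B e \<le> count A e" for e
  proof (cases "e \<in># R")
    case True
    then have "e \<notin># B" using B assms by auto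
    then show ?thesis by (simp add: not_in_iff)
  next
    case False
    then show ?thesis using mset_subset_eq_count[OF B(1), of e] by (simp add: not_in_iff)
  qed
  then show "B \<in> {B. B \<subseteq># A}" by (simp add: subseteq_mset_def)
next
  fix B assume "B \<in> {B. B \<subseteq># A}"
  then show "B \<in> {B. B \<subseteq># A + R \<and> (\<forall>e\<in>#B. P e)}"
    using assms(2) by (auto dest: mset_subset_eqD intro: subset_mset.order_trans[OF _ mset_subset_eq_add_left])
qed

section \<open>Alternating sums over the classes that are coupled to \<open>e0\<close>\<close>

text \<open>The classes need only be unions of connected components; in
  \<open>cumulant_sq_bound\<close> they are the components of the graph formed by \<open>e0\<close>
  and the multigraph. The bound on \<open>K\<close> is there for
  \<open>free_count_empty_ge\<close>.\<close>

locale match_graph =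
  fixes K M :: nat and V :: "vertex set" and c :: "vertex \<Rightarrow> 'c" and c0 :: 'c
    and e0 :: "vertex \<times> vertex" and G :: "(vertex \<times> vertex) set"
  assumes V: "V \<subseteq> {1..K} \<times> {1..M}" and K: "2 * (card V)\<^sup>2 \<le> K" "1 \<le> K"
    and G: "G \<subseteq> V \<times> V" and cG: "\<And>u w. (u, w) \<in> G \<Longrightarrow> c u = c w"
    and e0: "e0 \<in> V \<times> V" "c (fst e0) = c0" "c (snd e0) = c0"
begin

lemma finV: "finite V" using V finite_subset by blast

lemma fin\<Phi>: "finite (V \<rightarrow>\<^sub>E {1..K})" using finV by (intro finite_PiE) auto

lemma edge_ok:
  assumes "(a, b) \<in> insert e0 G" shows "a \<in> V \<and> b \<in> V \<and> c a = c b"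
proof (cases "(a, b) = e0")
  case True
  then show ?thesis using e0 by (metis SigmaE2 fst_conv snd_conv)
next
  case False
  then have ab: "(a, b) \<in> G" using assms by simp
  then have "(a, b) \<in> V \<times> V" using G by (rule rev_subsetD)
  then show ?thesis using cG[OF ab] by simp
qed

text \<open>The class \<open>c0\<close> is excluded because it belongs to every block
  \<open>insert c0 D\<close>; only the other classes can be coupled and uncoupled.\<close>

definition classes_hit :: "((vertex \<times> vertex) \<times> 'd) multiset \<Rightarrow> 'c set" where
  "classes_hit \<eta> = (c \<circ> fst) ` edges_of \<eta> - {c0}"

text \<open>Coincidences are forbidden inside the class \<open>c0\<close> of \<open>e0\<close>, inside every other class, and between
  the classes in \<open>insert c0 D\<close>. The labels of those classes are jointly those of a uniform permutation
  tuple, and the remaining classes are independent of them.\<close>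

definition clash :: "'c set \<Rightarrow> vertex \<Rightarrow> vertex \<Rightarrow> bool" where
  "clash D u w \<longleftrightarrow> u \<noteq> w \<and> snd u = snd w \<and> (c u = c w \<or> c u \<in> insert c0 D \<and> c w \<in> insert c0 D)"

definition free :: "'c set \<Rightarrow> (vertex \<Rightarrow> nat) \<Rightarrow> bool" where
  "free D \<phi> \<longleftrightarrow> (\<forall>u\<in>V. \<forall>w\<in>V. clash D u w \<longrightarrow> \<phi> u \<noteq> \<phi> w)"

definition free_count :: "'c set \<Rightarrow> (vertex \<times> vertex) set \<Rightarrow> real" where
  "free_count D S = (\<Sum>\<phi>\<in>V \<rightarrow>\<^sub>E {1..K}. of_bool (free D \<phi>) * of_bool (sat \<phi> S))"

text \<open>A clash compares two vertices of the same layer that lie both in the block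
  \<open>insert c0 D\<close> or both outside. Permuting the labels of the block layer by layer
  therefore preserves \<open>free D\<close>, and \<open>relabelling_average\<close> applies with the
  block as \<open>U\<close>.\<close>

lemma free_count_factor:
  assumes S: "S \<subseteq> insert e0 G" "\<And>u w. (u, w) \<in> S \<Longrightarrow> c u \<in> insert c0 D"
    and T: "T \<subseteq> G" "\<And>u w. (u, w) \<in> T \<Longrightarrow> c u \<notin> insert c0 D"
  shows "free_count D (S \<union> T) = avg K M (\<lambda>\<pi>. of_bool (sat (label_of \<pi>) S)) * free_count D T"
proof -
  define U where "U = {u \<in> V. c u \<in> insert c0 D}"
  have SU: "u \<in> U" if u: "u \<in> fst ` S \<union> snd ` S" for u
  proof -
    obtain e where e: "e \<in> S" "u = fst e \<or> u = snd e" using u by blast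
    obtain a b where "e = (a, b)" by (cases e)
    then have ab: "(a, b) \<in> S" "u = a \<or> u = b" using e by auto
    have "c a \<in> insert c0 D" using S(2) ab(1) .
    moreover have "(a, b) \<in> insert e0 G" using S(1) ab(1) by (rule subsetD)
    then have "a \<in> V \<and> b \<in> V \<and> c a = c b" by (rule edge_ok)
    ultimately show ?thesis using ab(2) by (auto simp: U_def)
  qed
  have TU: "u \<in> V - U" if u: "u \<in> fst ` T \<union> snd ` T" for u
  proof -
    obtain e where e: "e \<in> T" "u = fst e \<or> u = snd e" using u by blast
    obtain a b where "e = (a, b)" by (cases e)
    then have ab: "(a, b) \<in> T" "u = a \<or> u = b" using e by auto
    have "c a \<notin> insert c0 D" using T(2) ab(1) .
    moreover have "(a, b) \<in> insert e0 G" using T(1) ab(1) by (intro insertI2) (rule subsetD)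
    then have "a \<in> V \<and> b \<in> V \<and> c a = c b" by (rule edge_ok)
    ultimately show ?thesis using ab(2) by (auto simp: U_def)
  qed
  have "(\<Sum>\<phi>\<in>V \<rightarrow>\<^sub>E {1..K}. of_bool (free D \<phi>) * of_bool (sat \<phi> S) * of_bool (sat \<phi> T))
    = avg K M (\<lambda>\<pi>. of_bool (sat (label_of \<pi>) S)) * (\<Sum>\<phi>\<in>V \<rightarrow>\<^sub>E {1..K}. of_bool (free D \<phi>) * of_bool (sat \<phi> T))"
  proof (rule relabelling_average[OF V, of U])
    show "U \<subseteq> V" by (auto simp: U_def)
    show "of_bool (sat \<phi> S) = of_bool (sat \<psi> S)" if "\<And>u. u \<in> U \<Longrightarrow> \<phi> u = \<psi> u" for \<phi> \<psi> :: "vertex \<Rightarrow> nat"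
      using sat_cong[of S \<phi> \<psi>] that SU by simp
    show "of_bool (sat \<phi> T) = of_bool (sat \<psi> T)" if "\<And>u. u \<in> V - U \<Longrightarrow> \<phi> u = \<psi> u" for \<phi> \<psi> :: "vertex \<Rightarrow> nat"
      using sat_cong[of T \<phi> \<psi>] that TU by simp
    show "of_bool (free D (act U \<tau> \<phi>)) = of_bool (free D \<phi>)" if t: "\<tau> \<in> perm_space K M" "\<phi> \<in> V \<rightarrow>\<^sub>E {1..K}" for \<tau> \<phi>
    proof -
      have "(act U \<tau> \<phi> u \<noteq> act U \<tau> \<phi> w) = (\<phi> u \<noteq> \<phi> w)" if uw: "u \<in> V" "w \<in> V" "clash D u w" for u w
      proof -
        have "snd u \<in> {1..M}" using uw V by auto
        then have "\<tau> (snd u) permutes {1..K}" using t(1) unfolding perm_space_def PiE_iff by auto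
        then have "inj (\<tau> (snd u))" by (rule permutes_inj)
        moreover have "snd w = snd u" "u \<in> U \<longleftrightarrow> w \<in> U" using uw by (auto simp: clash_def U_def)
        ultimately show ?thesis by (simp add: act_def inj_eq)
      qed
      then show ?thesis by (simp add: free_def)
    qed
    show "u = w" if "\<phi> \<in> V \<rightarrow>\<^sub>E {1..K}" "of_bool (free D \<phi>) \<noteq> (0::real)" "u \<in> U" "w \<in> U" "snd u = snd w" "\<phi> u = \<phi> w" for \<phi> u w
    proof (rule ccontr)
      assume ne: "u \<noteq> w"
      have "free D \<phi>" using that(2) by (simp split: if_splits)
      moreover have "u \<in> V" "w \<in> V" "clash D u w" using that(3-5) ne by (auto simp: U_def clash_def)
      ultimately show False using that(6) unfolding free_def by blast
    qed
  qed
  moreover have "free_count D (S \<union> T) = (\<Sum>\<phi>\<in>V \<rightarrow>\<^sub>E {1..K}. of_bool (free D \<phi>) * of_bool (sat \<phi> S) * of_bool (sat \<phi> T))"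
    unfolding free_count_def by (intro sum.cong refl) (auto simp: sat_Un)
  ultimately show ?thesis by (simp add: free_count_def)
qed

text \<open>The submultisets with classes in \<open>D\<close> are those of the part \<open>A\<close>
  of \<open>\<eta>\<close> inside the block. By \<open>free_count_factor\<close> the edges of
  \<open>A\<close> enter through their match moments and the edges outside only as a common factor,
  so this is \<open>cumulant_conv\<close> for \<open>A\<close> times that factor.\<close>

lemma free_count_conv:
  fixes \<eta> :: "((vertex \<times> vertex) \<times> 'd) multiset"
  assumes \<eta>: "edges_of \<eta> \<subseteq> G"
  shows "(\<Sum>\<eta>1\<in>{\<eta>1. \<eta>1 \<subseteq># \<eta> \<and> classes_hit \<eta>1 \<subseteq> D}. cumulant K M e0 \<eta>1 * (free_count D (edges_of (\<eta> - \<eta>1)) / mfact (\<eta> - \<eta>1)))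
    = free_count D (insert e0 (edges_of \<eta>)) / mfact \<eta>"
proof -
  define P where "P = (\<lambda>e::(vertex \<times> vertex) \<times> 'd. c (fst (fst e)) \<in> insert c0 D)"
  define A where "A = filter_mset P \<eta>"
  define R where "R = filter_mset (\<lambda>e. \<not> P e) \<eta>"
  have eta: "\<eta> = A + R" unfolding A_def R_def by (rule multiset_partition)
  have PA: "P e" if "e \<in># A" for e using that by (simp add: A_def)
  have PR: "\<not> P e" if "e \<in># R" for e using that by (simp add: R_def)
  have G': "edges_of A \<subseteq> G" "edges_of R \<subseteq> G" using \<eta> by (auto simp: eta)
  have csP: "classes_hit B \<subseteq> D \<longleftrightarrow> (\<forall>e\<in>#B. P e)" for B
    by (auto simp: classes_hit_def edges_of_def P_def)
  have idx: "{\<eta>1. \<eta>1 \<subseteq># \<eta> \<and> classes_hit \<eta>1 \<subseteq> D} = {B. B \<subseteq># A}"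
    unfolding csP eta by (rule submultisets_filter) (use PA PR in auto)
  have disj: "set_mset B \<inter> set_mset R = {}" if "B \<subseteq># A" for B
    using PA PR mset_subset_eqD[OF that] by (meson disjoint_iff)
  have eP: "c u \<in> insert c0 D" if B: "B \<subseteq># A" and uw: "(u, w) \<in> edges_of B" for B u w
  proof -
    obtain e where e: "e \<in># B" "fst e = (u, w)" using uw unfolding edges_of_def by (metis imageE)
    then have "P e" using PA mset_subset_eqD[OF B] by blast
    then show ?thesis using e by (simp add: P_def)
  qed
  have eR: "c u \<notin> insert c0 D" if uw: "(u, w) \<in> edges_of R" for u w
  proof -
    obtain e where e: "e \<in># R" "fst e = (u, w)" using uw unfolding edges_of_def by (metis imageE)
    then have "\<not> P e" using PR by blast
    then show ?thesis using e by (simp add: P_def)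
  qed
  have step: "free_count D (edges_of (\<eta> - B)) / mfact (\<eta> - B) = match_moment K M (A - B) * (free_count D (edges_of R) / mfact R)" if B: "B \<subseteq># A" for B
  proof -
    have eq: "\<eta> - B = (A - B) + R" using B unfolding eta by (simp add: multiset_diff_union_assoc union_commute)
    have sub: "A - B \<subseteq># A" by simp
    have "free_count D (edges_of (A - B) \<union> edges_of R) = avg K M (\<lambda>\<pi>. of_bool (sat (label_of \<pi>) (edges_of (A - B)))) * free_count D (edges_of R)"
      using G' edges_of_mono[OF sub] eP[OF sub] eR by (intro free_count_factor) auto
    then show ?thesis using mfact_union_disjoint[OF disj[OF sub]] unfolding eq by (simp add: match_moment_def)
  qed
  have "(\<Sum>\<eta>1\<in>{\<eta>1. \<eta>1 \<subseteq># \<eta> \<and> classes_hit \<eta>1 \<subseteq> D}. cumulant K M e0 \<eta>1 * (free_count D (edges_of (\<eta> - \<eta>1)) / mfact (\<eta> - \<eta>1)))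
    = (\<Sum>B\<in>{B. B \<subseteq># A}. cumulant K M e0 B * match_moment K M (A - B) * (free_count D (edges_of R) / mfact R))"
    unfolding idx by (intro sum.cong refl) (simp add: step)
  also have "\<dots> = conv (cumulant K M e0) (match_moment K M) A * (free_count D (edges_of R) / mfact R)"
    unfolding conv_def by (rule sum_distrib_right[symmetric])
  also have "\<dots> = match_moment_at K M e0 A * (free_count D (edges_of R) / mfact R)" by (simp add: cumulant_conv)
  also have "\<dots> = free_count D (insert e0 (edges_of A) \<union> edges_of R) / (mfact A * mfact R)"
  proof -
    have "free_count D (insert e0 (edges_of A) \<union> edges_of R) = avg K M (\<lambda>\<pi>. of_bool (sat (label_of \<pi>) (insert e0 (edges_of A)))) * free_count D (edges_of R)"
    proof (rule free_count_factor)
      show "insert e0 (edges_of A) \<subseteq> insert e0 G" using G' by auto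
      show "c u \<in> insert c0 D" if uw: "(u, w) \<in> insert e0 (edges_of A)" for u w
      proof (cases "(u, w) = e0")
        case True
        then have "c u = c0" using e0(2) by (metis fst_conv)
        then show ?thesis by simp
      next
        case False
        then show ?thesis using eP[of A u w] uw by blast
      qed
    qed (use G' eR in blast)+
    then show ?thesis by (simp add: match_moment_at_def)
  qed
  also have "\<dots> = free_count D (insert e0 (edges_of \<eta>)) / mfact \<eta>"
    using mfact_union_disjoint[OF disj[of A]] by (simp add: eta)
  finally show ?thesis .
qed

text \<open>Inclusion-exclusion over the set \<open>D\<close> of classes coupled to
  \<open>c0\<close>.\<close>

definition alt_count :: "'c set \<Rightarrow> 'c set \<Rightarrow> (vertex \<times> vertex) set \<Rightarrow> real" where
  "alt_count A B S = (\<Sum>D\<in>{D. B \<subseteq> D \<and> D \<subseteq> A}. (-1) ^ card (A - D) * free_count D S)"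

text \<open>The alternating sum of \<open>free_count_conv\<close> over all \<open>D\<close>: a fixed
  \<open>\<eta>1\<close> occurs for the sets between its own classes and those of
  \<open>\<eta>\<close>. For \<open>\<eta>1 = \<eta>\<close> only one set remains, so the identity
  can be solved for the cumulant of \<open>\<eta>\<close>, and every other term contains an
  alternating sum over the missing classes, which is small.\<close>

lemma alt_count_conv:
  fixes \<eta> :: "((vertex \<times> vertex) \<times> 'd) multiset"
  assumes \<eta>: "edges_of \<eta> \<subseteq> G"
  shows "(\<Sum>\<eta>1\<in>{\<eta>1. \<eta>1 \<subseteq># \<eta>}. cumulant K M e0 \<eta>1 * (alt_count (classes_hit \<eta>) (classes_hit \<eta>1) (edges_of (\<eta> - \<eta>1)) / mfact (\<eta> - \<eta>1)))
    = alt_count (classes_hit \<eta>) {} (insert e0 (edges_of \<eta>)) / mfact \<eta>"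
proof -
  let ?A = "classes_hit \<eta>" and ?s = "\<lambda>D. (-1::real) ^ card (classes_hit \<eta> - D)"
  let ?g = "\<lambda>D \<eta>1. cumulant K M e0 \<eta>1 * (free_count D (edges_of (\<eta> - \<eta>1)) / mfact (\<eta> - \<eta>1))"
  have fin: "finite ?A" by (simp add: classes_hit_def)
  have "alt_count ?A {} (insert e0 (edges_of \<eta>)) / mfact \<eta> = (\<Sum>D\<in>Pow ?A. ?s D * (free_count D (insert e0 (edges_of \<eta>)) / mfact \<eta>))"
    by (simp add: alt_count_def sum_divide_distrib Pow_def)
  also have "\<dots> = (\<Sum>D\<in>Pow ?A. ?s D * (\<Sum>\<eta>1\<in>{\<eta>1. \<eta>1 \<subseteq># \<eta> \<and> classes_hit \<eta>1 \<subseteq> D}. ?g D \<eta>1))"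
    by (simp only: free_count_conv[OF \<eta>])
  also have "\<dots> = (\<Sum>D\<in>Pow ?A. \<Sum>\<eta>1\<in>{\<eta>1. \<eta>1 \<subseteq># \<eta>}. if classes_hit \<eta>1 \<subseteq> D then ?s D * (?g D \<eta>1) else 0)"
  proof (intro sum.cong refl)
    fix D
    have "{\<eta>1. \<eta>1 \<subseteq># \<eta> \<and> classes_hit \<eta>1 \<subseteq> D} = {\<eta>1. \<eta>1 \<subseteq># \<eta>} \<inter> {\<eta>1. classes_hit \<eta>1 \<subseteq> D}" by auto
    then show "?s D * (\<Sum>\<eta>1\<in>{\<eta>1. \<eta>1 \<subseteq># \<eta> \<and> classes_hit \<eta>1 \<subseteq> D}. ?g D \<eta>1)
      = (\<Sum>\<eta>1\<in>{\<eta>1. \<eta>1 \<subseteq># \<eta>}. if classes_hit \<eta>1 \<subseteq> D then ?s D * (?g D \<eta>1) else 0)"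
      by (simp only: sum_distrib_left sum.If_cases[OF finite_submultisets]) simp
  qed
  also have "\<dots> = (\<Sum>\<eta>1\<in>{\<eta>1. \<eta>1 \<subseteq># \<eta>}. \<Sum>D\<in>Pow ?A. if classes_hit \<eta>1 \<subseteq> D then ?s D * (?g D \<eta>1) else 0)"
    by (rule sum.swap)
  also have "\<dots> = (\<Sum>\<eta>1\<in>{\<eta>1. \<eta>1 \<subseteq># \<eta>}. cumulant K M e0 \<eta>1 * (alt_count ?A (classes_hit \<eta>1) (edges_of (\<eta> - \<eta>1)) / mfact (\<eta> - \<eta>1)))"
  proof (intro sum.cong refl)
    fix \<eta>1 :: "((vertex \<times> vertex) \<times> 'd) multiset"
    have "{D. classes_hit \<eta>1 \<subseteq> D \<and> D \<subseteq> ?A} = Pow ?A \<inter> {D. classes_hit \<eta>1 \<subseteq> D}" by auto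
    then have "alt_count ?A (classes_hit \<eta>1) (edges_of (\<eta> - \<eta>1)) = (\<Sum>D\<in>Pow ?A. if classes_hit \<eta>1 \<subseteq> D then ?s D * free_count D (edges_of (\<eta> - \<eta>1)) else 0)"
      using fin by (simp only: alt_count_def sum.If_cases finite_Pow_iff) simp
    then show "(\<Sum>D\<in>Pow ?A. if classes_hit \<eta>1 \<subseteq> D then ?s D * (?g D \<eta>1) else 0)
      = cumulant K M e0 \<eta>1 * (alt_count ?A (classes_hit \<eta>1) (edges_of (\<eta> - \<eta>1)) / mfact (\<eta> - \<eta>1))"
      by (simp add: sum_distrib_left sum_divide_distrib if_distrib[of "\<lambda>x. _ * x"] if_distrib[of "\<lambda>x. x / _"] mult_ac cong: if_cong)
  qed
  finally show ?thesis by simp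
qed

end

section \<open>Size of the alternating sums and of a single cumulant\<close>

context match_graph
begin

lemma sum_sat: "(\<Sum>\<phi>\<in>V \<rightarrow>\<^sub>E {1..K}. of_bool (sat \<phi> T)) = label_count V K T"
proof -
  have "labellings V K T = (V \<rightarrow>\<^sub>E {1..K}) \<inter> {\<phi>. sat \<phi> T}" by (auto simp: labellings_def)
  then show ?thesis using fin\<Phi> by (simp add: label_count_def of_bool_def sum.If_cases)
qed

text \<open>The alternating sum vanishes unless every class of \<open>A - B\<close> has a label in common with another class;
  such a coincidence divides the number of labellings by \<open>K\<close> and serves at most two classes.\<close>

lemma abs_alt_count_le:
  assumes S: "S \<subseteq> V \<times> V" and cl: "\<And>a b. (a, b) \<in> S \<Longrightarrow> c a = c b"
    and A: "finite A" "B \<subseteq> A" "c0 \<notin> A"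
  shows "\<bar>alt_count A B S\<bar> * sqrt (real K) ^ card (A - B) \<le> (2 * (real (card V))\<^sup>2) ^ card (A - B) * label_count V K S"
proof -
  let ?\<Phi> = "V \<rightarrow>\<^sub>E {1..K}" and ?v = "real (card V)"
  define Q where "Q = A - B"
  have finQ: "finite Q" using A by (simp add: Q_def)
  define y where "y \<phi> = (\<Sum>D\<in>{D. B \<subseteq> D \<and> D \<subseteq> A}. (-1) ^ card (A - D) * (of_bool (free D \<phi>) :: real))" for \<phi>
  define cross where "cross \<phi> i \<longleftrightarrow> (\<exists>u\<in>V. \<exists>w\<in>V. c u = i \<and> c w \<noteq> i \<and> \<phi> u = \<phi> w)" for \<phi> :: "vertex \<Rightarrow> nat" and i
  \<comment> \<open>A choice, for each class in \<open>Q\<close>, of a pair of vertices witnessing a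
    coincidence with another class. The number of choices gives the factor \<open>card V ^ 2\<close>
    per class; the remaining factor \<open>2\<close> per class counts the sets
    \<open>D\<close>.\<close>
  define F where "F = {f \<in> Q \<rightarrow>\<^sub>E V \<times> V. \<forall>i\<in>Q. c (fst (f i)) = i \<and> c (snd (f i)) \<noteq> i}"
  have finQE: "finite (Q \<rightarrow>\<^sub>E V \<times> V)" by (intro finite_PiE finQ finite_cartesian_product finV)
  have FQ: "F \<subseteq> Q \<rightarrow>\<^sub>E V \<times> V" by (simp add: F_def)
  then have finF: "finite F" using finQE by (rule finite_subset)
  have cardF: "real (card F) \<le> (?v\<^sup>2) ^ card Q"
  proof -
    have "card F \<le> card (Q \<rightarrow>\<^sub>E V \<times> V)" by (rule card_mono[OF finQE FQ])
    also have "\<dots> = (card V * card V) ^ card Q" using finQ by (simp add: card_PiE card_cartesian_product)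
    finally have "real (card F) \<le> real ((card V * card V) ^ card Q)" by (rule of_nat_mono)
    then show ?thesis by (simp add: power2_eq_square)
  qed
  \<comment> \<open>The clashes that coupling \<open>i\<close> adds are between \<open>i\<close> and
    other classes, and without a coincidence there they are respected automatically.\<close>
  have free_insert: "free (insert i D) \<phi> = free D \<phi>"
    if i: "\<not> cross \<phi> i" "i \<noteq> c0" "i \<notin> D" for \<phi> i D
  proof -
    have "(clash (insert i D) u w \<longrightarrow> \<phi> u \<noteq> \<phi> w) = (clash D u w \<longrightarrow> \<phi> u \<noteq> \<phi> w)" if uw: "u \<in> V" "w \<in> V" for u w
    proof (cases "\<phi> u = \<phi> w")
      case True
      have "clash (insert i D) u w = clash D u w"
      proof (cases "c u = c w")
        case False
        have "\<not> (c u = i \<and> c w \<noteq> i)" using i(1) uw True unfolding cross_def by blast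
        moreover have "\<not> (c w = i \<and> c u \<noteq> i)" using i(1) uw True[symmetric] unfolding cross_def by blast
        ultimately have "c u \<noteq> i" "c w \<noteq> i" using False by auto
        then show ?thesis by (auto simp: clash_def)
      qed (simp add: clash_def)
      then show ?thesis by simp
    qed simp
    then show ?thesis unfolding free_def by blast
  qed
  have y_le: "\<bar>y \<phi>\<bar> \<le> 2 ^ card Q * of_bool (\<forall>i\<in>Q. cross \<phi> i)" for \<phi>
  proof (cases "\<forall>i\<in>Q. cross \<phi> i")
    case True
    then show ?thesis unfolding y_def Q_def using abs_alternating_sum_le[OF A(1,2), of "\<lambda>D. of_bool (free D \<phi>)"] by simp
  next
    case False
    then obtain i where i: "i \<in> Q" "\<not> cross \<phi> i" by auto
    have "i \<noteq> c0" using i A by (auto simp: Q_def)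
    then have "y \<phi> = 0" unfolding y_def
      using i free_insert[OF i(2)] by (intro alternating_sum_eq_0[OF A(1), of i]) (auto simp: Q_def)
    then show ?thesis by simp
  qed
  have ex_f: "of_bool (sat \<phi> S) * of_bool (\<forall>i\<in>Q. cross \<phi> i) \<le> (\<Sum>f\<in>F. of_bool (sat \<phi> (S \<union> f ` Q)) :: real)" for \<phi>
  proof (cases "sat \<phi> S \<and> (\<forall>i\<in>Q. cross \<phi> i)")
    case True
    then have "\<forall>i\<in>Q. \<exists>e. e \<in> V \<times> V \<and> c (fst e) = i \<and> c (snd e) \<noteq> i \<and> \<phi> (fst e) = \<phi> (snd e)"
      unfolding cross_def by force
    then obtain g where g: "\<And>i. i \<in> Q \<Longrightarrow> g i \<in> V \<times> V \<and> c (fst (g i)) = i \<and> c (snd (g i)) \<noteq> i \<and> \<phi> (fst (g i)) = \<phi> (snd (g i))"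
      by metis
    define f where "f = restrict g Q"
    have "f \<in> F" unfolding F_def f_def using g by (simp add: PiE_iff)
    moreover have "sat \<phi> (S \<union> f ` Q)"
    proof -
      have "sat \<phi> (f ` Q)" unfolding sat_def f_def using g by (simp add: case_prod_beta)
      then show ?thesis using True by (simp add: sat_Un)
    qed
    ultimately have "(1::real) \<le> (\<Sum>f\<in>F. of_bool (sat \<phi> (S \<union> f ` Q)))"
      using member_le_sum[of f F "\<lambda>f. of_bool (sat \<phi> (S \<union> f ` Q)) :: real"] finF by simp
    then show ?thesis using True by simp
  next
    case False
    then have "of_bool (sat \<phi> S) * of_bool (\<forall>i\<in>Q. cross \<phi> i) = (0::real)" by auto
    then show ?thesis by (simp only:) (intro sum_nonneg, simp)
  qed
  have cntF: "label_count V K (S \<union> f ` Q) * sqrt (real K) ^ card Q \<le> label_count V K S" if f: "f \<in> F" for f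
  proof (rule power2_le_imp_le)
    have "(sqrt (real K) ^ card Q)\<^sup>2 = real K ^ card Q"
      by (simp add: power_mult[symmetric] mult.commute[of "card Q"]) (simp add: power_mult)
    then have "(label_count V K (S \<union> f ` Q) * sqrt (real K) ^ card Q)\<^sup>2 = (label_count V K (S \<union> f ` Q))\<^sup>2 * real K ^ card Q"
      by (simp add: power_mult_distrib)
    also have "\<dots> \<le> (label_count V K S)\<^sup>2"
    proof (rule label_count_crossing_edges[OF finV S cl finQ _ K(2)])
      fix i assume "i \<in> Q"
      then show "f i \<in> V \<times> V \<and> c (fst (f i)) = i \<and> c (snd (f i)) \<noteq> i"
        using f unfolding F_def PiE_iff by blast
    qed
    finally show "(label_count V K (S \<union> f ` Q) * sqrt (real K) ^ card Q)\<^sup>2 \<le> (label_count V K S)\<^sup>2" .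
  qed simp
  have "alt_count A B S = (\<Sum>D\<in>{D. B \<subseteq> D \<and> D \<subseteq> A}. \<Sum>\<phi>\<in>?\<Phi>. of_bool (sat \<phi> S) * ((-1) ^ card (A - D) * of_bool (free D \<phi>)))"
    unfolding alt_count_def free_count_def sum_distrib_left by (intro sum.cong refl) simp
  also have "\<dots> = (\<Sum>\<phi>\<in>?\<Phi>. \<Sum>D\<in>{D. B \<subseteq> D \<and> D \<subseteq> A}. of_bool (sat \<phi> S) * ((-1) ^ card (A - D) * of_bool (free D \<phi>)))"
    by (rule sum.swap)
  also have "\<dots> = (\<Sum>\<phi>\<in>?\<Phi>. of_bool (sat \<phi> S) * y \<phi>)"
    unfolding y_def by (simp only: sum_distrib_left)
  finally have "\<bar>alt_count A B S\<bar> \<le> (\<Sum>\<phi>\<in>?\<Phi>. \<bar>of_bool (sat \<phi> S) * y \<phi>\<bar>)"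
    using sum_abs by metis
  also have "\<dots> \<le> (\<Sum>\<phi>\<in>?\<Phi>. 2 ^ card Q * (\<Sum>f\<in>F. of_bool (sat \<phi> (S \<union> f ` Q))))"
  proof (intro sum_mono)
    fix \<phi>
    have "\<bar>of_bool (sat \<phi> S) * y \<phi>\<bar> = of_bool (sat \<phi> S) * \<bar>y \<phi>\<bar>" by (simp add: abs_mult)
    also have "\<dots> \<le> of_bool (sat \<phi> S) * (2 ^ card Q * of_bool (\<forall>i\<in>Q. cross \<phi> i))"
      by (intro mult_left_mono y_le) simp
    also have "\<dots> = 2 ^ card Q * (of_bool (sat \<phi> S) * of_bool (\<forall>i\<in>Q. cross \<phi> i))" by (simp only: mult_ac)
    also have "\<dots> \<le> 2 ^ card Q * (\<Sum>f\<in>F. of_bool (sat \<phi> (S \<union> f ` Q)))"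
      by (intro mult_left_mono ex_f) simp
    finally show "\<bar>of_bool (sat \<phi> S) * y \<phi>\<bar> \<le> 2 ^ card Q * (\<Sum>f\<in>F. of_bool (sat \<phi> (S \<union> f ` Q)))" .
  qed
  also have "\<dots> = 2 ^ card Q * (\<Sum>\<phi>\<in>?\<Phi>. \<Sum>f\<in>F. of_bool (sat \<phi> (S \<union> f ` Q)))"
    by (simp only: sum_distrib_left)
  also have "(\<Sum>\<phi>\<in>?\<Phi>. \<Sum>f\<in>F. of_bool (sat \<phi> (S \<union> f ` Q))) = (\<Sum>f\<in>F. \<Sum>\<phi>\<in>?\<Phi>. of_bool (sat \<phi> (S \<union> f ` Q)) :: real)"
    by (rule sum.swap)
  also have "\<dots> = (\<Sum>f\<in>F. label_count V K (S \<union> f ` Q))"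
    by (simp only: sum_sat)
  finally have "\<bar>alt_count A B S\<bar> * sqrt (real K) ^ card Q \<le> 2 ^ card Q * (\<Sum>f\<in>F. label_count V K (S \<union> f ` Q)) * sqrt (real K) ^ card Q"
    by (rule mult_right_mono) simp
  also have "\<dots> = 2 ^ card Q * (\<Sum>f\<in>F. label_count V K (S \<union> f ` Q) * sqrt (real K) ^ card Q)"
    by (simp only: sum_distrib_right mult.assoc)
  also have "\<dots> \<le> 2 ^ card Q * (\<Sum>f\<in>F. label_count V K S)"
    by (intro mult_left_mono sum_mono cntF) simp_all
  also have "\<dots> = 2 ^ card Q * real (card F) * label_count V K S" by simp
  also have "\<dots> \<le> 2 ^ card Q * (?v\<^sup>2) ^ card Q * label_count V K S"
    by (intro mult_right_mono mult_left_mono cardF) simp_all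
  also have "\<dots> = (2 * ?v\<^sup>2) ^ card Q * label_count V K S" by (simp only: power_mult_distrib)
  finally show ?thesis by (simp only: Q_def)
qed

lemma label_count_pair: "u \<in> V \<Longrightarrow> w \<in> V \<Longrightarrow> u \<noteq> w \<Longrightarrow> label_count V K {(u, w)} * real K = real K ^ card V"
  using label_count_insert_cut[OF finV, of "{}" "{u}" u w K] label_count_empty[OF finV, of K] by simp

text \<open>A union bound: a fixed pair of distinct vertices receives equal labels in a fraction
  \<open>1 / K\<close> of the labellings, and there are at most \<open>card V ^ 2 <= K / 2\<close>
  ordered pairs.\<close>

lemma free_count_empty_ge: "real K ^ card V \<le> 2 * free_count D {}"
proof -
  let ?\<Phi> = "V \<rightarrow>\<^sub>E {1..K}"
  define E where "E = {(u, w) \<in> V \<times> V. u \<noteq> w}"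
  have finE: "finite E" unfolding E_def using finV by (auto intro: finite_subset[of _ "V \<times> V"])
  have K0: "real K > 0" using K by simp
  have pt: "(1::real) \<le> of_bool (free D \<phi>) * of_bool (sat \<phi> {}) + (\<Sum>e\<in>E. of_bool (sat \<phi> {e}))" for \<phi>
  proof (cases "free D \<phi>")
    case True
    then show ?thesis by (simp add: sum_nonneg)
  next
    case False
    then obtain u w where uw: "u \<in> V" "w \<in> V" "clash D u w" "\<phi> u = \<phi> w" by (auto simp: free_def)
    then have "(u, w) \<in> E" by (auto simp: E_def clash_def)
    then have "(of_bool (sat \<phi> {(u, w)}) :: real) \<le> (\<Sum>e\<in>E. of_bool (sat \<phi> {e}))"
      by (rule member_le_sum[of _ E "\<lambda>e. of_bool (sat \<phi> {e})"]) (use finE in auto)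
    then show ?thesis using uw by simp
  qed
  have ce: "label_count V K {e} = real K ^ card V / real K" if "e \<in> E" for e
    using that label_count_pair K0 by (auto simp: E_def nonzero_eq_divide_eq)
  have cE: "real (card E) \<le> (real (card V))\<^sup>2"
  proof -
    have "card E \<le> card (V \<times> V)" unfolding E_def using finV by (intro card_mono) auto
    then have "card E \<le> card V * card V" by (simp add: card_cartesian_product)
    then have "real (card E) \<le> real (card V * card V)" by (rule of_nat_mono)
    then show ?thesis by (simp add: power2_eq_square)
  qed
  have "real K ^ card V = (\<Sum>\<phi>\<in>?\<Phi>. 1)" using finV by (simp add: card_PiE)
  also have "\<dots> \<le> (\<Sum>\<phi>\<in>?\<Phi>. of_bool (free D \<phi>) * of_bool (sat \<phi> {}) + (\<Sum>e\<in>E. of_bool (sat \<phi> {e})))"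
    by (intro sum_mono pt)
  also have "\<dots> = free_count D {} + (\<Sum>\<phi>\<in>?\<Phi>. \<Sum>e\<in>E. of_bool (sat \<phi> {e}))"
    by (simp only: sum.distrib free_count_def)
  also have "(\<Sum>\<phi>\<in>?\<Phi>. \<Sum>e\<in>E. of_bool (sat \<phi> {e})) = (\<Sum>e\<in>E. \<Sum>\<phi>\<in>?\<Phi>. of_bool (sat \<phi> {e}) :: real)"
    by (rule sum.swap)
  also have "\<dots> = (\<Sum>e\<in>E. label_count V K {e})" by (simp only: sum_sat)
  also have "\<dots> = (\<Sum>e\<in>E. real K ^ card V / real K)" by (intro sum.cong refl ce)
  also have "\<dots> = real (card E) / real K * real K ^ card V" by simp
  also have "\<dots> \<le> 1 / 2 * real K ^ card V"
  proof (rule mult_right_mono)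
    have "real (2 * (card V)\<^sup>2) \<le> real K" using K(1) by (rule of_nat_mono)
    then have "2 * (real (card V))\<^sup>2 \<le> real K" by simp
    then have "2 * real (card E) \<le> real K" using cE by linarith
    then show "real (card E) / real K \<le> 1 / 2" using K0 by (simp add: divide_simps)
  qed simp
  finally show ?thesis by linarith
qed

lemma alt_count_self: "alt_count A A S = free_count A S"
proof -
  have "{D. A \<subseteq> D \<and> D \<subseteq> A} = {A}" by auto
  then show ?thesis by (simp add: alt_count_def)
qed

lemma finite_classes_hit [simp]: "finite (classes_hit \<eta>)" by (simp add: classes_hit_def)

lemma classes_hit_mono: "A \<subseteq># B \<Longrightarrow> classes_hit A \<subseteq> classes_hit B"
  using edges_of_mono[of A B] by (auto simp: classes_hit_def)

lemma card_classes_hit_diff: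
  assumes "B \<subseteq># A" shows "card (classes_hit A - classes_hit B) \<le> size (A - B)"
proof -
  have "A = B + (A - B)" using assms by simp
  then have "edges_of A = edges_of B \<union> edges_of (A - B)" using edges_of_union by metis
  then have "classes_hit A - classes_hit B \<subseteq> (c \<circ> fst) ` edges_of (A - B)" by (auto simp: classes_hit_def)
  then have "card (classes_hit A - classes_hit B) \<le> card ((c \<circ> fst) ` edges_of (A - B))" by (intro card_mono) auto
  also have "\<dots> \<le> card (edges_of (A - B))" by (rule card_image_le) simp
  also have "\<dots> \<le> card (set_mset (A - B))" unfolding edges_of_def by (rule card_image_le) simp
  also have "\<dots> \<le> size (A - B)" by (rule card_set_mset_le_size)
  finally show ?thesis .
qed

end

lemma abs_div_mfact_le: "\<bar>x / mfact A\<bar> \<le> \<bar>x\<bar>"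
proof -
  have "\<bar>x / mfact A\<bar> = \<bar>x\<bar> / mfact A" by (simp add: abs_divide abs_of_pos[OF mfact_pos])
  also have "\<dots> \<le> \<bar>x\<bar> / 1" using mfact_ge_1[of A] by (intro divide_left_mono) auto
  finally show ?thesis by simp
qed

context match_graph
begin

text \<open>Induction by solving \<open>alt_count_conv\<close> for the term of \<open>\<eta>\<close>
  itself. For a smaller \<open>\<eta>1\<close>, the classes missing from it get their power of
  \<open>sqrt K\<close> from \<open>abs_alt_count_le\<close> and those of \<open>\<eta>1\<close>
  from the induction hypothesis.\<close>

lemma cumulant_bound:
  fixes \<eta> :: "((vertex \<times> vertex) \<times> 'd) multiset"
  assumes "edges_of \<eta> \<subseteq> G" "size \<eta> \<le> L" "1 \<le> L"
  shows "\<bar>cumulant K M e0 \<eta>\<bar> * sqrt (real K) ^ card (classes_hit \<eta>) * real K ^ card V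
    \<le> 6 * (8 * real L * (real (card V))\<^sup>2) ^ size \<eta> * label_count V K (insert e0 (edges_of \<eta>))"
  using assms(1,2)
proof (induction "size \<eta>" arbitrary: \<eta> rule: less_induct)
  case less
  define g where "g = 2 * (real (card V))\<^sup>2"
  \<comment> \<open>An edge outside \<open>\<eta>1\<close> contributes at most \<open>g\<close>,
    while the bound to be proved allows \<open>b\<close> per edge. The ratio is
    \<open>x = 1 / (4 * L)\<close>, which is small enough for the sum over all strict submultisets
    to be at most \<open>1 / 3\<close>.\<close>
  define b where "b = 4 * real L * g"
  define x where "x = 1 / (4 * real L)"
  let ?r = "sqrt (real K)" and ?N = "real K ^ card V" and ?A = "classes_hit \<eta>"
  let ?C = "label_count V K (insert e0 (edges_of \<eta>))" and ?n = "size \<eta>"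
  have bdef: "8 * real L * (real (card V))\<^sup>2 = b" by (simp add: b_def g_def)
  have "V \<noteq> {}" using e0 by auto
  then have "card V \<ge> 1" using finV by (simp add: Suc_leI card_gt_0_iff)
  then have "(1::real)\<^sup>2 \<le> (real (card V))\<^sup>2" by (intro power_mono) auto
  then have g1: "1 \<le> g" by (simp add: g_def)
  have L1: "1 \<le> real L" using assms(3) by simp
  then have "1 * g \<le> 4 * real L * g" using g1 by (intro mult_right_mono) auto
  then have bg: "g \<le> b" by (simp add: b_def)
  have b1: "1 \<le> b" using bg g1 by linarith
  have gx: "g = b * x" using L1 by (simp add: b_def x_def)
  have r0: "?r > 0" using K by simp
  have N0: "?N > 0" using K by simp
  have GV: "edges_of \<eta> \<subseteq> V \<times> V" "insert e0 (edges_of \<eta>) \<subseteq> V \<times> V" using less.prems G e0 by auto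
  have cle: "c a = c b" if "(a, b) \<in> insert e0 (edges_of \<eta>)" for a b
    using edge_ok[of a b] that less.prems(1) by blast
  have c0A: "c0 \<notin> ?A" by (simp add: classes_hit_def)
  have cardA: "card ?A \<le> ?n" using card_classes_hit_diff[of "{#}" \<eta>] by (simp add: classes_hit_def)
  have wpos: "?N \<le> 2 * free_count ?A {}" by (rule free_count_empty_ge)
  define T where "T \<eta>1 = cumulant K M e0 \<eta>1 * (alt_count ?A (classes_hit \<eta>1) (edges_of (\<eta> - \<eta>1)) / mfact (\<eta> - \<eta>1))" for \<eta>1
  have "(\<Sum>\<eta>1\<in>{\<eta>1. \<eta>1 \<subseteq># \<eta>}. T \<eta>1) = alt_count ?A {} (insert e0 (edges_of \<eta>)) / mfact \<eta>"
    unfolding T_def by (rule alt_count_conv[OF less.prems(1)])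
  then have "cumulant K M e0 \<eta> * free_count ?A {} = alt_count ?A {} (insert e0 (edges_of \<eta>)) / mfact \<eta> - (\<Sum>\<eta>1\<in>{\<eta>1. \<eta>1 \<subset># \<eta>}. T \<eta>1)"
    unfolding submultisets_split by (subst (asm) sum.insert) (auto simp: T_def alt_count_self)
  then have "\<bar>cumulant K M e0 \<eta> * free_count ?A {}\<bar> \<le> \<bar>alt_count ?A {} (insert e0 (edges_of \<eta>)) / mfact \<eta>\<bar> + (\<Sum>\<eta>1\<in>{\<eta>1. \<eta>1 \<subset># \<eta>}. \<bar>T \<eta>1\<bar>)"
    using sum_abs[of T "{\<eta>1. \<eta>1 \<subset># \<eta>}"] by linarith
  then have "\<bar>cumulant K M e0 \<eta> * free_count ?A {}\<bar> * ?r ^ card ?A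
     \<le> (\<bar>alt_count ?A {} (insert e0 (edges_of \<eta>)) / mfact \<eta>\<bar> + (\<Sum>\<eta>1\<in>{\<eta>1. \<eta>1 \<subset># \<eta>}. \<bar>T \<eta>1\<bar>)) * ?r ^ card ?A"
    using r0 by (intro mult_right_mono) auto
  then have main: "\<bar>cumulant K M e0 \<eta> * free_count ?A {}\<bar> * ?r ^ card ?A
     \<le> \<bar>alt_count ?A {} (insert e0 (edges_of \<eta>)) / mfact \<eta>\<bar> * ?r ^ card ?A + (\<Sum>\<eta>1\<in>{\<eta>1. \<eta>1 \<subset># \<eta>}. \<bar>T \<eta>1\<bar> * ?r ^ card ?A)"
    by (simp only: distrib_right sum_distrib_right)
  have first: "\<bar>alt_count ?A {} (insert e0 (edges_of \<eta>)) / mfact \<eta>\<bar> * ?r ^ card ?A \<le> b ^ ?n * ?C"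
  proof -
    have "\<bar>alt_count ?A {} (insert e0 (edges_of \<eta>)) / mfact \<eta>\<bar> \<le> \<bar>alt_count ?A {} (insert e0 (edges_of \<eta>))\<bar>"
      by (rule abs_div_mfact_le)
    then have "\<bar>alt_count ?A {} (insert e0 (edges_of \<eta>)) / mfact \<eta>\<bar> * ?r ^ card ?A \<le> \<bar>alt_count ?A {} (insert e0 (edges_of \<eta>))\<bar> * ?r ^ card ?A"
      using r0 by (intro mult_right_mono) auto
    also have "\<dots> \<le> g ^ card ?A * ?C"
      using abs_alt_count_le[OF GV(2) cle finite_classes_hit _ c0A, of "{}"] by (simp add: g_def)
    also have "\<dots> \<le> b ^ ?n * ?C"
    proof (rule mult_right_mono)
      have "g ^ card ?A \<le> b ^ card ?A" using bg g1 by (intro power_mono) auto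
      also have "\<dots> \<le> b ^ ?n" using b1 cardA by (rule power_increasing[rotated])
      finally show "g ^ card ?A \<le> b ^ ?n" .
    qed simp
    finally show ?thesis .
  qed
  have summand: "\<bar>T \<eta>1\<bar> * ?r ^ card ?A \<le> 6 * b ^ ?n * ?C * x ^ size (\<eta> - \<eta>1)" if s: "\<eta>1 \<subset># \<eta>" for \<eta>1
  proof -
    have sub: "\<eta>1 \<subseteq># \<eta>" using s by (rule subset_mset.less_imp_le)
    let ?S = "edges_of (\<eta> - \<eta>1)" and ?q = "card (?A - classes_hit \<eta>1)"
    have csub: "classes_hit \<eta>1 \<subseteq> ?A" using sub by (rule classes_hit_mono)
    have SG: "?S \<subseteq> edges_of \<eta>" by (rule edges_of_mono) simp
    have SV: "?S \<subseteq> V \<times> V" using SG GV by blast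
    have clS: "c a = c b" if "(a, b) \<in> ?S" for a b using that SG cle by blast
    have e1: "edges_of \<eta>1 \<subseteq> G" using edges_of_mono[OF sub] less.prems(1) by blast
    have e1V: "insert e0 (edges_of \<eta>1) \<subseteq> V \<times> V" using edges_of_mono[OF sub] GV by blast
    have IH: "\<bar>cumulant K M e0 \<eta>1\<bar> * ?r ^ card (classes_hit \<eta>1) * ?N \<le> 6 * b ^ size \<eta>1 * label_count V K (insert e0 (edges_of \<eta>1))"
      using less.hyps[OF mset_subset_size[OF s] e1] size_mset_mono[OF sub] less.prems(2) by (simp only: bdef)
    have sz: "?n = size \<eta>1 + size (\<eta> - \<eta>1)" using sub by (simp add: size_Diff_submset size_mset_mono)
    have "card ?A = card (classes_hit \<eta>1) + ?q" using csub by (simp add: card_Diff_subset card_mono)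
    then have rsplit: "?r ^ card ?A = ?r ^ card (classes_hit \<eta>1) * ?r ^ ?q" by (simp add: power_add)
    have altb: "\<bar>alt_count ?A (classes_hit \<eta>1) ?S\<bar> * ?r ^ ?q \<le> g ^ ?q * label_count V K ?S"
      using abs_alt_count_le[OF SV clS finite_classes_hit csub c0A] by (simp add: g_def)
    have gq: "g ^ ?q \<le> g ^ size (\<eta> - \<eta>1)" using g1 card_classes_hit_diff[OF sub] by (rule power_increasing[rotated])
    \<comment> \<open>Supermodularity recombines the labellings of \<open>\<eta>1\<close> with
      \<open>e0\<close> and those of the remaining edges into labellings of the whole graph. Stating
      the bound with a label count instead of a power of \<open>K\<close> lets the induction pass
      through this step.\<close>
    have sup: "label_count V K (insert e0 (edges_of \<eta>1)) * label_count V K ?S \<le> ?C * ?N"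
    proof -
      have "insert e0 (edges_of \<eta>1) \<union> ?S = insert e0 (edges_of \<eta>)"
        using edges_of_union[of \<eta>1 "\<eta> - \<eta>1"] sub by auto
      then show ?thesis using label_count_supermodular[OF finV e1V SV K(2)] by simp
    qed
    have "\<bar>T \<eta>1\<bar> \<le> \<bar>cumulant K M e0 \<eta>1\<bar> * \<bar>alt_count ?A (classes_hit \<eta>1) ?S\<bar>"
      unfolding T_def abs_mult by (intro mult_left_mono abs_div_mfact_le) simp
    then have "\<bar>T \<eta>1\<bar> * ?r ^ card ?A * ?N \<le> \<bar>cumulant K M e0 \<eta>1\<bar> * \<bar>alt_count ?A (classes_hit \<eta>1) ?S\<bar> * ?r ^ card ?A * ?N"
      using r0 N0 by (intro mult_right_mono) auto
    also have "\<dots> = (\<bar>cumulant K M e0 \<eta>1\<bar> * ?r ^ card (classes_hit \<eta>1) * ?N) * (\<bar>alt_count ?A (classes_hit \<eta>1) ?S\<bar> * ?r ^ ?q)"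
      by (simp only: rsplit mult_ac)
    also have "\<dots> \<le> (6 * b ^ size \<eta>1 * label_count V K (insert e0 (edges_of \<eta>1))) * (g ^ ?q * label_count V K ?S)"
      using r0 b1 by (intro mult_mono IH altb) auto
    also have "\<dots> = 6 * b ^ size \<eta>1 * g ^ ?q * (label_count V K (insert e0 (edges_of \<eta>1)) * label_count V K ?S)" by (simp only: mult_ac)
    also have "\<dots> \<le> 6 * b ^ size \<eta>1 * g ^ size (\<eta> - \<eta>1) * (?C * ?N)"
      using b1 g1 by (intro mult_mono sup mult_left_mono gq) auto
    also have "\<dots> = (6 * b ^ ?n * ?C * x ^ size (\<eta> - \<eta>1)) * ?N"
      by (simp add: gx power_mult_distrib power_add sz)
    finally show ?thesis using N0 by (simp only: mult_le_cancel_right_pos)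
  qed
  have "(\<Sum>\<eta>1\<in>{\<eta>1. \<eta>1 \<subset># \<eta>}. \<bar>T \<eta>1\<bar> * ?r ^ card ?A) \<le> (\<Sum>\<eta>1\<in>{\<eta>1. \<eta>1 \<subset># \<eta>}. 6 * b ^ ?n * ?C * x ^ size (\<eta> - \<eta>1))"
    by (intro sum_mono summand) simp
  also have "\<dots> = 6 * b ^ ?n * ?C * (\<Sum>\<eta>1\<in>{\<eta>1. \<eta>1 \<subset># \<eta>}. x ^ size (\<eta> - \<eta>1))" by (simp only: sum_distrib_left)
  also have "\<dots> \<le> 6 * b ^ ?n * ?C * (1 / 3)"
    using b1 L1 less.prems(2)
    by (intro mult_left_mono sum_strict_submultisets_power_le[of x L]) (auto simp: x_def)
  finally have rest: "(\<Sum>\<eta>1\<in>{\<eta>1. \<eta>1 \<subset># \<eta>}. \<bar>T \<eta>1\<bar> * ?r ^ card ?A) \<le> 2 * (b ^ ?n * ?C)" by simp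
  have w0: "free_count ?A {} > 0" using wpos N0 by linarith
  have "\<bar>cumulant K M e0 \<eta>\<bar> * ?r ^ card ?A * ?N \<le> \<bar>cumulant K M e0 \<eta>\<bar> * ?r ^ card ?A * (2 * free_count ?A {})"
    using wpos r0 by (intro mult_left_mono) auto
  also have "\<dots> = 2 * (\<bar>cumulant K M e0 \<eta> * free_count ?A {}\<bar> * ?r ^ card ?A)"
    using w0 by (simp add: abs_mult)
  \<comment> \<open>The constant \<open>6\<close> reproduces itself: the smaller graphs contribute
    \<open>6 / 3 = 2\<close>, the moment with \<open>e0\<close> contributes \<open>1\<close>, and
    dividing by the free count costs a factor \<open>2\<close>.\<close>
  also have "\<dots> \<le> 2 * (3 * (b ^ ?n * ?C))" using main first rest by linarith
  finally show ?case by (simp add: bdef)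
qed

end

text \<open>Joint cumulants vanish when their arguments split into two independent groups, here the
  layers in \<open>L\<close> and the others. In the convolution for \<open>\<eta>\<close> the
  subgraphs inside \<open>L\<close> already produce the whole moment, the other strict subgraphs
  vanish by induction, and so the term of \<open>\<eta>\<close> has to be zero.\<close>

lemma cumulant_eq_0_layers:
  fixes \<theta> :: "((vertex \<times> vertex) \<times> 'd) multiset"
  assumes cl: "\<And>u w. (u, w) \<in> insert e0 (edges_of \<theta>) \<Longrightarrow> snd u \<in> L \<longleftrightarrow> snd w \<in> L" and e0: "snd (fst e0) \<in> L"
    and e: "e \<in># \<theta>" "snd (fst (fst e)) \<notin> L"
  shows "cumulant K M e0 \<theta> = 0"
proof -
  have avg_split: "avg K M (\<lambda>\<pi>. of_bool (sat (label_of \<pi>) (S \<union> T))) = avg K M (\<lambda>\<pi>. of_bool (sat (label_of \<pi>) S)) * avg K M (\<lambda>\<pi>. of_bool (sat (label_of \<pi>) T))"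
    if S: "\<And>e. e \<in> S \<Longrightarrow> snd (fst e) \<in> L \<and> snd (snd e) \<in> L" and T: "\<And>e. e \<in> T \<Longrightarrow> snd (fst e) \<notin> L \<and> snd (snd e) \<notin> L" for S T
  proof -
    have "avg K M (\<lambda>\<pi>. of_bool (sat (label_of \<pi>) S) * of_bool (sat (label_of \<pi>) T)) = avg K M (\<lambda>\<pi>. of_bool (sat (label_of \<pi>) S)) * avg K M (\<lambda>\<pi>. of_bool (sat (label_of \<pi>) T))"
    proof (rule avg_indep_layers[of L])
      show "of_bool (sat (label_of \<pi>) S) = of_bool (sat (label_of \<pi>') S)" if p: "\<And>m. m \<in> L \<Longrightarrow> \<pi> m = \<pi>' m" for \<pi> \<pi>'
      proof -
        have "sat (label_of \<pi>) S = sat (label_of \<pi>') S"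
        proof (rule sat_cong)
          fix u assume "u \<in> fst ` S \<union> snd ` S"
          then have "snd u \<in> L" using S by auto
          then show "label_of \<pi> u = label_of \<pi>' u" using p by (simp add: label_of_def case_prod_beta)
        qed
        then show ?thesis by simp
      qed
      show "of_bool (sat (label_of \<pi>) T) = of_bool (sat (label_of \<pi>') T)" if p: "\<And>m. m \<notin> L \<Longrightarrow> \<pi> m = \<pi>' m" for \<pi> \<pi>'
      proof -
        have "sat (label_of \<pi>) T = sat (label_of \<pi>') T"
        proof (rule sat_cong)
          fix u assume "u \<in> fst ` T \<union> snd ` T"
          then have "snd u \<notin> L" using T by auto
          then show "label_of \<pi> u = label_of \<pi>' u" using p by (simp add: label_of_def case_prod_beta)
        qed
        then show ?thesis by simp
      qed
    qed
    then show ?thesis by (simp add: sat_Un of_bool_conj)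
  qed
  define P where "P = (\<lambda>e::(vertex \<times> vertex) \<times> 'd. snd (fst (fst e)) \<in> L)"
  have P2: "P f \<longleftrightarrow> snd (snd (fst f)) \<in> L" if f: "f \<in># \<theta>" for f
  proof -
    have "(fst (fst f), snd (fst f)) \<in> insert e0 (edges_of \<theta>)" using f by (simp add: edges_of_def)
    then show ?thesis unfolding P_def by (rule cl)
  qed
  have "cumulant K M e0 \<eta> = 0" if "\<eta> \<subseteq># \<theta>" "\<exists>e\<in>#\<eta>. \<not> P e" for \<eta>
    using that
  proof (induction "size \<eta>" arbitrary: \<eta> rule: less_induct)
    case less
    define A where "A = filter_mset P \<eta>"
    define R where "R = filter_mset (\<lambda>e. \<not> P e) \<eta>"
    have eta: "\<eta> = A + R" unfolding A_def R_def by (rule multiset_partition)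
    have PA: "P e" if "e \<in># A" for e using that by (simp add: A_def)
    have PR: "\<not> P e" if "e \<in># R" for e using that by (simp add: R_def)
    have in\<theta>: "f \<in># \<theta>" if "f \<in># A \<or> f \<in># R" for f
      using mset_subset_eqD[OF less.prems(1), of f] that by (auto simp: eta)
    have idx: "{B. B \<subseteq># \<eta> \<and> (\<forall>e\<in>#B. P e)} = {B. B \<subseteq># A}"
      unfolding eta by (rule submultisets_filter) (use PA PR in auto)
    have disj: "set_mset B \<inter> set_mset R = {}" if "B \<subseteq># A" for B
      using PA PR mset_subset_eqD[OF that] by (meson disjoint_iff)
    have LA: "snd (fst f) \<in> L \<and> snd (snd f) \<in> L" if B: "B \<subseteq># A" and f: "f \<in> edges_of B" for B f
    proof -
      obtain e where e: "e \<in># B" "f = fst e" using f by (auto simp: edges_of_def)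
      then have "e \<in># A" using mset_subset_eqD[OF B] by simp
      then show ?thesis using PA[of e] P2[of e] in\<theta>[of e] e by (simp add: P_def)
    qed
    have LR: "snd (fst f) \<notin> L \<and> snd (snd f) \<notin> L" if f: "f \<in> edges_of R" for f
    proof -
      obtain e where e: "e \<in># R" "f = fst e" using f by (auto simp: edges_of_def)
      then show ?thesis using PR[of e] P2[of e] in\<theta>[of e] by (simp add: P_def)
    qed
    have Le0: "snd (fst e0) \<in> L \<and> snd (snd e0) \<in> L"
      using e0 cl[of "fst e0" "snd e0"] by simp
    have moR: "match_moment K M (\<eta> - B) = match_moment K M (A - B) * match_moment K M R" if B: "B \<subseteq># A" for B
    proof -
      have eq: "\<eta> - B = (A - B) + R" using B unfolding eta by (simp add: multiset_diff_union_assoc union_commute)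
      have sub: "A - B \<subseteq># A" by simp
      have "avg K M (\<lambda>\<pi>. of_bool (sat (label_of \<pi>) (edges_of (A - B) \<union> edges_of R))) = avg K M (\<lambda>\<pi>. of_bool (sat (label_of \<pi>) (edges_of (A - B)))) * avg K M (\<lambda>\<pi>. of_bool (sat (label_of \<pi>) (edges_of R)))"
        using LA[OF sub] LR by (rule avg_split)
      then show ?thesis using mfact_union_disjoint[OF disj[OF sub]] unfolding eq by (simp add: match_moment_def)
    qed
    have "avg K M (\<lambda>\<pi>. of_bool (sat (label_of \<pi>) (insert e0 (edges_of A) \<union> edges_of R))) = avg K M (\<lambda>\<pi>. of_bool (sat (label_of \<pi>) (insert e0 (edges_of A)))) * avg K M (\<lambda>\<pi>. of_bool (sat (label_of \<pi>) (edges_of R)))"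
      using LA[of A] LR Le0 by (intro avg_split) blast+
    then have moxR: "match_moment_at K M e0 \<eta> = match_moment_at K M e0 A * match_moment K M R"
      using mfact_union_disjoint[OF disj[of A]] unfolding eta by (simp add: match_moment_at_def match_moment_def)
    have "\<eta> \<noteq> A" using less.prems(2) PA by blast
    have "match_moment_at K M e0 \<eta> = (\<Sum>B\<in>{B. B \<subseteq># \<eta>}. cumulant K M e0 B * match_moment K M (\<eta> - B))"
      by (rule cumulant_conv[unfolded conv_def, symmetric])
    also have "\<dots> = (\<Sum>B\<in>insert \<eta> {B. B \<subseteq># A}. cumulant K M e0 B * match_moment K M (\<eta> - B))"
    proof (rule sum.mono_neutral_right)
      show "insert \<eta> {B. B \<subseteq># A} \<subseteq> {B. B \<subseteq># \<eta>}"
        by (auto simp: eta intro: subset_mset.order_trans[OF _ mset_subset_eq_add_left])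
      show "\<forall>B\<in>{B. B \<subseteq># \<eta>} - insert \<eta> {B. B \<subseteq># A}. cumulant K M e0 B * match_moment K M (\<eta> - B) = 0"
      proof
        fix B assume B: "B \<in> {B. B \<subseteq># \<eta>} - insert \<eta> {B. B \<subseteq># A}"
        then have s: "B \<subset># \<eta>" by (simp add: subset_mset.less_le)
        have "B \<notin> {B. B \<subseteq># \<eta> \<and> (\<forall>e\<in>#B. P e)}" using B unfolding idx by blast
        then have "\<exists>e\<in>#B. \<not> P e" using B by blast
        moreover have "B \<subseteq># \<theta>" using s less.prems(1) by (meson subset_mset.less_imp_le subset_mset.order_trans)
        ultimately have "cumulant K M e0 B = 0" using less.hyps[OF mset_subset_size[OF s]] by blast
        then show "cumulant K M e0 B * match_moment K M (\<eta> - B) = 0" by simp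
      qed
    qed simp
    also have "\<dots> = cumulant K M e0 \<eta> + (\<Sum>B\<in>{B. B \<subseteq># A}. cumulant K M e0 B * match_moment K M (\<eta> - B))"
    proof (subst sum.insert)
      show "\<eta> \<notin> {B. B \<subseteq># A}" using \<open>\<eta> \<noteq> A\<close> eta by (metis mem_Collect_eq mset_subset_eq_add_left subset_mset.antisym)
    qed simp_all
    also have "(\<Sum>B\<in>{B. B \<subseteq># A}. cumulant K M e0 B * match_moment K M (\<eta> - B)) = conv (cumulant K M e0) (match_moment K M) A * match_moment K M R"
      unfolding conv_def sum_distrib_right by (intro sum.cong refl) (simp add: moR)
    also have "\<dots> = match_moment_at K M e0 \<eta>" by (simp add: cumulant_conv moxR)
    finally show ?case by simp
  qed
  then show ?thesis using e by (auto simp: P_def)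
qed

section \<open>The squared cumulant of one multigraph in terms of its vertices and layers\<close>

definition verts :: "vertex \<times> vertex \<Rightarrow> ((vertex \<times> vertex) \<times> 'd) multiset \<Rightarrow> vertex set" where
  "verts e0 \<theta> = fst ` insert e0 (edges_of \<theta>) \<union> snd ` insert e0 (edges_of \<theta>)"

lemma finite_verts [simp]: "finite (verts e0 \<theta>)" by (simp add: verts_def)

lemma card_edges_of_le: "card (edges_of \<theta>) \<le> size \<theta>"
  unfolding edges_of_def using card_image_le[of "set_mset \<theta>" fst] card_set_mset_le_size[of \<theta>] by simp

lemma card_verts_le: "card (verts e0 \<theta>) \<le> 2 * size \<theta> + 2"
proof -
  let ?G = "insert e0 (edges_of \<theta>)"
  have g: "card ?G \<le> size \<theta> + 1" using card_edges_of_le[of \<theta>] card_insert_le_m1[of "size \<theta> + 1" "edges_of \<theta>" e0] by simp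
  have "card (verts e0 \<theta>) \<le> card (fst ` ?G) + card (snd ` ?G)" unfolding verts_def by (rule card_Un_le)
  also have "\<dots> \<le> card ?G + card ?G" by (intro add_mono card_image_le) auto
  finally show ?thesis using g by simp
qed

lemma label_count_le_classes:
  assumes V: "finite V" and c: "\<And>\<phi> u w. sat \<phi> S \<Longrightarrow> u \<in> V \<Longrightarrow> w \<in> V \<Longrightarrow> c u = c w \<Longrightarrow> \<phi> u = \<phi> w"
  shows "label_count V K S \<le> real K ^ card (c ` V)"
proof -
  let ?E = "c ` V \<rightarrow>\<^sub>E {1..K}"
  have fin: "finite ?E" using V by (intro finite_PiE) auto
  have "labellings V K S \<subseteq> (\<lambda>g. restrict (g \<circ> c) V) ` ?E"
  proof
    fix \<phi> assume \<phi>: "\<phi> \<in> labellings V K S"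
    define g where "g = (\<lambda>i\<in>c ` V. \<phi> (SOME u. u \<in> V \<and> c u = i))"
    have some: "(SOME u. u \<in> V \<and> c u = i) \<in> V \<and> c (SOME u. u \<in> V \<and> c u = i) = i" if i: "i \<in> c ` V" for i
    proof -
      obtain u where "u \<in> V \<and> c u = i" using i by blast
      then show ?thesis by (rule someI)
    qed
    have "g \<in> ?E"
    proof (rule PiE_I)
      fix i assume i: "i \<in> c ` V"
      have "\<phi> \<in> V \<rightarrow>\<^sub>E {1..K}" using \<phi> by (simp add: labellings_def)
      then show "g i \<in> {1..K}" using some[OF i] i by (simp add: g_def PiE_iff del: image_iff)
    qed (simp add: g_def)
    moreover have "\<phi> = restrict (g \<circ> c) V"
    proof
      fix u
      show "\<phi> u = restrict (g \<circ> c) V u"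
      proof (cases "u \<in> V")
        case True
        then have i: "c u \<in> c ` V" by simp
        have "\<phi> u = \<phi> (SOME w. w \<in> V \<and> c w = c u)"
          using some[OF i] True \<phi> by (intro c) (auto simp: labellings_def)
        then show ?thesis using True by (simp add: g_def)
      next
        case False
        have "\<phi> \<in> extensional V" using \<phi> by (simp add: labellings_def PiE_def)
        then show ?thesis using False by (simp add: extensional_def)
      qed
    qed
    ultimately show "\<phi> \<in> (\<lambda>g. restrict (g \<circ> c) V) ` ?E" by blast
  qed
  then have "card (labellings V K S) \<le> card ((\<lambda>g. restrict (g \<circ> c) V) ` ?E)" using fin by (intro card_mono) auto
  also have "\<dots> \<le> card ?E" using fin by (rule card_image_le)
  also have "\<dots> = K ^ card (c ` V)" using V by (simp add: card_PiE)
  finally have "real (card (labellings V K S)) \<le> real (K ^ card (c ` V))" by (rule of_nat_mono)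
  then show ?thesis by (simp add: label_count_def)
qed

lemma label_count_layers_ge:
  assumes V: "finite V"
  shows "real K ^ card (h ` V) \<le> label_count V K {(u, w) \<in> V \<times> V. h u = h w}"
proof -
  let ?E = "h ` V \<rightarrow>\<^sub>E {1..K}" and ?F = "{(u, w) \<in> V \<times> V. h u = h w}"
  have "card ?E \<le> card (labellings V K ?F)"
  proof (rule card_inj_on_le[of "\<lambda>g. restrict (g \<circ> h) V"])
    show "inj_on (\<lambda>g. restrict (g \<circ> h) V) ?E"
    proof (rule inj_onI)
      fix g g' assume a: "g \<in> ?E" "g' \<in> ?E" "restrict (g \<circ> h) V = restrict (g' \<circ> h) V"
      have "g i = g' i" if "i \<in> h ` V" for i
      proof -
        obtain u where u: "u \<in> V" "i = h u" using \<open>i \<in> h ` V\<close> by blast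
        have "restrict (g \<circ> h) V u = restrict (g' \<circ> h) V u" using a(3) by simp
        then show ?thesis using u by simp
      qed
      moreover have "g \<in> extensional (h ` V)" "g' \<in> extensional (h ` V)" using a by (auto simp: PiE_def)
      ultimately show "g = g'" by (metis extensionalityI)
    qed
    show "(\<lambda>g. restrict (g \<circ> h) V) ` ?E \<subseteq> labellings V K ?F"
    proof clarify
      fix g assume g: "g \<in> ?E"
      have "restrict (g \<circ> h) V \<in> V \<rightarrow>\<^sub>E {1..K}"
      proof (rule restrict_PiE_iff[THEN iffD2], rule ballI)
        fix u assume "u \<in> V"
        then have "h u \<in> h ` V" by simp
        then show "(g \<circ> h) u \<in> {1..K}" using g by (simp only: o_apply PiE_iff)
      qed
      moreover have "sat (restrict (g \<circ> h) V) ?F" unfolding sat_def by auto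
      ultimately show "restrict (g \<circ> h) V \<in> labellings V K ?F" by (simp add: labellings_def)
    qed
  qed (use V in simp)
  moreover have "card ?E = K ^ card (h ` V)" using V by (simp add: card_PiE)
  ultimately have "K ^ card (h ` V) \<le> card (labellings V K ?F)" by simp
  then have "real (K ^ card (h ` V)) \<le> real (card (labellings V K ?F))" by (rule of_nat_mono)
  then show ?thesis by (simp add: label_count_def)
qed

lemma label_count_Un_ge:
  assumes V: "finite V" and S: "S \<subseteq> V \<times> V" and T: "finite T" "T \<subseteq> V \<times> V" and K: "1 \<le> K"
  shows "label_count V K S \<le> label_count V K (S \<union> T) * real K ^ card T"
  using T
proof (induction T rule: finite_induct)
  case (insert e T)
  obtain u w where e: "e = (u, w)" by (cases e)
  have uw: "u \<in> V" "w \<in> V" and TV: "T \<subseteq> V \<times> V" using insert.prems e by auto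
  have "label_count V K S \<le> label_count V K (S \<union> T) * real K ^ card T" using insert.IH[OF TV] .
  also have "\<dots> \<le> (label_count V K (insert (u, w) (S \<union> T)) * real K) * real K ^ card T"
    using S TV by (intro mult_right_mono label_count_insert_ge[OF V _ uw K]) auto
  finally show ?case using insert.hyps e by (simp add: mult.assoc)
qed simp

text \<open>Let \<open>C\<close> be the label count of the graph, \<open>v\<close> and
  \<open>t\<close> its numbers of vertices and layers, and \<open>q\<close> the number of classes
  besides \<open>c0\<close>. The square of \<open>cumulant_bound\<close> controls the squared
  cumulant times \<open>K ^ (q + 2 * v)\<close> by \<open>C ^ 2\<close>. One factor \<open>C\<close>
  is at most \<open>K ^ (q + 1)\<close> and the other satisfies
  \<open>C * K ^ t <= K ^ (1 + v)\<close>, so \<open>q\<close> cancels. The base comes from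
  \<open>8 * L * v ^ 2\<close> with \<open>v <= 2 * L + 2\<close>.\<close>

lemma cumulant_sq_bound:
  fixes \<theta> :: "((vertex \<times> vertex) \<times> 'd) multiset"
  assumes e0: "e0 \<in> ({1..K} \<times> {1..M}) \<times> ({1..K} \<times> {1..M})" and edges_of: "edges_of \<theta> \<subseteq> ({1..K} \<times> {1..M}) \<times> ({1..K} \<times> {1..M})"
    and L: "size \<theta> \<le> L" "1 \<le> L" and K: "2 * (2 * L + 2)\<^sup>2 \<le> K" and nz: "cumulant K M e0 \<theta> \<noteq> 0"
  defines "V \<equiv> verts e0 \<theta>"
  shows "(cumulant K M e0 \<theta>)\<^sup>2 * real K ^ card V * real K ^ card (snd ` V)
      \<le> 36 * ((32 * real L * (real L + 1)\<^sup>2) ^ size \<theta>)\<^sup>2 * (real K)\<^sup>2"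
    and "card (snd ` V) \<le> size \<theta> + 2"
proof -
  let ?G = "insert e0 (edges_of \<theta>)"
  \<comment> \<open>\<open>F\<close> merges the vertices of each layer. By itself it has at least
    \<open>K ^ t\<close> labellings, which is the input for supermodularity.\<close>
  define F where "F = {(u, w) \<in> V \<times> V. snd u = snd w}"
  define c where "c u = {z. (u, z) \<in> (?G \<union> ?G\<inverse>)\<^sup>*}" for u
  have finV: "finite V" by (simp add: V_def)
  have GV: "?G \<subseteq> V \<times> V" unfolding V_def verts_def by force
  have GV1: "edges_of \<theta> \<subseteq> V \<times> V" and e0V: "e0 \<in> V \<times> V" using GV by auto
  have FV: "F \<subseteq> V \<times> V" by (auto simp: F_def)
  have ce: "c u = c w" if "(u, w) \<in> ?G" for u w
  proof -
    have "(u, w) \<in> ?G \<union> ?G\<inverse>" "(w, u) \<in> ?G \<union> ?G\<inverse>" using that by auto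
    then show ?thesis unfolding c_def by (auto intro: converse_rtrancl_into_rtrancl)
  qed
  have V0: "V \<subseteq> {1..K} \<times> {1..M}"
    unfolding V_def verts_def using e0 edges_of by (auto simp: subset_iff)
  have vle: "card V \<le> 2 * L + 2" using card_verts_le[of e0 \<theta>] L by (simp add: V_def)
  have K1: "1 \<le> K" using K by (simp add: power2_eq_square)
  have K8: "2 \<le> K" using K by (simp add: power2_eq_square)
  have KV: "2 * (card V)\<^sup>2 \<le> K"
    using K power_mono[OF vle, of 2] by linarith
  define c0 where "c0 = c (fst e0)"
  have ce0: "c (snd e0) = c0" unfolding c0_def using ce[of "fst e0" "snd e0"] by simp
  interpret G: match_graph K M V c c0 e0 "edges_of \<theta>"
  proof
    show "c u = c w" if "(u, w) \<in> edges_of \<theta>" for u w using that by (intro ce) auto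
  qed (use V0 KV K1 GV1 e0V ce0 in \<open>auto simp: c0_def\<close>)
  \<comment> \<open>Since the cumulant is nonzero, \<open>cumulant_eq_0_layers\<close> with
    \<open>Ly\<close>, the layers reachable from that of \<open>e0\<close>, shows that all layers
    are reachable. Then graph and \<open>F\<close> together admit only constant labellings.\<close>
  have conn: "\<phi> u = \<phi> w" if s: "sat \<phi> (?G \<union> F)" and uw: "u \<in> V" "w \<in> V" for \<phi> :: "vertex \<Rightarrow> nat" and u w
  proof -
    define R where "R = map_prod snd snd ` ?G"
    define Ly where "Ly = {m. (snd (fst e0), m) \<in> (R \<union> R\<inverse>)\<^sup>*}"
    have cl: "snd a \<in> Ly \<longleftrightarrow> snd b \<in> Ly" if "(a, b) \<in> ?G" for a b
    proof -
      have "(snd a, snd b) \<in> R" unfolding R_def using that by (metis map_prod_simp imageI)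
      then show ?thesis unfolding Ly_def by (auto intro: rtrancl_into_rtrancl)
    qed
    have e0L: "snd (fst e0) \<in> Ly" by (simp add: Ly_def)
    have all: "snd a \<in> Ly \<and> snd b \<in> Ly" if ab: "(a, b) \<in> ?G" for a b
    proof -
      have "snd a \<in> Ly"
      proof (cases "(a, b) = e0")
        case True
        then show ?thesis using e0L by (metis fst_conv)
      next
        case False
        then obtain e where e: "e \<in># \<theta>" "fst e = (a, b)" using ab by (auto simp: edges_of_def)
        show ?thesis
        proof (rule ccontr)
          assume "snd a \<notin> Ly"
          then have "cumulant K M e0 \<theta> = 0" using cumulant_eq_0_layers[OF cl e0L e(1)] e(2) by simp
          then show False using nz by simp
        qed
      qed
      then show ?thesis using cl[OF ab] by simp
    qed
    have VL: "snd z \<in> Ly" if z: "z \<in> V" for z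
    proof -
      obtain e where "e \<in> ?G" "z = fst e \<or> z = snd e" using z unfolding V_def verts_def by blast
      then show ?thesis using all[of "fst e" "snd e"] by auto
    qed
    have e0V': "fst e0 \<in> V" using e0V by auto
    have sF: "\<phi> a = \<phi> b" if "a \<in> V" "b \<in> V" "snd a = snd b" for a b
    proof -
      have "(a, b) \<in> F" using that by (simp add: F_def)
      then show ?thesis using s unfolding sat_Un sat_def by blast
    qed
    have reach: "\<forall>z\<in>V. snd z = m \<longrightarrow> \<phi> z = \<phi> (fst e0)" if "(snd (fst e0), m) \<in> (R \<union> R\<inverse>)\<^sup>*" for m
      using that
    proof (induction rule: rtrancl_induct)
      case base
      then show ?case using sF e0V' by blast
    next
      case (step m m')
      obtain a b where ab: "(a, b) \<in> ?G" "(m = snd a \<and> m' = snd b) \<or> (m = snd b \<and> m' = snd a)"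
      proof -
        have "(m, m') \<in> R \<or> (m', m) \<in> R" using step.hyps(2) by auto
        then obtain e where e: "e \<in> ?G" "(m, m') = map_prod snd snd e \<or> (m', m) = map_prod snd snd e"
          unfolding R_def by (elim disjE imageE) simp_all
        have "(fst e, snd e) \<in> ?G" using e(1) by simp
        moreover have "(m = snd (fst e) \<and> m' = snd (snd e)) \<or> (m = snd (snd e) \<and> m' = snd (fst e))"
          using e(2) by (auto simp: map_prod_def case_prod_beta)
        ultimately show ?thesis by (rule that)
      qed
      have abV: "a \<in> V" "b \<in> V" using ab(1) GV by auto
      have eq: "\<phi> a = \<phi> b" using s ab(1) unfolding sat_Un sat_def by blast
      show ?case
      proof (intro ballI impI)
        fix z assume z: "z \<in> V" "snd z = m'"
        show "\<phi> z = \<phi> (fst e0)"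
          using ab(2)
        proof
          assume "m = snd a \<and> m' = snd b"
          then show ?thesis using sF[OF z(1) abV(2)] z(2) eq step.IH abV by auto
        next
          assume "m = snd b \<and> m' = snd a"
          then show ?thesis using sF[OF z(1) abV(1)] z(2) eq step.IH abV by auto
        qed
      qed
    qed
    have "\<phi> z = \<phi> (fst e0)" if "z \<in> V" for z
      using reach[of "snd z"] VL[OF that] that by (simp add: Ly_def)
    then show ?thesis using uw by simp
  qed
  let ?v = "card V" and ?t = "card (snd ` V)" and ?k = "real K"
  have K0: "?k > 0" using K1 by simp
  have one: "label_count V K (?G \<union> F) \<le> ?k"
  proof -
    have "label_count V K (?G \<union> F) \<le> ?k ^ card ((\<lambda>_. ()) ` V)"
      using conn by (intro label_count_le_classes[OF finV]) blast
    also have "\<dots> \<le> ?k ^ 1"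
    proof (rule power_increasing)
      have "card ((\<lambda>_. ()) ` V) \<le> card {()}" by (intro card_mono) auto
      then show "card ((\<lambda>_. ()) ` V) \<le> 1" by simp
    qed (use K1 in simp)
    finally show ?thesis by simp
  qed
  have lay: "?k ^ ?t \<le> label_count V K F" unfolding F_def by (rule label_count_layers_ge[OF finV])
  have a: "label_count V K ?G * ?k ^ ?t \<le> ?k * ?k ^ ?v"
  proof -
    have "label_count V K ?G * ?k ^ ?t \<le> label_count V K ?G * label_count V K F" by (intro mult_left_mono lay) simp
    also have "\<dots> \<le> label_count V K (?G \<union> F) * ?k ^ ?v" by (rule label_count_supermodular[OF finV GV FV K1])
    also have "\<dots> \<le> ?k * ?k ^ ?v" by (intro mult_right_mono one) simp
    finally show ?thesis .
  qed
  have b: "label_count V K ?G \<le> ?k ^ (card (G.classes_hit \<theta>) + 1)"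
  proof -
    have "label_count V K ?G \<le> ?k ^ card (c ` V)"
    proof (rule label_count_le_classes[OF finV])
      fix \<phi> u w assume "sat \<phi> ?G" "c u = c w"
      moreover have "w \<in> c w" by (simp add: c_def)
      ultimately have "w \<in> c u" by simp
      then have "(u, w) \<in> (?G \<union> ?G\<inverse>)\<^sup>*" unfolding c_def by (rule CollectD)
      then show "\<phi> u = \<phi> w" using \<open>sat \<phi> ?G\<close> by (rule sat_connected)
    qed
    also have "\<dots> \<le> ?k ^ (card (G.classes_hit \<theta>) + 1)"
    proof (rule power_increasing)
      have "c ` V \<subseteq> insert c0 (G.classes_hit \<theta>)"
      proof
        fix i assume "i \<in> c ` V"
        then obtain z where z: "z \<in> V" "i = c z" by auto
        then obtain e where e: "e \<in> ?G" "z = fst e \<or> z = snd e" unfolding V_def verts_def by blast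
        then have "i = c (fst e)" using z ce[of "fst e" "snd e"] by auto
        then have i: "i = (c \<circ> fst) e" by simp
        show "i \<in> insert c0 (G.classes_hit \<theta>)"
        proof (cases "e = e0")
          case True
          then show ?thesis by (simp add: i c0_def)
        next
          case False
          then have "i \<in> (c \<circ> fst) ` edges_of \<theta>" using e(1) unfolding i by blast
          then show ?thesis unfolding G.classes_hit_def by blast
        qed
      qed
      then have "card (c ` V) \<le> card (insert c0 (G.classes_hit \<theta>))" by (intro card_mono) auto
      also have "\<dots> \<le> card (G.classes_hit \<theta>) + 1" by (simp add: card_insert_if)
      finally show "card (c ` V) \<le> card (G.classes_hit \<theta>) + 1" .
    qed (use K1 in simp)
    finally show ?thesis .
  qed
  define B where "B = (32 * real L * (real L + 1)\<^sup>2) ^ size \<theta>"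
  define q where "q = card (G.classes_hit \<theta>)"
  let ?C = "label_count V K ?G" and ?kp = "\<bar>cumulant K M e0 \<theta>\<bar>"
  have "?kp * sqrt ?k ^ q * ?k ^ ?v \<le> 6 * (8 * real L * (real ?v)\<^sup>2) ^ size \<theta> * ?C"
    unfolding q_def by (rule G.cumulant_bound[OF subset_refl L])
  also have "\<dots> \<le> 6 * B * ?C"
    unfolding B_def
  proof (intro mult_right_mono mult_left_mono power_mono)
    have "real ?v \<le> 2 * (real L + 1)" using vle by simp
    then have "(real ?v)\<^sup>2 \<le> (2 * (real L + 1))\<^sup>2" by (intro power_mono) auto
    then have "8 * real L * (real ?v)\<^sup>2 \<le> 8 * real L * (2 * (real L + 1))\<^sup>2" by (intro mult_left_mono) auto
    also have "8 * real L * (2 * (real L + 1))\<^sup>2 = 32 * real L * (real L + 1)\<^sup>2"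
      by (simp only: power_mult_distrib) simp
    finally show "8 * real L * (real ?v)\<^sup>2 \<le> 32 * real L * (real L + 1)\<^sup>2" .
  qed auto
  finally have m: "?kp * sqrt ?k ^ q * ?k ^ ?v \<le> 6 * B * ?C" .
  have "(?kp * sqrt ?k ^ q * ?k ^ ?v)\<^sup>2 \<le> (6 * B * ?C)\<^sup>2"
    using m by (intro power_mono) auto
  moreover have "(sqrt ?k ^ q)\<^sup>2 = ?k ^ q"
    by (simp add: power_mult[symmetric] mult.commute[of q]) (simp add: power_mult)
  ultimately have m2: "(cumulant K M e0 \<theta>)\<^sup>2 * ?k ^ q * (?k ^ ?v)\<^sup>2 \<le> 36 * B\<^sup>2 * ?C\<^sup>2"
    by (simp add: power_mult_distrib)
  have "((cumulant K M e0 \<theta>)\<^sup>2 * ?k ^ ?v * ?k ^ ?t) * (?k ^ q * ?k ^ ?v) = ((cumulant K M e0 \<theta>)\<^sup>2 * ?k ^ q * (?k ^ ?v)\<^sup>2) * ?k ^ ?t"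
    by (simp only: power2_eq_square mult_ac)
  also have "\<dots> \<le> (36 * B\<^sup>2 * ?C\<^sup>2) * ?k ^ ?t"
    by (intro mult_right_mono m2) simp
  also have "\<dots> = 36 * B\<^sup>2 * (?C * (?C * ?k ^ ?t))" by (simp only: power2_eq_square mult_ac)
  also have "\<dots> \<le> 36 * B\<^sup>2 * (?k ^ (q + 1) * (?k * ?k ^ ?v))"
  proof (rule mult_left_mono)
    show "?C * (?C * ?k ^ ?t) \<le> ?k ^ (q + 1) * (?k * ?k ^ ?v)"
      by (rule mult_mono[OF b[folded q_def] a]) simp_all
  qed simp
  also have "\<dots> = (36 * B\<^sup>2 * ?k\<^sup>2) * (?k ^ q * ?k ^ ?v)" by (simp add: power2_eq_square)
  finally show "(cumulant K M e0 \<theta>)\<^sup>2 * ?k ^ ?v * ?k ^ ?t \<le> 36 * ((32 * real L * (real L + 1)\<^sup>2) ^ size \<theta>)\<^sup>2 * ?k\<^sup>2"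
    using K0 unfolding B_def by (simp only: mult_le_cancel_right_pos zero_less_power mult_pos_pos)
  \<comment> \<open>Connecting \<open>t\<close> layers takes \<open>t - 1\<close> edges: each edge
    divides the \<open>K ^ t\<close> labellings of \<open>F\<close> by at most \<open>K\<close>, and
    at most \<open>K\<close> remain.\<close>
  have "?k ^ ?t \<le> label_count V K F" by (rule lay)
  also have "\<dots> \<le> label_count V K (F \<union> ?G) * ?k ^ card ?G" by (rule label_count_Un_ge[OF finV FV _ GV K1]) simp
  also have "\<dots> \<le> ?k * ?k ^ card ?G" using one by (intro mult_right_mono) (auto simp: Un_commute)
  also have "\<dots> = ?k ^ (card ?G + 1)" by simp
  finally have "?t \<le> card ?G + 1" using K8 by (subst (asm) power_increasing_iff) auto
  also have "card ?G \<le> size \<theta> + 1" using card_edges_of_le[of \<theta>] card_insert_le_m1[of "size \<theta> + 1" "edges_of \<theta>" e0] by simp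
  finally show "?t \<le> size \<theta> + 2" by simp
qed

section \<open>Summing squared cumulants over multigraphs\<close>

text \<open>\<open>vweight\<close> is a summable majorant: inserting a new vertex costs \<open>1/K\<close> and opening a new layer another
  \<open>1/max(K, M)\<close>, which compensates the \<open>K M\<close> possible positions.\<close>

definition vweight :: "nat \<Rightarrow> nat \<Rightarrow> vertex set \<Rightarrow> real" where
  "vweight K M X = (1 / real K) ^ card X * (1 / max (real K) (real M)) ^ card (snd ` X)"

lemma vweight_nonneg [simp]: "vweight K M X \<ge> 0"
  by (simp add: vweight_def)

text \<open>An old vertex costs nothing and there are \<open>card X\<close> of them. A new vertex on
  an old layer costs \<open>1 / K\<close>, with at most \<open>K * card X\<close> positions. A new
  layer costs \<open>1 / (K * max K M)\<close>, with at most \<open>K * M\<close> positions.\<close>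

lemma sum_vweight_insert_le:
  assumes X: "finite X" and K: "1 \<le> K"
  shows "(\<Sum>u\<in>{1..K} \<times> {1..M}. vweight K M (insert u X)) \<le> (2 * real (card X) + 1) * vweight K M X"
proof -
  let ?V = "{1..K} \<times> {1..M}" and ?N = "max (real K) (real M)" and ?w = "vweight K M X"
  have K0: "real K > 0" using K by simp
  have N0: "?N > 0" using K0 by simp
  have "vweight K M (insert u X) \<le> ?w * (of_bool (u \<in> X) + of_bool (snd u \<in> snd ` X) / real K + 1 / (real K * ?N))" for u
  proof -
    consider "u \<in> X" | "u \<notin> X" "snd u \<in> snd ` X" | "u \<notin> X" "snd u \<notin> snd ` X" by blast
    then show ?thesis
    proof cases
      case 1
      then have "?w * 1 \<le> ?w * (of_bool (u \<in> X) + of_bool (snd u \<in> snd ` X) / real K + 1 / (real K * ?N))"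
        using N0 K0 by (intro mult_left_mono) auto
      then show ?thesis using 1 by (simp add: insert_absorb)
    next
      case 2
      then have e: "vweight K M (insert u X) = ?w * (1 / real K)"
        using X by (simp add: vweight_def insert_absorb)
      have "?w * (1 / real K) \<le> ?w * (of_bool (u \<in> X) + of_bool (snd u \<in> snd ` X) / real K + 1 / (real K * ?N))"
        using 2 N0 K0 by (intro mult_left_mono) auto
      then show ?thesis by (simp only: e)
    next
      case 3
      then have "vweight K M (insert u X) = ?w * (1 / (real K * ?N))"
        using X by (simp add: vweight_def)
      then show ?thesis using 3 by simp
    qed
  qed
  then have "(\<Sum>u\<in>?V. vweight K M (insert u X)) \<le> (\<Sum>u\<in>?V. ?w * (of_bool (u \<in> X) + of_bool (snd u \<in> snd ` X) / real K + 1 / (real K * ?N)))"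
    by (rule sum_mono)
  also have "\<dots> = ?w * ((\<Sum>u\<in>?V. of_bool (u \<in> X)) + (\<Sum>u\<in>?V. of_bool (snd u \<in> snd ` X)) / real K + (\<Sum>u\<in>?V. 1 / (real K * ?N)))"
    by (simp only: sum_distrib_left[symmetric] sum.distrib sum_divide_distrib[symmetric])
  also have "\<dots> \<le> ?w * (real (card X) + real (card X) + 1)"
  proof (intro mult_left_mono add_mono)
    have "(\<Sum>u\<in>?V. of_bool (u \<in> X)) = real (card (?V \<inter> X))"
      by (simp add: of_bool_def sum.If_cases Int_def)
    also have "\<dots> \<le> real (card X)" using X by (intro of_nat_mono card_mono) auto
    finally show "(\<Sum>u\<in>?V. of_bool (u \<in> X)) \<le> real (card X)" .
    have "(\<Sum>u\<in>?V. of_bool (snd u \<in> snd ` X)) = real (card (?V \<inter> {u. snd u \<in> snd ` X}))"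
      by (simp add: of_bool_def sum.If_cases)
    also have "\<dots> \<le> real (card ({1..K} \<times> (snd ` X)))"
    proof (intro of_nat_mono card_mono subsetI)
      fix u assume "u \<in> ?V \<inter> {u. snd u \<in> snd ` X}"
      then show "u \<in> {1..K} \<times> (snd ` X)" unfolding Int_iff mem_Collect_eq mem_Times_iff by blast
    qed (use X in simp)
    also have "\<dots> = real K * real (card (snd ` X))" by (simp add: card_cartesian_product)
    also have "\<dots> \<le> real K * real (card X)" using card_image_le[OF X, of snd] by (intro mult_left_mono of_nat_mono) auto
    finally show "(\<Sum>u\<in>?V. of_bool (snd u \<in> snd ` X)) / real K \<le> real (card X)"
      using K0 by (simp add: divide_le_eq mult.commute)
    have "(\<Sum>u\<in>?V. 1 / (real K * ?N)) = (real K * real M) / (real K * ?N)" by (simp add: card_cartesian_product)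
    also have "\<dots> = real M / ?N" using K0 by simp
    also have "\<dots> \<le> 1" using N0 by (simp add: divide_le_eq_1)
    finally show "(\<Sum>u\<in>?V. 1 / (real K * ?N)) \<le> 1" .
  qed simp
  finally show ?thesis by (simp add: algebra_simps)
qed

lemma verts_empty [simp]: "verts e0 {#} = {fst e0, snd e0}"
  by (auto simp: verts_def)

lemma verts_add_mset: "verts e0 (add_mset ((u, w), d) \<theta>) = insert u (insert w (verts e0 \<theta>))"
  by (auto simp: verts_def edges_of_def)

text \<open>Lists replace multisets so that edges can be inserted one by one. An edge inserts two
  vertices and carries one of \<open>p\<close> coordinates.\<close>

lemma sum_vweight_lists_le:
  assumes K: "1 \<le> K" and L: "l \<le> L"
  shows "(\<Sum>s\<in>{s. set s \<subseteq> (({1..K} \<times> {1..M}) \<times> ({1..K} \<times> {1..M})) \<times> {1..p} \<and> length s = l}. vweight K M (verts e0 (mset s)))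
    \<le> (real p * (4 * real L + 3)\<^sup>2) ^ l * vweight K M {fst e0, snd e0}"
  using L
proof (induction l)
  case 0
  have "{s. set s \<subseteq> (({1..K} \<times> {1..M}) \<times> ({1..K} \<times> {1..M})) \<times> {1..p} \<and> length s = 0} = {[]}"
    by auto
  then show ?case by simp
next
  case (Suc l)
  let ?V = "{1..K} \<times> {1..M}"
  let ?E = "(?V \<times> ?V) \<times> {1..p}"
  let ?Ls = "\<lambda>l. {s. set s \<subseteq> ?E \<and> length s = l}"
  have fin: "finite (?Ls l)" by (intro finite_lists_length_eq) auto
  have Ls: "?Ls (Suc l) = (\<lambda>(e, s). e # s) ` (?E \<times> ?Ls l)"
    by (auto simp: length_Suc_conv image_iff)
  have "(\<Sum>s\<in>?Ls (Suc l). vweight K M (verts e0 (mset s))) = (\<Sum>(e, s)\<in>?E \<times> ?Ls l. vweight K M (verts e0 (add_mset e (mset s))))"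
    unfolding Ls by (subst sum.reindex) (auto simp: inj_on_def case_prod_beta intro!: sum.cong)
  also have "\<dots> = (\<Sum>e\<in>?E. \<Sum>s\<in>?Ls l. vweight K M (verts e0 (add_mset e (mset s))))"
    by (rule sum.cartesian_product[symmetric])
  also have "\<dots> = (\<Sum>s\<in>?Ls l. \<Sum>e\<in>?E. vweight K M (verts e0 (add_mset e (mset s))))"
    by (rule sum.swap)
  also have "\<dots> \<le> (\<Sum>s\<in>?Ls l. (real p * (4 * real L + 3)\<^sup>2) * vweight K M (verts e0 (mset s)))"
  proof (rule sum_mono)
    fix s assume s: "s \<in> ?Ls l"
    let ?X = "verts e0 (mset s)"
    have cX: "real (card ?X) \<le> 2 * real l + 2" using card_verts_le[of e0 "mset s"] s by simp
    have lL: "real l + 1 \<le> real L" using Suc.prems by simp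
    define f where "f q = vweight K M (insert (fst q) (insert (snd q) ?X))" for q
    have "(\<Sum>e\<in>?E. vweight K M (verts e0 (add_mset e (mset s)))) = (\<Sum>e\<in>?E. f (fst e))"
    proof (rule sum.cong[OF refl])
      fix e :: "(vertex \<times> vertex) \<times> nat"
      show "vweight K M (verts e0 (add_mset e (mset s))) = f (fst e)"
        using verts_add_mset[of e0 "fst (fst e)" "snd (fst e)" "snd e" "mset s"] by (simp add: f_def)
    qed
    also have "\<dots> = (\<Sum>q\<in>?V \<times> ?V. \<Sum>d\<in>{1..p}. f q)"
      by (subst sum.cartesian_product) (simp add: case_prod_beta)
    also have "\<dots> = real p * (\<Sum>q\<in>?V \<times> ?V. f q)"
      by (simp add: sum_distrib_left)
    also have "(\<Sum>q\<in>?V \<times> ?V. f q) = (\<Sum>u\<in>?V. \<Sum>w\<in>?V. f (u, w))"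
      by (subst sum.cartesian_product) simp
    also have "\<dots> = (\<Sum>w\<in>?V. \<Sum>u\<in>?V. f (u, w))" by (rule sum.swap)
    also have "\<dots> = (\<Sum>w\<in>?V. \<Sum>u\<in>?V. vweight K M (insert u (insert w ?X)))" by (simp add: f_def)
    \<comment> \<open>Once \<open>w\<close> is present there are at most \<open>2 * l + 3\<close>
      vertices, and \<open>2 * (2 * l + 3) + 1 = 4 * (l + 1) + 3\<close>.\<close>
    also have "\<dots> \<le> (\<Sum>w\<in>?V. (4 * real L + 3) * vweight K M (insert w ?X))"
    proof (rule sum_mono)
      fix w
      have "(\<Sum>u\<in>?V. vweight K M (insert u (insert w ?X))) \<le> (2 * real (card (insert w ?X)) + 1) * vweight K M (insert w ?X)"
        by (rule sum_vweight_insert_le) (use K in auto)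
      also have "\<dots> \<le> (4 * real L + 3) * vweight K M (insert w ?X)"
      proof (rule mult_right_mono)
        have "real (card (insert w ?X)) \<le> real (card ?X) + 1" by (simp add: card_insert_if)
        then show "2 * real (card (insert w ?X)) + 1 \<le> 4 * real L + 3" using cX lL by linarith
      qed simp
      finally show "(\<Sum>u\<in>?V. vweight K M (insert u (insert w ?X))) \<le> (4 * real L + 3) * vweight K M (insert w ?X)" .
    qed
    also have "\<dots> = (4 * real L + 3) * (\<Sum>w\<in>?V. vweight K M (insert w ?X))" by (simp only: sum_distrib_left)
    also have "\<dots> \<le> (4 * real L + 3) * ((2 * real (card ?X) + 1) * vweight K M ?X)"
      using K by (intro mult_left_mono sum_vweight_insert_le) auto
    also have "\<dots> \<le> (4 * real L + 3) * ((4 * real L + 3) * vweight K M ?X)"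
      using cX lL by (intro mult_left_mono mult_right_mono) auto
    also have "\<dots> = (4 * real L + 3)\<^sup>2 * vweight K M ?X" by (simp add: power2_eq_square)
    finally show "(\<Sum>e\<in>?E. vweight K M (verts e0 (add_mset e (mset s)))) \<le> (real p * (4 * real L + 3)\<^sup>2) * vweight K M ?X"
      by (simp add: mult_left_mono mult.assoc)
  qed
  also have "\<dots> = (real p * (4 * real L + 3)\<^sup>2) * (\<Sum>s\<in>?Ls l. vweight K M (verts e0 (mset s)))"
    by (simp only: sum_distrib_left)
  also have "\<dots> \<le> (real p * (4 * real L + 3)\<^sup>2) * ((real p * (4 * real L + 3)\<^sup>2) ^ l * vweight K M {fst e0, snd e0})"
    using Suc by (intro mult_left_mono) auto
  finally show ?case by (simp add: mult.assoc)
qed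

definition coloured_edges :: "nat \<Rightarrow> nat \<Rightarrow> nat \<Rightarrow> ((vertex \<times> vertex) \<times> nat) set" where
  "coloured_edges K M p = (({1..K} \<times> {1..M}) \<times> ({1..K} \<times> {1..M})) \<times> {1..p}"

definition multisets_of :: "'a set \<Rightarrow> nat \<Rightarrow> 'a multiset set" where
  "multisets_of E l = {\<theta>. set_mset \<theta> \<subseteq> E \<and> size \<theta> = l}"

lemma multisets_of_eq: "multisets_of E l = mset ` {s. set s \<subseteq> E \<and> length s = l}"
proof (intro set_eqI iffI)
  fix \<theta> assume "\<theta> \<in> multisets_of E l"
  moreover obtain s where "mset s = \<theta>" using ex_mset by blast
  ultimately have "mset s = \<theta>" "set s \<subseteq> E" "length s = l" by (auto simp: multisets_of_def)
  then show "\<theta> \<in> mset ` {s. set s \<subseteq> E \<and> length s = l}" by blast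
qed (auto simp: multisets_of_def)

lemma finite_multisets_of [simp]: "finite E \<Longrightarrow> finite (multisets_of E l)"
  unfolding multisets_of_eq by (intro finite_imageI finite_lists_length_eq)

lemma card_multisets_of_le: "finite E \<Longrightarrow> card (multisets_of E l) \<le> card E ^ l"
  unfolding multisets_of_eq
  by (rule order_trans[OF card_image_le]) (auto simp: card_lists_length_eq finite_lists_length_eq)

text \<open>To use \<open>vweight\<close>, the power \<open>K ^ (-t)\<close> is written as that of
  \<open>max K M\<close> times \<open>max 1 (M / K) ^ t\<close>, where \<open>t <= l + 2\<close>.
  This puts one factor \<open>max 1 (M / K)\<close> on each edge. The two surplus ones, with the
  factor \<open>K ^ 2\<close> of \<open>cumulant_sq_bound\<close>, leave \<open>1 / K ^ 2\<close>
  against the weight of the endpoints of \<open>e0\<close>, which lie on two layers. Summing over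
  lists only repeats nonnegative terms.\<close>

lemma sum_cumulant_sq_le:
  assumes e0: "e0 \<in> ({1..K} \<times> {1..M}) \<times> ({1..K} \<times> {1..M})" and e0l: "snd (fst e0) \<noteq> snd (snd e0)"
    and L: "l \<le> L" "1 \<le> L" and K: "2 * (2 * L + 2)\<^sup>2 \<le> K"
  shows "(\<Sum>\<theta>\<in>multisets_of (coloured_edges K M p) l. (cumulant K M e0 \<theta>)\<^sup>2)
    \<le> 36 / (real K)\<^sup>2 * ((32 * real L * (real L + 1)\<^sup>2)\<^sup>2 * (4 * real L + 3)\<^sup>2 * real p * max 1 (real M / real K)) ^ l"
proof -
  let ?k = "real K" and ?N = "max (real K) (real M)" and ?\<mu> = "max 1 (real M / real K)"
  let ?E = "coloured_edges K M p" and ?B = "32 * real L * (real L + 1)\<^sup>2"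
  let ?Ls = "{s. set s \<subseteq> ?E \<and> length s = l}"
  have K1: "1 \<le> K" using K by (simp add: power2_eq_square)
  have k0: "?k > 0" using K1 by simp
  have N0: "?N > 0" using k0 by simp
  have N: "?N = ?k * ?\<mu>" using k0 by (simp add: max_mult_distrib_left)
  have \<mu>1: "1 \<le> ?\<mu>" by simp
  define c where "c = 36 * (?B ^ l)\<^sup>2 * ?k\<^sup>2 * ?\<mu> ^ (l + 2)"
  have c0: "c \<ge> 0" by (simp add: c_def)
  have pt: "(cumulant K M e0 (mset s))\<^sup>2 \<le> c * vweight K M (verts e0 (mset s))" if s: "s \<in> ?Ls" for s
  proof (cases "cumulant K M e0 (mset s) = 0")
    case False
    let ?v = "card (verts e0 (mset s))" and ?t = "card (snd ` verts e0 (mset s))"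
    have edges_of: "edges_of (mset s) \<subseteq> ({1..K} \<times> {1..M}) \<times> ({1..K} \<times> {1..M})"
      using s unfolding edges_of_def coloured_edges_def by auto
    have sz: "size (mset s) = l" using s by simp
    have a: "(cumulant K M e0 (mset s))\<^sup>2 * ?k ^ ?v * ?k ^ ?t \<le> 36 * (?B ^ l)\<^sup>2 * ?k\<^sup>2"
      using cumulant_sq_bound(1)[OF e0 edges_of _ L(2) K False] L(1) unfolding sz by simp
    have t: "?t \<le> l + 2" using cumulant_sq_bound(2)[OF e0 edges_of _ L(2) K False] L(1) unfolding sz by simp
    have "(cumulant K M e0 (mset s))\<^sup>2 = ((cumulant K M e0 (mset s))\<^sup>2 * ?k ^ ?v * ?k ^ ?t) * ((1 / ?k) ^ ?v * (1 / ?k) ^ ?t)"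
      using k0 by (simp add: power_divide)
    also have "\<dots> \<le> (36 * (?B ^ l)\<^sup>2 * ?k\<^sup>2) * ((1 / ?k) ^ ?v * (1 / ?k) ^ ?t)"
      by (intro mult_right_mono a) simp
    also have "(1 / ?k) ^ ?t = (1 / ?N) ^ ?t * ?\<mu> ^ ?t"
      unfolding power_mult_distrib[symmetric] N using k0 \<mu>1 by (simp add: field_simps)
    also have "(36 * (?B ^ l)\<^sup>2 * ?k\<^sup>2) * ((1 / ?k) ^ ?v * ((1 / ?N) ^ ?t * ?\<mu> ^ ?t))
       \<le> (36 * (?B ^ l)\<^sup>2 * ?k\<^sup>2) * ((1 / ?k) ^ ?v * ((1 / ?N) ^ ?t * ?\<mu> ^ (l + 2)))"
      using \<mu>1 t N0 k0 by (intro mult_left_mono power_increasing) auto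
    also have "\<dots> = c * vweight K M (verts e0 (mset s))" by (simp only: c_def vweight_def mult_ac)
    finally show ?thesis .
  qed (simp add: c0)
  have finE: "finite ?E" by (simp add: coloured_edges_def)
  have "(\<Sum>\<theta>\<in>multisets_of ?E l. (cumulant K M e0 \<theta>)\<^sup>2) \<le> (\<Sum>s\<in>?Ls. (cumulant K M e0 (mset s))\<^sup>2)"
    unfolding multisets_of_eq by (rule sum_image_le[OF finite_lists_length_eq[OF finE], unfolded o_def]) simp
  also have "\<dots> \<le> (\<Sum>s\<in>?Ls. c * vweight K M (verts e0 (mset s)))" by (rule sum_mono) (rule pt)
  also have "\<dots> = c * (\<Sum>s\<in>?Ls. vweight K M (verts e0 (mset s)))" by (simp only: sum_distrib_left)
  also have "\<dots> \<le> c * ((real p * (4 * real L + 3)\<^sup>2) ^ l * vweight K M {fst e0, snd e0})"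
    using sum_vweight_lists_le[OF K1 L(1), of M e0 p] c0 by (intro mult_left_mono) (auto simp: coloured_edges_def)
  also have "vweight K M {fst e0, snd e0} = (1 / ?k)\<^sup>2 * (1 / ?N)\<^sup>2"
  proof -
    have "fst e0 \<noteq> snd e0" using e0l by auto
    then show ?thesis using e0l by (simp add: vweight_def numeral_2_eq_2)
  qed
  also have "c * ((real p * (4 * real L + 3)\<^sup>2) ^ l * ((1 / ?k)\<^sup>2 * (1 / ?N)\<^sup>2))
     = 36 * (1 / ?k)\<^sup>2 * (?B\<^sup>2 * (4 * real L + 3)\<^sup>2 * real p * ?\<mu>) ^ l * (?k\<^sup>2 * (?\<mu>\<^sup>2 * (1 / ?N)\<^sup>2))"
  proof -
    have "(36 * (b ^ l)\<^sup>2 * x * m ^ (l + 2)) * ((r * q) ^ l * (y * z)) = 36 * y * (b\<^sup>2 * q * r * m) ^ l * (x * (m\<^sup>2 * z))"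
      for b x m r q y z :: real
      by (simp add: power_mult_distrib power_add power2_eq_square)
    then show ?thesis unfolding c_def .
  qed
  also have "?k\<^sup>2 * (?\<mu>\<^sup>2 * (1 / ?N)\<^sup>2) = 1"
    unfolding N using k0 \<mu>1 by (simp add: power_mult_distrib power_divide)
  finally show ?thesis by (simp add: power_divide)
qed

section \<open>Isserlis' formula\<close>

lemma conv_assoc: "conv (conv f g) h A = conv f (conv g h) A"
proof -
  have "conv (conv f g) h A = (\<Sum>(B, C)\<in>Sigma {B. B \<subseteq># A} (\<lambda>B. {C. C \<subseteq># B}). f C * g (B - C) * h (A - B))"
    unfolding conv_def sum_distrib_right by (subst sum.Sigma) auto
  also have "\<dots> = (\<Sum>(C, D)\<in>Sigma {C. C \<subseteq># A} (\<lambda>C. {D. D \<subseteq># A - C}). f C * (g D * h (A - C - D)))"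
  proof (rule sum.reindex_bij_witness[of _ "\<lambda>(C, D). (C + D, C)" "\<lambda>(B, C). (C, B - C)"])
    fix q assume "q \<in> Sigma {B. B \<subseteq># A} (\<lambda>B. {C. C \<subseteq># B})"
    then obtain B C where q: "q = (B, C)" "B \<subseteq># A" "C \<subseteq># B" by auto
    have CA: "C \<subseteq># A" using q by (meson subset_mset.order_trans)
    have "count B x - count C x \<le> count A x - count C x" for x
      using mset_subset_eq_count[OF q(2)] by (simp add: diff_le_mono)
    then have BC: "B - C \<subseteq># A - C" by (simp add: subseteq_mset_def)
    show "(case case q of (B, C) \<Rightarrow> (C, B - C) of (C, D) \<Rightarrow> (C + D, C)) = q" using q by simp
    show "(case q of (B, C) \<Rightarrow> (C, B - C)) \<in> Sigma {C. C \<subseteq># A} (\<lambda>C. {D. D \<subseteq># A - C})"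
      using q CA BC by simp
    have "A - C - (B - C) = A - B" using q by (simp add: diff_diff_add_mset)
    then show "(case case q of (B, C) \<Rightarrow> (C, B - C) of (C, D) \<Rightarrow> f C * (g D * h (A - C - D)))
      = (case q of (B, C) \<Rightarrow> f C * g (B - C) * h (A - B))" by (simp add: q)
  next
    fix q assume "q \<in> Sigma {C. C \<subseteq># A} (\<lambda>C. {D. D \<subseteq># A - C})"
    then obtain C D where q: "q = (C, D)" "C \<subseteq># A" "D \<subseteq># A - C" by auto
    show "(case case q of (C, D) \<Rightarrow> (C + D, C) of (B, C) \<Rightarrow> (C, B - C)) = q" using q by simp
    have "C + D \<subseteq># A" using q by (metis subset_mset.add_diff_inverse subset_mset.add_left_mono)
    then show "(case q of (C, D) \<Rightarrow> (C + D, C)) \<in> Sigma {B. B \<subseteq># A} (\<lambda>B. {C. C \<subseteq># B})" using q by simp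
  qed
  also have "\<dots> = conv f (conv g h) A"
    unfolding conv_def sum_distrib_left by (subst sum.Sigma) auto
  finally show ?thesis .
qed

section \<open>Multigraphs with prescribed degrees\<close>

type_synonym entry = "nat \<times> nat \<times> nat"
type_synonym cedge = "(vertex \<times> vertex) \<times> nat"

definition end1 :: "cedge \<Rightarrow> entry" where
  "end1 e = (fst (fst (fst e)), snd (fst (fst e)), snd e)"

definition end2 :: "cedge \<Rightarrow> entry" where
  "end2 e = (fst (snd (fst e)), snd (snd (fst e)), snd e)"

definition ends :: "cedge multiset \<Rightarrow> entry multiset" where
  "ends \<theta> = image_mset end1 \<theta> + image_mset end2 \<theta>"

lemma ends_empty [simp]: "ends {#} = {#}" by (simp add: ends_def)
lemma ends_union [simp]: "ends (A + B) = ends A + ends B" by (simp add: ends_def)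
lemma ends_add_mset: "ends (add_mset e A) = {#end1 e, end2 e#} + ends A" by (simp add: ends_def)
lemma size_ends [simp]: "size (ends \<theta>) = 2 * size \<theta>" by (simp add: ends_def)

lemma finite_coloured_edges [simp]: "finite (coloured_edges K M p)"
  by (simp add: coloured_edges_def)

text \<open>The multigraphs with degree sequence \<open>A\<close>, where a loop counts
  twice.\<close>

definition fibre :: "cedge set \<Rightarrow> entry multiset \<Rightarrow> cedge multiset set" where
  "fibre E A = {\<theta>. set_mset \<theta> \<subseteq> E \<and> ends \<theta> = A}"

lemma fibre_subset: "fibre E A \<subseteq> multisets_of E (size A div 2)"
  by (auto simp: fibre_def multisets_of_def)

lemma finite_fibre [simp]: "finite E \<Longrightarrow> finite (fibre E A)"
  by (rule finite_subset[OF fibre_subset finite_multisets_of])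

text \<open>The coefficient at \<open>A\<close> after substituting \<open>c t_i t_j\<close> for the
  variable of an edge with ends \<open>i\<close> and \<open>j\<close> in a power series. A
  substitution respects products, which is \<open>push_conv\<close>.\<close>

definition push :: "cedge set \<Rightarrow> real \<Rightarrow> (cedge multiset \<Rightarrow> real) \<Rightarrow> entry multiset \<Rightarrow> real" where
  "push E c g A = (\<Sum>\<theta>\<in>fibre E A. c ^ size \<theta> * g \<theta>)"

lemma push_conv:
  assumes E: "finite E"
  shows "push E c (conv f g) A = conv (push E c f) (push E c g) A"
proof -
  have "push E c (conv f g) A = (\<Sum>(\<theta>, \<eta>)\<in>Sigma (fibre E A) (\<lambda>\<theta>. {\<eta>. \<eta> \<subseteq># \<theta>}). c ^ size \<theta> * (f \<eta> * g (\<theta> - \<eta>)))"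
    unfolding push_def conv_def sum_distrib_left using E by (subst sum.Sigma) auto
  also have "\<dots> = (\<Sum>(B, \<eta>, \<zeta>)\<in>Sigma {B. B \<subseteq># A} (\<lambda>B. fibre E B \<times> fibre E (A - B)). (c ^ size \<eta> * f \<eta>) * (c ^ size \<zeta> * g \<zeta>))"
  proof (rule sum.reindex_bij_witness[of _ "\<lambda>(B, \<eta>, \<zeta>). (\<eta> + \<zeta>, \<eta>)" "\<lambda>(\<theta>, \<eta>). (ends \<eta>, \<eta>, \<theta> - \<eta>)"])
    fix q assume "q \<in> Sigma (fibre E A) (\<lambda>\<theta>. {\<eta>. \<eta> \<subseteq># \<theta>})"
    then obtain \<theta> \<eta> where q: "q = (\<theta>, \<eta>)" "set_mset \<theta> \<subseteq> E" "ends \<theta> = A" "\<eta> \<subseteq># \<theta>" by (auto simp: fibre_def)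
    have th: "\<theta> = \<eta> + (\<theta> - \<eta>)" using q by simp
    have A: "A = ends \<eta> + ends (\<theta> - \<eta>)" using q(3) th ends_union by metis
    have sub: "set_mset \<eta> \<subseteq> E" "set_mset (\<theta> - \<eta>) \<subseteq> E"
      using q(2) set_mset_mono[OF q(4)] in_diffD[of _ \<theta> \<eta>] by blast+
    show "(case case q of (\<theta>, \<eta>) \<Rightarrow> (ends \<eta>, \<eta>, \<theta> - \<eta>) of (B, \<eta>, \<zeta>) \<Rightarrow> (\<eta> + \<zeta>, \<eta>)) = q" using q th by simp
    show "(case q of (\<theta>, \<eta>) \<Rightarrow> (ends \<eta>, \<eta>, \<theta> - \<eta>)) \<in> Sigma {B. B \<subseteq># A} (\<lambda>B. fibre E B \<times> fibre E (A - B))"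
      using sub A by (simp add: q(1) fibre_def)
    have "size \<theta> = size \<eta> + size (\<theta> - \<eta>)" using th size_union by metis
    then show "(case case q of (\<theta>, \<eta>) \<Rightarrow> (ends \<eta>, \<eta>, \<theta> - \<eta>) of (B, \<eta>, \<zeta>) \<Rightarrow> (c ^ size \<eta> * f \<eta>) * (c ^ size \<zeta> * g \<zeta>))
      = (case q of (\<theta>, \<eta>) \<Rightarrow> c ^ size \<theta> * (f \<eta> * g (\<theta> - \<eta>)))"
      by (simp add: q(1) power_add)
  next
    fix q assume "q \<in> Sigma {B. B \<subseteq># A} (\<lambda>B. fibre E B \<times> fibre E (A - B))"
    then obtain B \<eta> \<zeta> where q: "q = (B, \<eta>, \<zeta>)" "B \<subseteq># A" "\<eta> \<in> fibre E B" "\<zeta> \<in> fibre E (A - B)" by auto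
    show "(case case q of (B, \<eta>, \<zeta>) \<Rightarrow> (\<eta> + \<zeta>, \<eta>) of (\<theta>, \<eta>) \<Rightarrow> (ends \<eta>, \<eta>, \<theta> - \<eta>)) = q"
      using q by (simp add: fibre_def)
    show "(case q of (B, \<eta>, \<zeta>) \<Rightarrow> (\<eta> + \<zeta>, \<eta>)) \<in> Sigma (fibre E A) (\<lambda>\<theta>. {\<eta>. \<eta> \<subseteq># \<theta>})"
      using q by (simp add: fibre_def)
  qed
  also have "\<dots> = (\<Sum>B\<in>{B. B \<subseteq># A}. \<Sum>(\<eta>, \<zeta>)\<in>fibre E B \<times> fibre E (A - B). (c ^ size \<eta> * f \<eta>) * (c ^ size \<zeta> * g \<zeta>))"
    using E by (subst sum.Sigma) auto
  also have "\<dots> = conv (push E c f) (push E c g) A"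
    unfolding conv_def push_def sum_product by (simp add: sum.cartesian_product)
  finally show ?thesis .
qed

text \<open>The coefficients of \<open>exp(sum t_e 1_e)\<close> for fixed labels; averaging them
  over the permutations gives \<open>match_moment\<close>.\<close>

definition eps :: "(vertex \<Rightarrow> nat) \<Rightarrow> cedge multiset \<Rightarrow> real" where
  "eps \<phi> \<theta> = of_bool (sat \<phi> (edges_of \<theta>)) / mfact \<theta>"

lemma edges_of_add_mset [simp]: "edges_of (add_mset e A) = insert (fst e) (edges_of A)" by (simp add: edges_of_def)

lemma eps_add_mset:
  "real (count \<theta> e + 1) * eps \<phi> (add_mset e \<theta>) = of_bool (\<phi> (fst (fst e)) = \<phi> (snd (fst e))) * eps \<phi> \<theta>"
proof -
  have "sat \<phi> (insert (fst e) (edges_of \<theta>)) \<longleftrightarrow> \<phi> (fst (fst e)) = \<phi> (snd (fst e)) \<and> sat \<phi> (edges_of \<theta>)"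
    using sat_insert[of \<phi> "fst (fst e)" "snd (fst e)" "edges_of \<theta>"] by simp
  then show ?thesis by (simp add: eps_def mfact_add_mset del: of_nat_Suc of_nat_add)
qed

text \<open>The coefficients of \<open>t_i d/dt_i\<close>, with \<open>i = i0\<close>, applied to
  the exponential of a quadratic form. Each occurrence of \<open>i0\<close> in \<open>A\<close> is
  an end of some edge, and deleting that edge cancels its multiplicity against the factorial in
  \<open>eps\<close>. A loop at \<open>i0\<close> is counted at both ends.\<close>

lemma push_eps_recursion:
  fixes A :: "entry multiset"
  assumes E: "finite E"
  shows "real (count A i0) * push E c (eps \<phi>) A
    = (\<Sum>e\<in>E. (of_bool (end1 e = i0) + of_bool (end2 e = i0)) *
        (c * of_bool (\<phi> (fst (fst e)) = \<phi> (snd (fst e))) * (if {#end1 e, end2 e#} \<subseteq># A then push E c (eps \<phi>) (A - {#end1 e, end2 e#}) else 0)))"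
proof -
  let ?inc = "\<lambda>e. (of_bool (end1 e = i0) + of_bool (end2 e = i0) :: real)"
  let ?w = "\<lambda>\<theta>. c ^ size \<theta> * eps \<phi> \<theta>"
  have label_count: "real (count (image_mset h \<theta>) i0) = (\<Sum>e\<in>E. real (count \<theta> e) * of_bool (h e = i0))"
    if "set_mset \<theta> \<subseteq> E" for h :: "cedge \<Rightarrow> entry" and \<theta>
    using that
  proof (induction \<theta>)
    case (add x \<theta>)
    have "(\<Sum>e\<in>E. real (count (add_mset x \<theta>) e) * of_bool (h e = i0))
      = (\<Sum>e\<in>E. real (count \<theta> e) * of_bool (h e = i0) + (if e = x then of_bool (h e = i0) else 0))"
      by (intro sum.cong) (auto simp: algebra_simps)
    also have "\<dots> = (\<Sum>e\<in>E. real (count \<theta> e) * of_bool (h e = i0)) + of_bool (h x = i0)"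
      using E add.prems by (simp add: sum.distrib)
    finally show ?case using add by simp
  qed simp
  have "real (count A i0) * push E c (eps \<phi>) A = (\<Sum>\<theta>\<in>fibre E A. real (count (ends \<theta>) i0) * ?w \<theta>)"
    unfolding push_def sum_distrib_left by (intro sum.cong refl) (simp add: fibre_def)
  also have "\<dots> = (\<Sum>\<theta>\<in>fibre E A. \<Sum>e\<in>E. ?inc e * (real (count \<theta> e) * ?w \<theta>))"
  proof (intro sum.cong refl)
    fix \<theta> assume "\<theta> \<in> fibre E A"
    then have s: "set_mset \<theta> \<subseteq> E" by (simp add: fibre_def)
    have "real (count (ends \<theta>) i0) = (\<Sum>e\<in>E. ?inc e * real (count \<theta> e))"
      unfolding ends_def using label_count[OF s, of end1] label_count[OF s, of end2] by (simp add: sum.distrib algebra_simps)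
    then show "real (count (ends \<theta>) i0) * ?w \<theta> = (\<Sum>e\<in>E. ?inc e * (real (count \<theta> e) * ?w \<theta>))"
      by (simp only: sum_distrib_right mult.assoc)
  qed
  also have "\<dots> = (\<Sum>e\<in>E. ?inc e * (\<Sum>\<theta>\<in>fibre E A. real (count \<theta> e) * ?w \<theta>))"
    by (subst sum.swap) (simp only: sum_distrib_left)
  also have "\<dots> = (\<Sum>e\<in>E. ?inc e * (c * of_bool (\<phi> (fst (fst e)) = \<phi> (snd (fst e))) * (if {#end1 e, end2 e#} \<subseteq># A then push E c (eps \<phi>) (A - {#end1 e, end2 e#}) else 0)))"
  proof (intro sum.cong refl arg_cong2[where f="(*)"])
    fix e assume e: "e \<in> E"
    let ?D = "{#end1 e, end2 e#}"
    have "(\<Sum>\<theta>\<in>fibre E A. real (count \<theta> e) * ?w \<theta>) = (\<Sum>\<theta>\<in>{\<theta>\<in>fibre E A. e \<in># \<theta>}. real (count \<theta> e) * ?w \<theta>)"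
    proof (rule sum.mono_neutral_right)
      show "\<forall>\<theta>\<in>fibre E A - {\<theta>\<in>fibre E A. e \<in># \<theta>}. real (count \<theta> e) * ?w \<theta> = 0"
        by (simp add: not_in_iff)
      show "finite (fibre E A)" using E by (rule finite_fibre)
      show "{\<theta>\<in>fibre E A. e \<in># \<theta>} \<subseteq> fibre E A" by (rule Collect_restrict)
    qed
    also have "\<dots> = (if ?D \<subseteq># A then (\<Sum>\<theta>\<in>fibre E (A - ?D). real (count \<theta> e + 1) * ?w (add_mset e \<theta>)) else 0)"
    proof (cases "?D \<subseteq># A")
      case True
      have "(\<Sum>\<theta>\<in>{\<theta>\<in>fibre E A. e \<in># \<theta>}. real (count \<theta> e) * ?w \<theta>) = (\<Sum>\<theta>\<in>fibre E (A - ?D). real (count \<theta> e + 1) * ?w (add_mset e \<theta>))"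
      proof (rule sum.reindex_bij_witness[of _ "add_mset e" "\<lambda>\<theta>. \<theta> - {#e#}"])
        fix \<theta> assume t: "\<theta> \<in> {\<theta>\<in>fibre E A. e \<in># \<theta>}"
        then have "e \<in># \<theta>" by simp
        then obtain \<theta>' where t': "\<theta> = add_mset e \<theta>'" by (rule multi_member_split[THEN exE])
        then show "add_mset e (\<theta> - {#e#}) = \<theta>" by simp
        have "A = ends \<theta>" "set_mset \<theta> \<subseteq> E" using t by (simp_all add: fibre_def)
        then have "A = ?D + ends \<theta>'" "set_mset \<theta>' \<subseteq> E" using t' by (simp_all add: ends_add_mset)
        then show "\<theta> - {#e#} \<in> fibre E (A - ?D)" using t' by (simp add: fibre_def)
        show "real (count (\<theta> - {#e#}) e + 1) * ?w (add_mset e (\<theta> - {#e#})) = real (count \<theta> e) * ?w \<theta>"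
          using t' by simp
      next
        fix \<theta> assume t: "\<theta> \<in> fibre E (A - ?D)"
        then have "ends (add_mset e \<theta>) = A" unfolding ends_add_mset fibre_def using subset_mset.add_diff_inverse[OF True] by simp
        then show "add_mset e \<theta> \<in> {\<theta>\<in>fibre E A. e \<in># \<theta>}" using t e by (simp add: fibre_def)
      qed simp
      then show ?thesis using True by simp
    next
      case False
      have "{\<theta>\<in>fibre E A. e \<in># \<theta>} = {}"
      proof (rule ccontr)
        assume "{\<theta>\<in>fibre E A. e \<in># \<theta>} \<noteq> {}"
        then obtain \<theta> where t: "\<theta> \<in> fibre E A" "e \<in># \<theta>" by blast
        from t(2) obtain \<theta>' where t': "\<theta> = add_mset e \<theta>'" by (rule multi_member_split[THEN exE])
        have "A = ends \<theta>" using t by (simp add: fibre_def)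
        then have "A = ?D + ends \<theta>'" using t' by (simp only: ends_add_mset)
        then have "?D \<subseteq># A" by (simp only: mset_subset_eq_add_left)
        then show False using False by simp
      qed
      then show ?thesis using False by (simp only: sum.empty if_False)
    qed
    also have "\<dots> = c * of_bool (\<phi> (fst (fst e)) = \<phi> (snd (fst e))) * (if ?D \<subseteq># A then push E c (eps \<phi>) (A - ?D) else 0)"
    proof -
      have "real (count \<theta> e + 1) * ?w (add_mset e \<theta>) = c * of_bool (\<phi> (fst (fst e)) = \<phi> (snd (fst e))) * ?w \<theta>" for \<theta>
      proof -
        have "real (count \<theta> e + 1) * ?w (add_mset e \<theta>) = c * c ^ size \<theta> * (real (count \<theta> e + 1) * eps \<phi> (add_mset e \<theta>))"
          by (simp only: size_add_mset power_Suc mult_ac)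
        then show ?thesis unfolding eps_add_mset by (simp only: mult_ac)
      qed
      then show ?thesis by (simp only: push_def sum_distrib_left[symmetric] mult_zero_right if_distrib[of "\<lambda>x. _ * x"] cong: if_cong)
    qed
    finally show "(\<Sum>\<theta>\<in>fibre E A. real (count \<theta> e) * ?w \<theta>)
      = c * of_bool (\<phi> (fst (fst e)) = \<phi> (snd (fst e))) * (if ?D \<subseteq># A then push E c (eps \<phi>) (A - ?D) else 0)" .
  qed
  finally show ?thesis .
qed

definition centre_of :: "(vertex \<Rightarrow> nat) \<Rightarrow> entry \<Rightarrow> nat \<times> nat" where
  "centre_of \<phi> i = (\<phi> (fst i, fst (snd i)), snd (snd i))"

text \<open>Isserlis' formula: both sides satisfy the recursion obtained by pairing one fixed factor
  with every other one.\<close>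

lemma isserlis:
  fixes U :: "(nat \<times> nat) multiset \<Rightarrow> real"
  assumes U0: "U {#} = 1"
    and Urec: "\<And>j B. j \<in> {1..K} \<times> {1..p} \<Longrightarrow> U (add_mset j B) = v * real (count B j) * U (B - {#j#})"
    and \<phi>: "\<And>u. u \<in> {1..K} \<times> {1..M} \<Longrightarrow> \<phi> u \<in> {1..K}"
    and A: "set_mset A \<subseteq> entries K M p"
  shows "U (image_mset (centre_of \<phi>) A) = mfact A * push (coloured_edges K M p) (v / 2) (eps \<phi>) A"
  using A
proof (induction "size A" arbitrary: A rule: less_induct)
  case less
  let ?E = "coloured_edges K M p" and ?j = "centre_of \<phi>"
  let ?P = "push ?E (v / 2) (eps \<phi>)"
  show ?case
  proof (cases A)
    case empty
    have "fibre ?E {#} = {{#}}" by (auto simp: fibre_def ends_def)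
    then show ?thesis by (simp add: empty U0 push_def eps_def)
  next
    case (add i0 B)
    let ?d = "snd (snd i0)" and ?u = "(fst i0, fst (snd i0))"
    have i0: "i0 \<in> entries K M p" and B: "set_mset B \<subseteq> entries K M p" using less.prems add by auto
    have ji0: "?j i0 \<in> {1..K} \<times> {1..p}"
      using i0 \<phi>[of ?u] by (auto simp: entries_def centre_of_def)
    have IH: "U (image_mset ?j (B - {#i#})) = mfact (B - {#i#}) * ?P (B - {#i#})" if "i \<in># B" for i
    proof (rule less.hyps)
      show "size (B - {#i#}) < size A" using that add by (simp add: size_Diff_singleton less_Suc_eq_le)
      show "set_mset (B - {#i#}) \<subseteq> entries K M p" using B by (meson in_diffD subset_iff)
    qed
    have mf: "real (count B i) * mfact (B - {#i#}) = mfact B" if "i \<in># B" for i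
      using mfact_add_mset[of i "B - {#i#}"] that by (simp del: of_nat_Suc of_nat_add)
    define t where "t i = v * of_bool (?j i = ?j i0) * ?P (B - {#i#})" for i
    have lhs: "U (image_mset ?j A) = mfact B * (\<Sum>i\<in>set_mset B. t i)"
    proof -
      have "U (image_mset ?j A) = v * real (count (image_mset ?j B) (?j i0)) * U (image_mset ?j B - {#?j i0#})"
        using Urec[OF ji0] add by simp
      also have "real (count (image_mset ?j B) (?j i0)) = (\<Sum>i\<in>set_mset B. real (count B i) * of_bool (?j i = ?j i0))"
      proof -
        have "?j -` {?j i0} \<inter> set_mset B = set_mset B \<inter> {i. ?j i = ?j i0}" by auto
        then show ?thesis by (simp add: count_image_mset sum.inter_restrict of_bool_def if_distrib[of "\<lambda>x. _ * x"] if_distrib[of real] cong: if_cong)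
      qed
      also have "v * (\<Sum>i\<in>set_mset B. real (count B i) * of_bool (?j i = ?j i0)) * U (image_mset ?j B - {#?j i0#})
        = (\<Sum>i\<in>set_mset B. v * (real (count B i) * of_bool (?j i = ?j i0)) * U (image_mset ?j B - {#?j i0#}))"
        by (simp only: sum_distrib_left sum_distrib_right)
      also have "\<dots> = (\<Sum>i\<in>set_mset B. mfact B * t i)"
      proof (intro sum.cong refl)
        fix i assume i: "i \<in># B"
        show "v * (real (count B i) * of_bool (?j i = ?j i0)) * U (image_mset ?j B - {#?j i0#}) = mfact B * t i"
        proof (cases "?j i = ?j i0")
          case True
          have "image_mset ?j B - {#?j i0#} = image_mset ?j (B - {#i#})"
            using i True by (simp add: image_mset_Diff)
          then have "U (image_mset ?j B - {#?j i0#}) = mfact (B - {#i#}) * ?P (B - {#i#})" using IH[OF i] by simp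
          then show ?thesis using True mf[OF i, symmetric] by (simp add: t_def)
        qed (simp add: t_def)
      qed
      finally show ?thesis by (simp only: sum_distrib_left)
    qed
    define g where "g e = (v / 2) * of_bool (\<phi> (fst (fst e)) = \<phi> (snd (fst e))) * (if {#end1 e, end2 e#} \<subseteq># A then ?P (A - {#end1 e, end2 e#}) else 0)" for e
    \<comment> \<open>Edges are ordered pairs, so two distinct entries are joined by two edges of
      weight \<open>v / 2\<close> each. This is the sum over the edges whose end \<open>h1\<close>
      is \<open>i0\<close>, with \<open>mk\<close> building the edge from its other end; it is used
      once for each orientation.\<close>
    have half: "(\<Sum>e\<in>?E. of_bool (h1 e = i0) * g e) = (\<Sum>i\<in>set_mset B. t i / 2)"
      if mk: "\<And>u' d. mk u' d = ((?u, u'), d) \<or> mk u' d = ((u', ?u), d)"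
        and h: "\<And>e. {#h1 e, h2 e#} = {#end1 e, end2 e#}"
        and mk1: "\<And>u' d. h1 (mk u' d) = (fst ?u, snd ?u, d)" and mk2: "\<And>u' d. h2 (mk u' d) = (fst u', snd u', d)"
        and sur: "\<And>e. h1 e = i0 \<Longrightarrow> e = mk (fst (h2 e), fst (snd (h2 e))) ?d" "\<And>e. h1 e = i0 \<Longrightarrow> snd (snd (h2 e)) = ?d"
      for h1 h2 and mk :: "vertex \<Rightarrow> nat \<Rightarrow> cedge"
    proof -
      let ?I = "{i \<in> set_mset B. snd (snd i) = ?d}" and ?m = "\<lambda>i. mk (fst i, fst (snd i)) ?d"
      let ?F = "{e \<in> ?E. h1 e = i0 \<and> h2 e \<in># B}"
      have sub: "{#end1 e, end2 e#} \<subseteq># A \<longleftrightarrow> h2 e \<in># B" if "h1 e = i0" for e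
        unfolding h[symmetric] that add by simp
      have "(\<Sum>e\<in>?E. of_bool (h1 e = i0) * g e) = (\<Sum>e\<in>?F. of_bool (h1 e = i0) * g e)"
      proof (rule sum.mono_neutral_right)
        show "\<forall>e\<in>?E - ?F. of_bool (h1 e = i0) * g e = 0"
        proof
          fix e assume "e \<in> ?E - ?F"
          then have "h1 e \<noteq> i0 \<or> h2 e \<notin># B" by blast
          then show "of_bool (h1 e = i0) * g e = 0" using sub[of e] by (cases "h1 e = i0") (simp_all add: g_def)
        qed
        show "?F \<subseteq> ?E" by (rule Collect_restrict)
      qed simp
      also have "\<dots> = (\<Sum>i\<in>?I. t i / 2)"
      proof (rule sum.reindex_bij_witness[of _ ?m h2])
        fix e assume e: "e \<in> ?F"
        then show "?m (h2 e) = e" using sur(1)[of e] by simp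
        show "h2 e \<in> ?I" using e sur(2)[of e] by simp
        have e1: "h1 e = i0" "h2 e \<in># B" using e by auto
        have AB: "A - {#end1 e, end2 e#} = B - {#h2 e#}" unfolding h[symmetric] e1 add by simp
        have "of_bool (\<phi> (fst (fst e)) = \<phi> (snd (fst e))) = (of_bool (?j (h2 e) = ?j i0) :: real)"
        proof -
          have "e = mk (fst (h2 e), fst (snd (h2 e))) ?d" using sur(1)[OF e1(1)] .
          then have "e = ((?u, (fst (h2 e), fst (snd (h2 e)))), ?d) \<or> e = (((fst (h2 e), fst (snd (h2 e))), ?u), ?d)"
            using mk by metis
          then have "(\<phi> (fst (fst e)) = \<phi> (snd (fst e))) = (\<phi> (fst (h2 e), fst (snd (h2 e))) = \<phi> ?u)"
          proof
            assume "e = ((?u, (fst (h2 e), fst (snd (h2 e)))), ?d)"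
            then have "fst (fst e) = ?u" "snd (fst e) = (fst (h2 e), fst (snd (h2 e)))" by (metis fst_conv snd_conv)+
            then show ?thesis by auto
          next
            assume "e = (((fst (h2 e), fst (snd (h2 e))), ?u), ?d)"
            then have "snd (fst e) = ?u" "fst (fst e) = (fst (h2 e), fst (snd (h2 e)))" by (metis fst_conv snd_conv)+
            then show ?thesis by auto
          qed
          then show ?thesis using sur(2)[OF e1(1)] by (simp add: centre_of_def)
        qed
        then show "t (h2 e) / 2 = of_bool (h1 e = i0) * g e"
          using sub[OF e1(1)] e1 AB by (simp add: t_def g_def)
      next
        fix i assume i: "i \<in> ?I"
        then have it: "i = (fst i, fst (snd i), ?d)" by (metis (mono_tags, lifting) mem_Collect_eq prod.collapse)
        show "h2 (?m i) = i" using it by (simp add: mk2)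
        have "i \<in> entries K M p" using i B by blast
        then have "?m i \<in> ?E"
          using mk[of "(fst i, fst (snd i))" ?d] i0 by (auto simp: entries_def coloured_edges_def)
        moreover have "h1 (?m i) = i0" by (simp add: mk1)
        moreover have "h2 (?m i) \<in># B" using i it by (simp add: mk2)
        ultimately show "?m i \<in> ?F" by blast
      qed
      also have "\<dots> = (\<Sum>i\<in>set_mset B. t i / 2)"
      proof (rule sum.mono_neutral_left)
        show "\<forall>i\<in>set_mset B - ?I. t i / 2 = 0" by (auto simp: t_def centre_of_def)
      qed auto
      finally show ?thesis .
    qed
    have "mfact A * ?P A = mfact B * (real (count A i0) * ?P A)"
      by (simp add: add mfact_add_mset del: of_nat_Suc of_nat_add)
    also have "real (count A i0) * ?P A = (\<Sum>e\<in>?E. of_bool (end1 e = i0) * g e) + (\<Sum>e\<in>?E. of_bool (end2 e = i0) * g e)"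
      unfolding push_eps_recursion[OF finite_coloured_edges] g_def by (simp only: distrib_right sum.distrib)
    also have "(\<Sum>e\<in>?E. of_bool (end1 e = i0) * g e) = (\<Sum>i\<in>set_mset B. t i / 2)"
      by (rule half[of "\<lambda>u' d. ((?u, u'), d)" end1 end2]) (auto simp: end1_def end2_def prod_eq_iff)
    also have "(\<Sum>e\<in>?E. of_bool (end2 e = i0) * g e) = (\<Sum>i\<in>set_mset B. t i / 2)"
      by (rule half[of "\<lambda>u' d. ((u', ?u), d)" end2 end1]) (auto simp: end1_def end2_def prod_eq_iff)
    finally show ?thesis by (simp add: lhs sum.distrib[symmetric])
  qed
qed

section \<open>Gaussian moments and Hermite polynomials\<close>

text \<open>The moments of \<open>N(0, s^2)\<close>, in the shape in which
  \<open>normal_moment_even\<close> provides them.\<close>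

definition gmom :: "real \<Rightarrow> nat \<Rightarrow> real" where
  "gmom s n = (if even n then fact n / ((2 / s\<^sup>2) ^ (n div 2) * fact (n div 2)) else 0)"

lemma gmom_0 [simp]: "gmom s 0 = 1" by (simp add: gmom_def)

lemma gmom_Suc:
  assumes s: "s > 0"
  shows "gmom s (Suc n) = s\<^sup>2 * real n * gmom s (n - 1)"
proof (cases "even n")
  case True
  then show ?thesis by (cases "n = 0") (auto simp: gmom_def)
next
  case False
  then obtain k where k: "n = 2 * k + 1" by (elim oddE)
  have "gmom s (Suc n) = fact (2 * k + 2) / ((2 / s\<^sup>2) ^ (k + 1) * fact (k + 1))"
    by (simp add: gmom_def k)
  also have "(fact (2 * k + 2) :: real) = (2 * (real k + 1)) * (2 * real k + 1) * fact (2 * k)"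
    by (simp add: algebra_simps)
  also have "(fact (k + 1) :: real) = (real k + 1) * fact k" by simp
  also have "(2 * (real k + 1)) * (2 * real k + 1) * fact (2 * k) / ((2 / s\<^sup>2) ^ (k + 1) * ((real k + 1) * fact k))
    = s\<^sup>2 * (2 * real k + 1) * (fact (2 * k) / ((2 / s\<^sup>2) ^ k * fact k))"
  proof -
    have gen: "(2 * b) * c * f / ((2 / v) ^ (k + 1) * (b * g)) = v * c * (f / ((2 / v) ^ k * g))"
      if "b \<noteq> 0" "v \<noteq> 0" for b c f v g :: real
      using that by (simp add: field_simps)
    show ?thesis by (rule gen) (use s in simp_all)
  qed
  also have "fact (2 * k) / ((2 / s\<^sup>2) ^ k * fact k) = gmom s (n - 1)" by (simp add: gmom_def k)
  finally show ?thesis by (simp add: k)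
qed

lemma gaussian_moment:
  assumes s: "s > 0"
  shows "has_bochner_integral (gaussian a s) (\<lambda>y. (y - a) ^ n) (gmom s n)"
proof -
  have "has_bochner_integral lborel (\<lambda>y. normal_density a s y *\<^sub>R (y - a) ^ n) (gmom s n)"
  proof (cases "even n")
    case True
    then obtain k where k: "n = 2 * k" by (elim evenE)
    show ?thesis using normal_moment_even[OF s, of a k] by (simp add: gmom_def k)
  next
    case False
    then obtain k where k: "n = 2 * k + 1" by (elim oddE)
    show ?thesis using normal_moment_odd[OF s, of a k] by (simp add: gmom_def k)
  qed
  then show ?thesis
    unfolding gaussian_def by (intro has_bochner_integral_density) (auto simp: normal_density_nonneg)
qed

text \<open>The expectation of a polynomial in a centred Gaussian variable of standard deviation \<open>s\<close>.\<close>

definition glin :: "real \<Rightarrow> real poly \<Rightarrow> real" where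
  "glin s P = (\<Sum>i\<le>degree P. coeff P i * gmom s i)"

lemma glin_bound: "degree P \<le> n \<Longrightarrow> glin s P = (\<Sum>i\<le>n. coeff P i * gmom s i)"
  unfolding glin_def by (intro sum.mono_neutral_left) (auto simp: coeff_eq_0)

lemma gaussian_poly:
  assumes s: "s > 0"
  shows "has_bochner_integral (gaussian a s) (\<lambda>y. poly P (y - a)) (glin s P)"
  unfolding poly_altdef glin_def
  by (intro has_bochner_integral_sum has_bochner_integral_mult_right gaussian_moment[OF s])

lemma glin_add: "glin s (P + Q) = glin s P + glin s Q"
proof -
  define n where "n = max (degree P) (degree Q)"
  have "degree P \<le> n" "degree Q \<le> n" "degree (P + Q) \<le> n" by (auto simp: n_def intro: degree_add_le)
  then show ?thesis by (simp add: glin_bound[of _ n] sum.distrib distrib_right)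
qed

lemma glin_smult: "glin s (smult c P) = c * glin s P"
  using glin_bound[of "smult c P" "degree P" s] by (simp add: glin_def sum_distrib_left mult.assoc)

lemma glin_diff: "glin s (P - Q) = glin s P - glin s Q"
  using glin_add[of s "P - Q" Q] by simp

lemma glin_0 [simp]: "glin s 0 = 0" by (simp add: glin_def)

lemma glin_const [simp]: "glin s [:c:] = c" by (simp add: glin_def)

text \<open>Stein's identity \<open>E[Z P(Z)] = s^2 E[P'(Z)]\<close>, read off from the recursion of
  the moments.\<close>

lemma glin_stein:
  assumes s: "s > 0"
  shows "glin s (pCons 0 P) = s\<^sup>2 * glin s (pderiv P)"
proof -
  define n where "n = degree P"
  have "degree (pCons 0 P) \<le> Suc n" by (simp add: n_def degree_pCons_le)
  then have "glin s (pCons 0 P) = (\<Sum>i\<le>Suc n. coeff (pCons 0 P) i * gmom s i)" by (rule glin_bound)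
  also have "\<dots> = (\<Sum>i\<le>n. coeff P i * gmom s (Suc i))" by (simp add: sum.atMost_Suc_shift del: sum.atMost_Suc)
  also have "\<dots> = s\<^sup>2 * (\<Sum>i\<le>n. real i * coeff P i * gmom s (i - 1))"
    by (simp add: gmom_Suc[OF s] sum_distrib_left mult_ac)
  also have "(\<Sum>i\<le>n. real i * coeff P i * gmom s (i - 1)) = (\<Sum>i\<le>Suc n. real i * coeff P i * gmom s (i - 1))"
    by (simp add: n_def coeff_eq_0)
  also have "\<dots> = (\<Sum>i\<le>n. real (Suc i) * coeff P (Suc i) * gmom s i)"
    by (simp add: sum.atMost_Suc_shift del: of_nat_Suc sum.atMost_Suc)
  also have "\<dots> = glin s (pderiv P)"
    by (subst glin_bound[of _ n]) (auto simp: coeff_pderiv n_def degree_pderiv)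
  finally show ?thesis .
qed

text \<open>The monic Hermite polynomials of variance \<open>s^2\<close>. By
  \<open>glin_stein\<close> the recursion applies the adjoint of \<open>s^2\<close> times
  differentiation for the form that sends \<open>P\<close> and \<open>Q\<close> to
  \<open>glin s (P * Q)\<close>.\<close>

fun herm :: "real \<Rightarrow> nat \<Rightarrow> real poly" where
  "herm s 0 = 1"
| "herm s (Suc n) = pCons 0 (herm s n) - smult (s\<^sup>2) (pderiv (herm s n))"

text \<open>Integration by parts \<open>n\<close> times. Orthogonality and the pairing with shifted
  powers both reduce to the \<open>n\<close>-th derivative of the other factor.\<close>

lemma glin_herm:
  assumes s: "s > 0"
  shows "glin s (herm s n * P) = s ^ (2 * n) * glin s ((pderiv ^^ n) P)"
proof (induction n arbitrary: P)
  case (Suc n)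
  have "herm s (Suc n) * P = pCons 0 (herm s n * P) - smult (s\<^sup>2) (pderiv (herm s n) * P)"
    by (simp add: algebra_simps)
  then have "glin s (herm s (Suc n) * P) = s\<^sup>2 * glin s (pderiv (herm s n * P)) - s\<^sup>2 * glin s (pderiv (herm s n) * P)"
    by (simp only: glin_diff glin_smult glin_stein[OF s])
  also have "pderiv (herm s n * P) = herm s n * pderiv P + pderiv (herm s n) * P"
    by (simp add: pderiv_mult mult.commute)
  also have "s\<^sup>2 * glin s (herm s n * pderiv P + pderiv (herm s n) * P) - s\<^sup>2 * glin s (pderiv (herm s n) * P)
     = s\<^sup>2 * glin s (herm s n * pderiv P)"
    by (simp add: glin_add algebra_simps)
  also have "\<dots> = s ^ (2 * Suc n) * glin s ((pderiv ^^ n) (pderiv P))"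
    by (simp add: Suc power2_eq_square)
  finally show ?case by (simp add: funpow_swap1)
qed simp

lemma coeff_funpow_pderiv: "coeff ((pderiv ^^ n) P) i = (fact (i + n) / fact i) * coeff (P :: real poly) (i + n)"
proof (induction n arbitrary: i)
  case (Suc n)
  have "coeff ((pderiv ^^ Suc n) P) i = real (Suc i) * coeff ((pderiv ^^ n) P) (Suc i)"
    by (simp add: coeff_pderiv)
  also have "\<dots> = real (Suc i) * (fact (Suc i + n) / fact (Suc i)) * coeff P (Suc i + n)"
    by (simp only: Suc mult.assoc)
  also have "real (Suc i) * (F / fact (Suc i)) = F / fact i" for F
    unfolding fact_Suc by (simp del: of_nat_Suc)
  finally show ?case by (simp del: fact_Suc)
qed simp

lemma herm_monic: "degree (herm s n) \<le> n \<and> coeff (herm s n) n = 1"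
proof (induction n)
  case (Suc n)
  have d1: "degree (pCons 0 (herm s n)) \<le> Suc n" using Suc degree_pCons_le[of 0 "herm s n"] by linarith
  have d2: "degree (pderiv (herm s n)) \<le> n" using Suc degree_pderiv[of "herm s n"] by linarith
  have "degree (smult (s\<^sup>2) (pderiv (herm s n))) \<le> Suc n" using d2 degree_smult_le[of "s\<^sup>2" "pderiv (herm s n)"] by linarith
  with d1 have "degree (herm s (Suc n)) \<le> Suc n" by (simp add: degree_diff_le)
  moreover have "coeff (pderiv (herm s n)) (Suc n) = 0" using d2 by (intro coeff_eq_0) simp
  ultimately show ?case using Suc by simp
qed simp

lemma glin_herm_herm:
  assumes s: "s > 0"
  shows "glin s (herm s n * herm s m) = (if n = m then s ^ (2 * n) * fact n else 0)"
proof -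
  have lt: "glin s (herm s n * herm s m) = 0" if "m < n" for n m
  proof -
    have "coeff ((pderiv ^^ n) (herm s m)) i = 0" for i
      unfolding coeff_funpow_pderiv using herm_monic[of s m] that by (simp add: coeff_eq_0)
    then have "(pderiv ^^ n) (herm s m) = 0" by (intro poly_eqI) simp
    then show ?thesis using glin_herm[OF s, of n "herm s m"] by simp
  qed
  consider "m < n" | "n < m" | "n = m" by linarith
  then show ?thesis
  proof cases
    case 1
    then show ?thesis using lt[of m n] by simp
  next
    case 2
    then show ?thesis using lt[of n m] by (simp add: mult.commute)
  next
    case 3
    have "coeff ((pderiv ^^ n) (herm s n)) i = coeff [:fact n:] i" for i
    proof (cases i)
      case 0
      then show ?thesis unfolding coeff_funpow_pderiv using herm_monic[of s n] by simp
    next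
      case (Suc j)
      then show ?thesis unfolding coeff_funpow_pderiv using herm_monic[of s n] by (simp add: coeff_eq_0)
    qed
    then have "(pderiv ^^ n) (herm s n) = [:fact n:]" by (intro poly_eqI)
    then show ?thesis using glin_herm[OF s, of n "herm s n"] 3 by simp
  qed
qed

lemma funpow_pderiv_power:
  "(pderiv ^^ n) ([:a, 1:] ^ m) = (if n \<le> m then smult (fact m / fact (m - n)) ([:a, 1:] ^ (m - n)) else (0 :: real poly))"
proof (induction n)
  case (Suc n)
  show ?case
  proof (cases "Suc n \<le> m")
    case True
    then obtain j where j: "m - n = Suc j" by (metis Suc_diff_Suc Suc_le_eq)
    have jm: "m - Suc n = j" using j by simp
    have "pderiv ([:a, 1:] ^ Suc j) = smult (real (Suc j)) ([:a, 1:] ^ j)"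
      by (simp add: pderiv_power_Suc pderiv_pCons del: power_Suc)
    then show ?thesis using Suc True j jm by (simp add: pderiv_smult del: power_Suc of_nat_Suc)
  next
    case False
    then show ?thesis using Suc by (cases "n = m") (auto simp: pderiv_smult)
  qed
qed simp

text \<open>The \<open>n\<close>-th moment of \<open>N(a, s^2)\<close>.\<close>

definition gpow :: "real \<Rightarrow> real \<Rightarrow> nat \<Rightarrow> real" where
  "gpow s a n = glin s ([:a, 1:] ^ n)"

lemma glin_herm_power:
  assumes s: "s > 0"
  shows "glin s (herm s n * [:a, 1:] ^ m) = (if n \<le> m then s ^ (2 * n) * (fact m / fact (m - n)) * gpow s a (m - n) else 0)"
  unfolding glin_herm[OF s] funpow_pderiv_power gpow_def by (simp add: glin_smult)

text \<open>The binomial theorem; division by factorials turns it into a convolution of the powers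
  of the mean with the noise moments.\<close>

lemma gpow_expand: "gpow s a n / fact n = (\<Sum>k\<le>n. (a ^ k / fact k) * (gmom s (n - k) / fact (n - k)))"
proof -
  have c: "coeff ([:a, 1:] ^ n) i = real (n choose i) * a ^ (n - i)" if "i \<le> n" for i
    using that by (simp add: coeff_linear_poly_power)
  have "gpow s a n = (\<Sum>i\<le>n. coeff ([:a, 1:] ^ n) i * gmom s i)"
    unfolding gpow_def by (rule glin_bound) (rule order_trans[OF degree_power_le], simp)
  also have "\<dots> = (\<Sum>k\<le>n. coeff ([:a, 1:] ^ n) (n - k) * gmom s (n - k))"
    by (rule sum.reindex_bij_witness[of _ "\<lambda>k. n - k" "\<lambda>k. n - k"]) auto
  also have "\<dots> / fact n = (\<Sum>k\<le>n. (a ^ k / fact k) * (gmom s (n - k) / fact (n - k)))"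
    unfolding sum_divide_distrib
  proof (intro sum.cong refl)
    fix k assume "k \<in> {..n}"
    then have k: "k \<le> n" by simp
    have "real (n choose (n - k)) = fact n / (fact (n - k) * fact k)"
      using binomial_fact[of "n - k" n] k by simp
    then show "coeff ([:a, 1:] ^ n) (n - k) * gmom s (n - k) / fact n = (a ^ k / fact k) * (gmom s (n - k) / fact (n - k))"
      using c[of "n - k"] k by simp
  qed
  finally show ?thesis .
qed

section \<open>The dual certificate\<close>

locale gaussian_model =
  fixes K M p :: nat and \<sigma> lam :: real
  assumes sigma: "\<sigma> > 0" and lam: "lam > 0"
begin

abbreviation "I \<equiv> entries K M p"
abbreviation "J \<equiv> {1..K} \<times> {1..p}"
abbreviation "E \<equiv> coloured_edges K M p"

lemma finI [simp]: "finite I" by (simp add: entries_def)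

definition mean :: "perms \<Rightarrow> centres \<Rightarrow> entry \<Rightarrow> real" where
  "mean \<pi> \<mu> i = \<mu> (centre_of (label_of \<pi>) i)"

definition monomial :: "entry multiset \<Rightarrow> tensor \<Rightarrow> real" where
  "monomial A y = (\<Prod>i\<in>I. y i ^ count A i)"

definition hermB :: "(entry \<Rightarrow> real) \<Rightarrow> entry multiset \<Rightarrow> tensor \<Rightarrow> real" where
  "hermB x B y = (\<Prod>i\<in>I. poly (herm \<sigma> (count B i)) (y i - x i))"

definition cond_moment :: "entry multiset \<Rightarrow> (entry \<Rightarrow> real) \<Rightarrow> real" where
  "cond_moment A x = (\<Prod>i\<in>I. gpow \<sigma> (x i) (count A i))"

text \<open>Divided by the factorial already, in contrast to \<open>cond_moment\<close> and
  \<open>centre_moment\<close>, since it serves as a factor of \<open>conv\<close>.\<close>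

definition noise_moment :: "entry multiset \<Rightarrow> real" where
  "noise_moment A = (\<Prod>i\<in>I. gmom \<sigma> (count A i) / fact (count A i))"

definition centre_moment :: "(nat \<times> nat) multiset \<Rightarrow> real" where
  "centre_moment B = (\<Prod>j\<in>J. gmom lam (count B j))"

lemma obs_law_eq: "obs_law K M p \<sigma> \<pi> \<mu> = (\<Pi>\<^sub>M i\<in>I. gaussian (mean \<pi> \<mu> i) \<sigma>)"
  unfolding obs_law_def by (intro PiM_cong) (auto simp: mean_def centre_of_def label_of_def)

lemma obs_poly:
  shows "has_bochner_integral (obs_law K M p \<sigma> \<pi> \<mu>) (\<lambda>y. \<Prod>i\<in>I. poly (P i) (y i - mean \<pi> \<mu> i)) (\<Prod>i\<in>I. glin \<sigma> (P i))"
proof -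
  interpret product_sigma_finite "\<lambda>i. gaussian (mean \<pi> \<mu> i) \<sigma>"
    using prob_space_gaussian[OF sigma] by (simp add: product_sigma_finite_def prob_space_imp_sigma_finite)
  have int: "integrable (gaussian (mean \<pi> \<mu> i) \<sigma>) (\<lambda>y. poly (P i) (y - mean \<pi> \<mu> i))" for i
    using gaussian_poly[OF sigma] by (rule integrable.intros)
  have "integral\<^sup>L (gaussian (mean \<pi> \<mu> i) \<sigma>) (\<lambda>y. poly (P i) (y - mean \<pi> \<mu> i)) = glin \<sigma> (P i)" for i
    using gaussian_poly[OF sigma] by (rule has_bochner_integral_integral_eq)
  then show ?thesis
    unfolding obs_law_eq has_bochner_integral_iff
    using product_integrable_prod[OF finI, of "\<lambda>i y. poly (P i) (y - mean \<pi> \<mu> i)"]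
      product_integral_prod[OF finI, of "\<lambda>i y. poly (P i) (y - mean \<pi> \<mu> i)"] int by simp
qed

lemma poly_shift_power: "y ^ n = poly ([:a, 1:] ^ n) (y - a)" for y a :: real
  by (simp add: poly_power)

lemma obs_monomial: "has_bochner_integral (obs_law K M p \<sigma> \<pi> \<mu>) (monomial A) (cond_moment A (mean \<pi> \<mu>))"
proof -
  have "monomial A = (\<lambda>y. \<Prod>i\<in>I. poly ([:mean \<pi> \<mu> i, 1:] ^ count A i) (y i - mean \<pi> \<mu> i))"
    unfolding monomial_def by (intro ext prod.cong refl poly_shift_power)
  then show ?thesis using obs_poly[of \<pi> \<mu> "\<lambda>i. [:mean \<pi> \<mu> i, 1:] ^ count A i"] by (simp add: cond_moment_def gpow_def)
qed

lemma monomial_add: "monomial A y * monomial B y = monomial (A + B) y"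
  by (simp add: monomial_def power_add prod.distrib)

lemma prod_count_sum: "set_mset A \<subseteq> I \<Longrightarrow> (\<Prod>i\<in>I. s ^ (2 * count A i)) = (s::real) ^ (2 * size A)"
proof (induction A)
  case (add x A)
  have "(\<Prod>i\<in>I. s ^ (2 * count (add_mset x A) i)) = (\<Prod>i\<in>I. s ^ (2 * count A i) * (if i = x then s\<^sup>2 else 1))"
    by (intro prod.cong refl) (auto simp: power2_eq_square)
  also have "\<dots> = (\<Prod>i\<in>I. s ^ (2 * count A i)) * s\<^sup>2"
    using add.prems by (simp add: prod.distrib)
  finally show ?case using add by (simp add: power2_eq_square)
qed simp

lemma mfact_I: "set_mset A \<subseteq> I \<Longrightarrow> mfact A = (\<Prod>i\<in>I. fact (count A i))"
  by (rule mfact_superset) simp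

text \<open>Integration by parts makes a Hermite polynomial of the noise act on the monomial as a
  derivative. On monomials divided by their factorials a derivative shifts the multi-index, so a
  combination of such polynomials acts on moments as a convolution.\<close>

lemma obs_herm_monomial:
  assumes A: "set_mset A \<subseteq> I" and B: "set_mset B \<subseteq> I"
  shows "has_bochner_integral (obs_law K M p \<sigma> \<pi> \<mu>) (\<lambda>y. hermB (mean \<pi> \<mu>) B y * monomial A y)
    (if B \<subseteq># A then \<sigma> ^ (2 * size B) * (mfact A / mfact (A - B)) * cond_moment (A - B) (mean \<pi> \<mu>) else 0)"
proof -
  let ?x = "mean \<pi> \<mu>"
  have "(\<lambda>y. hermB ?x B y * monomial A y) = (\<lambda>y. \<Prod>i\<in>I. poly (herm \<sigma> (count B i) * [:?x i, 1:] ^ count A i) (y i - ?x i))"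
    unfolding hermB_def monomial_def prod.distrib[symmetric] poly_mult
    by (intro ext prod.cong refl arg_cong2[where f="(*)"] poly_shift_power)
  moreover have "(\<Prod>i\<in>I. glin \<sigma> (herm \<sigma> (count B i) * [:?x i, 1:] ^ count A i))
    = (if B \<subseteq># A then \<sigma> ^ (2 * size B) * (mfact A / mfact (A - B)) * cond_moment (A - B) ?x else 0)"
  proof (cases "B \<subseteq># A")
    case True
    then have le: "count B i \<le> count A i" for i by (rule mset_subset_eq_count)
    have AB: "set_mset (A - B) \<subseteq> I" using A by (meson in_diffD subset_iff)
    have "(\<Prod>i\<in>I. glin \<sigma> (herm \<sigma> (count B i) * [:?x i, 1:] ^ count A i))
      = (\<Prod>i\<in>I. \<sigma> ^ (2 * count B i) * (fact (count A i) / fact (count (A - B) i)) * gpow \<sigma> (?x i) (count (A - B) i))"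
      by (intro prod.cong refl) (simp add: glin_herm_power[OF sigma] le)
    also have "\<dots> = \<sigma> ^ (2 * size B) * (mfact A / mfact (A - B)) * cond_moment (A - B) ?x"
      by (simp only: prod.distrib prod_dividef prod_count_sum[OF B] mfact_I[OF A] mfact_I[OF AB] cond_moment_def)
    finally show ?thesis using True by simp
  next
    case False
    then obtain i where i: "count A i < count B i" by (auto simp: subseteq_mset_def not_le)
    then have "i \<in># B" by (metis count_eq_zero_iff not_less_zero)
    then have "i \<in> I" using B by blast
    moreover have "glin \<sigma> (herm \<sigma> (count B i) * [:?x i, 1:] ^ count A i) = 0"
      using i by (simp add: glin_herm_power[OF sigma])
    ultimately have "(\<Prod>i\<in>I. glin \<sigma> (herm \<sigma> (count B i) * [:?x i, 1:] ^ count A i)) = 0"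
      by (intro prod_zero[OF finI]) blast
    then show ?thesis using False by simp
  qed
  ultimately show ?thesis using obs_poly[of \<pi> \<mu> "\<lambda>i. herm \<sigma> (count B i) * [:?x i, 1:] ^ count A i"] by simp
qed

lemma obs_herm_herm:
  assumes A: "set_mset A \<subseteq> I" and B: "set_mset B \<subseteq> I"
  shows "has_bochner_integral (obs_law K M p \<sigma> \<pi> \<mu>) (\<lambda>y. hermB (mean \<pi> \<mu>) A y * hermB (mean \<pi> \<mu>) B y)
    (if A = B then \<sigma> ^ (2 * size A) * mfact A else 0)"
proof -
  let ?x = "mean \<pi> \<mu>"
  have "(\<lambda>y. hermB ?x A y * hermB ?x B y) = (\<lambda>y. \<Prod>i\<in>I. poly (herm \<sigma> (count A i) * herm \<sigma> (count B i)) (y i - ?x i))"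
    unfolding hermB_def prod.distrib[symmetric] poly_mult ..
  moreover have "(\<Prod>i\<in>I. glin \<sigma> (herm \<sigma> (count A i) * herm \<sigma> (count B i))) = (if A = B then \<sigma> ^ (2 * size A) * mfact A else 0)"
  proof (cases "A = B")
    case True
    have "(\<Prod>i\<in>I. glin \<sigma> (herm \<sigma> (count A i) * herm \<sigma> (count B i))) = (\<Prod>i\<in>I. \<sigma> ^ (2 * count A i) * fact (count A i))"
      using True by (intro prod.cong refl) (simp add: glin_herm_herm[OF sigma])
    also have "\<dots> = \<sigma> ^ (2 * size A) * mfact A"
      by (simp only: prod.distrib prod_count_sum[OF A] mfact_I[OF A])
    finally show ?thesis using True by simp
  next
    case False
    then obtain i where i: "count A i \<noteq> count B i" by (auto simp: multiset_eq_iff)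
    then have "i \<in># A \<or> i \<in># B" by (metis count_eq_zero_iff)
    then have "i \<in> I" using A B by blast
    moreover have "glin \<sigma> (herm \<sigma> (count A i) * herm \<sigma> (count B i)) = 0"
      using i by (simp add: glin_herm_herm[OF sigma])
    ultimately have "(\<Prod>i\<in>I. glin \<sigma> (herm \<sigma> (count A i) * herm \<sigma> (count B i))) = 0"
      by (intro prod_zero[OF finI]) blast
    then show ?thesis using False by simp
  qed
  ultimately show ?thesis using obs_poly[of \<pi> \<mu> "\<lambda>i. herm \<sigma> (count A i) * herm \<sigma> (count B i)"] by simp
qed

text \<open>The distributive law: a choice of exponents bounded by those of \<open>A\<close> is a
  submultiset of \<open>A\<close>.\<close>

lemma sum_submultisets_prod:
  fixes f :: "entry \<Rightarrow> nat \<Rightarrow> real"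
  assumes A: "set_mset A \<subseteq> I"
  shows "(\<Prod>i\<in>I. \<Sum>k\<le>count A i. f i k) = (\<Sum>S\<in>{S. S \<subseteq># A}. \<Prod>i\<in>I. f i (count S i))"
proof -
  have "(\<Prod>i\<in>I. \<Sum>k\<le>count A i. f i k) = (\<Sum>g\<in>(\<Pi>\<^sub>E i\<in>I. {..count A i}). \<Prod>i\<in>I. f i (g i))"
    by (rule prod_sum_PiE) auto
  also have "\<dots> = (\<Sum>S\<in>{S. S \<subseteq># A}. \<Prod>i\<in>I. f i (count S i))"
  proof (rule sum.reindex_bij_witness[of _ "\<lambda>S. restrict (count S) I" "\<lambda>g. \<Sum>i\<in>I. replicate_mset (g i) i"])
    have label_count: "count (\<Sum>i\<in>I. replicate_mset (g i) i) x = (if x \<in> I then g x else 0)" for g x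
      by (simp add: count_sum count_replicate_mset)
    fix g assume g: "g \<in> (\<Pi>\<^sub>E i\<in>I. {..count A i})"
    show "restrict (count (\<Sum>i\<in>I. replicate_mset (g i) i)) I = g"
      using g by (intro extensionalityI[of _ I]) (simp_all add: label_count PiE_iff)
    show "(\<Sum>i\<in>I. replicate_mset (g i) i) \<in> {S. S \<subseteq># A}"
      using g by (auto simp: subseteq_mset_def label_count PiE_iff)
    show "(\<Prod>i\<in>I. f i (count (\<Sum>i\<in>I. replicate_mset (g i) i) i)) = (\<Prod>i\<in>I. f i (g i))"
      by (intro prod.cong refl) (simp add: label_count)
  next
    have label_count: "count (\<Sum>i\<in>I. replicate_mset (g i) i) x = (if x \<in> I then g x else 0)" for g x
      by (simp add: count_sum count_replicate_mset)
    fix S assume "S \<in> {S. S \<subseteq># A}"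
    then have S: "S \<subseteq># A" by simp
    have out: "count S x = 0" if "x \<notin> I" for x
    proof -
      have "x \<notin># S" using that A mset_subset_eqD[OF S] by blast
      then show ?thesis by (simp add: not_in_iff)
    qed
    show "(\<Sum>i\<in>I. replicate_mset (restrict (count S) I i) i) = S"
      by (intro multiset_eqI) (simp add: label_count out)
    show "restrict (count S) I \<in> (\<Pi>\<^sub>E i\<in>I. {..count A i})"
      using mset_subset_eq_count[OF S] by (intro restrict_PiE_iff[THEN iffD2]) simp
  qed
  finally show ?thesis .
qed

lemma cond_moment_expand:
  assumes A: "set_mset A \<subseteq> I"
  shows "cond_moment A x = mfact A * (\<Sum>S\<in>{S. S \<subseteq># A}. (\<Prod>i\<in>I. x i ^ count S i) / mfact S * noise_moment (A - S))"
proof -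
  have "cond_moment A x = mfact A * (\<Prod>i\<in>I. gpow \<sigma> (x i) (count A i) / fact (count A i))"
    using mfact_nz[of A] by (simp add: cond_moment_def prod_dividef mfact_I[OF A, symmetric])
  also have "(\<Prod>i\<in>I. gpow \<sigma> (x i) (count A i) / fact (count A i))
    = (\<Prod>i\<in>I. \<Sum>k\<le>count A i. (x i ^ k / fact k) * (gmom \<sigma> (count A i - k) / fact (count A i - k)))"
    by (simp only: gpow_expand)
  also have "\<dots> = (\<Sum>S\<in>{S. S \<subseteq># A}. \<Prod>i\<in>I. (x i ^ count S i / fact (count S i)) * (gmom \<sigma> (count A i - count S i) / fact (count A i - count S i)))"
    by (rule sum_submultisets_prod[OF A])
  also have "\<dots> = (\<Sum>S\<in>{S. S \<subseteq># A}. (\<Prod>i\<in>I. x i ^ count S i) / mfact S * noise_moment (A - S))"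
  proof (intro sum.cong refl)
    fix S assume "S \<in> {S. S \<subseteq># A}"
    then have S: "set_mset S \<subseteq> I" using A set_mset_mono[of S A] by auto
    show "(\<Prod>i\<in>I. (x i ^ count S i / fact (count S i)) * (gmom \<sigma> (count A i - count S i) / fact (count A i - count S i)))
      = (\<Prod>i\<in>I. x i ^ count S i) / mfact S * noise_moment (A - S)"
      unfolding noise_moment_def mfact_I[OF S] by (simp only: prod.distrib prod_dividef count_diff)
  qed
  finally show ?thesis .
qed

lemma centre_moment_rec:
  assumes j: "j \<in> J"
  shows "centre_moment (add_mset j B) = lam\<^sup>2 * real (count B j) * centre_moment (B - {#j#})"
proof -
  have "centre_moment (add_mset j B) = gmom lam (Suc (count B j)) * (\<Prod>i\<in>J - {j}. gmom lam (count (add_mset j B) i))"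
    unfolding centre_moment_def using j by (subst prod.remove[of _ j]) auto
  also have "(\<Prod>i\<in>J - {j}. gmom lam (count (add_mset j B) i)) = (\<Prod>i\<in>J - {j}. gmom lam (count (B - {#j#}) i))"
    by (intro prod.cong refl) auto
  also have "gmom lam (Suc (count B j)) = lam\<^sup>2 * real (count B j) * gmom lam (count (B - {#j#}) j)"
    by (simp add: gmom_Suc[OF lam])
  also have "lam\<^sup>2 * real (count B j) * gmom lam (count (B - {#j#}) j) * (\<Prod>i\<in>J - {j}. gmom lam (count (B - {#j#}) i))
    = lam\<^sup>2 * real (count B j) * centre_moment (B - {#j#})"
    unfolding centre_moment_def using j by (subst (2) prod.remove[of _ j]) (auto simp: mult.assoc)
  finally show ?thesis .
qed

text \<open>Grouping the entries by the centre coordinate that they read gives a moment of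
  independent Gaussians. Isserlis' formula then expresses it by multigraphs whose edges join entries
  with the same label.\<close>

lemma centres_monomial:
  assumes \<pi>: "\<pi> \<in> perm_space K M" and S: "set_mset S \<subseteq> I"
  shows "has_bochner_integral (centres_law K p lam) (\<lambda>\<mu>. \<Prod>i\<in>I. mean \<pi> \<mu> i ^ count S i)
    (mfact S * push E (lam\<^sup>2 / 2) (eps (label_of \<pi>)) S)"
proof -
  let ?c = "centre_of (label_of \<pi>)"
  interpret product_sigma_finite "\<lambda>i::nat \<times> nat. gaussian 0 lam"
    using prob_space_gaussian[OF lam] by (simp add: product_sigma_finite_def prob_space_imp_sigma_finite)
  have cJ: "?c i \<in> J" if "i \<in> I" for i
    using label_of_in[OF \<pi>, of "(fst i, fst (snd i))"] that by (auto simp: centre_of_def entries_def)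
  have eq: "(\<Prod>i\<in>I. mean \<pi> \<mu> i ^ count S i) = (\<Prod>j\<in>J. \<mu> j ^ count (image_mset ?c S) j)" for \<mu>
  proof -
    have "(\<Prod>i\<in>I. mean \<pi> \<mu> i ^ count S i) = (\<Prod>i\<in>set_mset S. mean \<pi> \<mu> i ^ count S i)"
      using S by (intro prod.mono_neutral_right) (auto simp: not_in_iff)
    also have "\<dots> = prod_mset (image_mset (mean \<pi> \<mu>) S)" by (rule image_prod_mset_multiplicity[symmetric])
    also have "image_mset (mean \<pi> \<mu>) S = image_mset \<mu> (image_mset ?c S)"
      unfolding multiset.map_comp by (intro image_mset_cong) (simp add: mean_def)
    also have "prod_mset \<dots> = (\<Prod>j\<in>set_mset (image_mset ?c S). \<mu> j ^ count (image_mset ?c S) j)"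
      by (rule image_prod_mset_multiplicity)
    also have "\<dots> = (\<Prod>j\<in>J. \<mu> j ^ count (image_mset ?c S) j)"
    proof (rule prod.mono_neutral_left)
      show "set_mset (image_mset ?c S) \<subseteq> J"
        unfolding set_image_mset using S cJ by blast
      show "\<forall>j\<in>J - set_mset (image_mset ?c S). \<mu> j ^ count (image_mset ?c S) j = 1"
      proof
        fix j assume "j \<in> J - set_mset (image_mset ?c S)"
        then have "count (image_mset ?c S) j = 0" by (metis DiffD2 count_eq_zero_iff)
        then show "\<mu> j ^ count (image_mset ?c S) j = 1" by simp
      qed
    qed simp
    finally show ?thesis .
  qed
  have hb: "has_bochner_integral (gaussian 0 lam) (\<lambda>y. y ^ n) (gmom lam n)" for n
    using gaussian_moment[OF lam, of 0 n] by simp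
  have "has_bochner_integral (centres_law K p lam) (\<lambda>\<mu>. \<Prod>j\<in>J. \<mu> j ^ count (image_mset ?c S) j) (centre_moment (image_mset ?c S))"
    unfolding centres_law_def has_bochner_integral_iff centre_moment_def
    using product_integrable_prod[of J "\<lambda>j y. y ^ count (image_mset ?c S) j"]
      product_integral_prod[of J "\<lambda>j y. y ^ count (image_mset ?c S) j"]
      integrable.intros[OF hb] has_bochner_integral_integral_eq[OF hb] by simp
  moreover have "centre_moment (image_mset ?c S) = mfact S * push E (lam\<^sup>2 / 2) (eps (label_of \<pi>)) S"
  proof (rule isserlis[OF _ _ _ S])
    show "centre_moment {#} = 1" by (simp add: centre_moment_def)
  qed (use centre_moment_rec label_of_in[OF \<pi>] in blast)+
  ultimately show ?thesis unfolding eq by simp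
qed

lemma centres_cond_moment:
  assumes \<pi>: "\<pi> \<in> perm_space K M" and A: "set_mset A \<subseteq> I"
  shows "has_bochner_integral (centres_law K p lam) (\<lambda>\<mu>. cond_moment A (mean \<pi> \<mu>))
    (mfact A * conv (push E (lam\<^sup>2 / 2) (eps (label_of \<pi>))) noise_moment A)"
proof -
  have "has_bochner_integral (centres_law K p lam)
    (\<lambda>\<mu>. mfact A * (\<Sum>S\<in>{S. S \<subseteq># A}. (\<Prod>i\<in>I. mean \<pi> \<mu> i ^ count S i) / mfact S * noise_moment (A - S)))
    (mfact A * (\<Sum>S\<in>{S. S \<subseteq># A}. (mfact S * push E (lam\<^sup>2 / 2) (eps (label_of \<pi>)) S) / mfact S * noise_moment (A - S)))"
  proof (intro has_bochner_integral_mult_right has_bochner_integral_sum has_bochner_integral_mult_left has_bochner_integral_divide_zero centres_monomial[OF \<pi>])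
    fix S assume "S \<in> {S. S \<subseteq># A}"
    then show "set_mset S \<subseteq> I" using A set_mset_mono[of S A] by auto
  qed
  then show ?thesis by (simp add: cond_moment_expand[OF A] conv_def)
qed

end

section \<open>Averages over the permutations and the coefficients of the certificate\<close>

lemma avg_add: "avg K M (\<lambda>\<pi>. f \<pi> + g \<pi>) = avg K M f + avg K M g"
  by (simp add: avg_def sum.distrib add_divide_distrib)

lemma avg_diff: "avg K M (\<lambda>\<pi>. f \<pi> - g \<pi>) = avg K M f - avg K M g"
  by (simp add: avg_def sum_subtractf diff_divide_distrib)

lemma avg_cmult: "avg K M (\<lambda>\<pi>. c * f \<pi>) = c * avg K M f"
  by (simp add: avg_def sum_distrib_left)

lemma avg_sum: "avg K M (\<lambda>\<pi>. \<Sum>i\<in>A. f i \<pi>) = (\<Sum>i\<in>A. avg K M (f i))"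
  unfolding avg_def by (subst sum.swap) (simp add: sum_divide_distrib)

lemma avg_mono: "(\<And>\<pi>. \<pi> \<in> perm_space K M \<Longrightarrow> f \<pi> \<le> g \<pi>) \<Longrightarrow> avg K M f \<le> avg K M g"
  unfolding avg_def by (intro divide_right_mono sum_mono) auto

lemma avg_conv_right: "avg K M (\<lambda>\<pi>. conv f (g \<pi>) A) = conv f (\<lambda>B. avg K M (\<lambda>\<pi>. g \<pi> B)) A"
  unfolding conv_def by (simp add: avg_sum avg_cmult)

lemma avg_push_conv:
  "avg K M (\<lambda>\<pi>. x \<pi> * conv (push E c (h \<pi>)) G A) = conv (push E c (\<lambda>\<theta>. avg K M (\<lambda>\<pi>. x \<pi> * h \<pi> \<theta>))) G A"
proof -
  have "x \<pi> * conv (push E c (h \<pi>)) G A = (\<Sum>B\<in>{B. B \<subseteq># A}. \<Sum>\<theta>\<in>fibre E B. (c ^ size \<theta> * G (A - B)) * (x \<pi> * h \<pi> \<theta>))" for \<pi>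
    unfolding conv_def push_def by (simp add: sum_distrib_left sum_distrib_right mult_ac)
  then have "avg K M (\<lambda>\<pi>. x \<pi> * conv (push E c (h \<pi>)) G A)
    = (\<Sum>B\<in>{B. B \<subseteq># A}. \<Sum>\<theta>\<in>fibre E B. (c ^ size \<theta> * G (A - B)) * avg K M (\<lambda>\<pi>. x \<pi> * h \<pi> \<theta>))"
    by (simp only: avg_sum avg_cmult)
  also have "\<dots> = conv (push E c (\<lambda>\<theta>. avg K M (\<lambda>\<pi>. x \<pi> * h \<pi> \<theta>))) G A"
    unfolding conv_def push_def by (simp add: sum_distrib_left sum_distrib_right mult_ac)
  finally show ?thesis .
qed

context gaussian_model
begin

definition mset_index :: "(entry \<Rightarrow> nat) \<Rightarrow> entry multiset" where
  "mset_index \<alpha> = (\<Sum>i\<in>I. replicate_mset (\<alpha> i) i)"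

lemma count_mset_index: "count (mset_index \<alpha>) i = (if i \<in> I then \<alpha> i else 0)"
  by (simp add: mset_index_def count_sum count_replicate_mset)

lemma set_mset_index: "set_mset (mset_index \<alpha>) \<subseteq> I"
proof
  fix i assume "i \<in># mset_index \<alpha>"
  then show "i \<in> I" using count_mset_index[of \<alpha> i] by (metis count_eq_zero_iff)
qed

lemma size_mset_index: "size (mset_index \<alpha>) = (\<Sum>i\<in>I. \<alpha> i)"
  by (simp add: mset_index_def)

definition low_msets :: "nat \<Rightarrow> entry multiset set" where
  "low_msets D = {B. set_mset B \<subseteq> I \<and> size B \<le> D}"

lemma finite_low_msets [simp]: "finite (low_msets D)"
proof -
  have "low_msets D = (\<Union>l\<in>{..D}. multisets_of I l)" by (auto simp: low_msets_def multisets_of_def)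
  then show ?thesis by simp
qed

definition match_ind :: "vertex \<times> vertex \<Rightarrow> perms \<Rightarrow> real" where
  "match_ind e0 \<pi> = of_bool (label_of \<pi> (fst e0) = label_of \<pi> (snd e0))"

text \<open>The joint cumulant of the indicator and of the signals at the entries in
  \<open>B\<close>, divided by \<open>mfact B\<close>; \<open>push\<close> pairs the entries as in
  Isserlis' formula.\<close>

definition cert :: "vertex \<times> vertex \<Rightarrow> entry multiset \<Rightarrow> real" where
  "cert e0 = push E (lam\<^sup>2 / 2) (cumulant K M e0)"

text \<open>The second moment of the certificate \<open>W = (\<Sum>B. cert B / \<sigma> ^ (2 * size B) * hermB B)\<close>: the
  polynomials \<open>hermB B\<close> are monic, orthogonal and of squared norm \<open>\<sigma> ^ (2 * size B) * mfact B\<close>.\<close>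

definition cert_norm :: "vertex \<times> vertex \<Rightarrow> nat \<Rightarrow> real" where
  "cert_norm e0 D = (\<Sum>B\<in>low_msets D. (cert e0 B)\<^sup>2 * mfact B / \<sigma> ^ (2 * size B))"

text \<open>\<open>E[Y^A | \<pi>]\<close> divided by the factorial of \<open>A\<close>, by
  \<open>centres_cond_moment\<close>.\<close>

definition obs_moment :: "perms \<Rightarrow> entry multiset \<Rightarrow> real" where
  "obs_moment \<pi> = conv (push E (lam\<^sup>2 / 2) (eps (label_of \<pi>))) noise_moment"

text \<open>The equation that makes \<open>W\<close> a dual certificate,
  \<open>E[x Y^A] = E[W Y^A]\<close>. On the level of matching indicators it is
  \<open>cumulant_conv\<close>; \<open>push_conv\<close> carries it over to the entries, and the
  noise is split off on the right by \<open>conv_assoc\<close>.\<close>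

lemma avg_match_PQ: "avg K M (\<lambda>\<pi>. match_ind e0 \<pi> * obs_moment \<pi> A) = avg K M (\<lambda>\<pi>. conv (cert e0) (obs_moment \<pi>) A)"
proof -
  have match_moment: "avg K M (\<lambda>\<pi>. eps (label_of \<pi>) \<theta>) = match_moment K M \<theta>" for \<theta> :: "cedge multiset"
    using avg_cmult[of K M "1 / mfact \<theta>" "\<lambda>\<pi>. of_bool (sat (label_of \<pi>) (edges_of \<theta>))"] by (simp add: match_moment_def eps_def)
  have match_moment_at: "avg K M (\<lambda>\<pi>. match_ind e0 \<pi> * eps (label_of \<pi>) \<theta>) = match_moment_at K M e0 \<theta>" for \<theta> :: "cedge multiset"
  proof -
    have "match_ind e0 \<pi> * eps (label_of \<pi>) \<theta> = of_bool (sat (label_of \<pi>) (insert e0 (edges_of \<theta>))) / mfact \<theta>" for \<pi>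
      using sat_insert[of "label_of \<pi>" "fst e0" "snd e0" "edges_of \<theta>"] by (simp add: match_ind_def eps_def)
    then show ?thesis
      using avg_cmult[of K M "1 / mfact \<theta>" "\<lambda>\<pi>. of_bool (sat (label_of \<pi>) (insert e0 (edges_of \<theta>)))"] by (simp add: match_moment_at_def)
  qed
  have PQ1: "avg K M (\<lambda>\<pi>. obs_moment \<pi> B) = conv (push E (lam\<^sup>2 / 2) (match_moment K M)) noise_moment B" for B
    using avg_push_conv[of K M "\<lambda>_. 1" E "lam\<^sup>2 / 2" "\<lambda>\<pi>. eps (label_of \<pi>)" noise_moment B] by (simp add: obs_moment_def match_moment)
  have "avg K M (\<lambda>\<pi>. match_ind e0 \<pi> * obs_moment \<pi> A) = conv (push E (lam\<^sup>2 / 2) (match_moment_at K M e0)) noise_moment A"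
    unfolding obs_moment_def avg_push_conv match_moment_at ..
  also have "match_moment_at K M e0 = (conv (cumulant K M e0) (match_moment K M) :: cedge multiset \<Rightarrow> real)" by (intro ext) (rule cumulant_conv[symmetric])
  also have "push E (lam\<^sup>2 / 2) (conv (cumulant K M e0) (match_moment K M)) = conv (cert e0) (push E (lam\<^sup>2 / 2) (match_moment K M))"
    unfolding cert_def by (intro ext) (rule push_conv, simp)
  also have "conv (conv (cert e0) (push E (lam\<^sup>2 / 2) (match_moment K M))) noise_moment A = conv (cert e0) (\<lambda>B. avg K M (\<lambda>\<pi>. obs_moment \<pi> B)) A"
    unfolding PQ1 conv_assoc ..
  also have "\<dots> = avg K M (\<lambda>\<pi>. conv (cert e0) (obs_moment \<pi>) A)" by (rule avg_conv_right[symmetric])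
  finally show ?thesis .
qed

lemma monomial_empty: "monomial {#} y = 1" by (simp add: monomial_def)

lemma obs_const: "has_bochner_integral (obs_law K M p \<sigma> \<pi> \<mu>) (\<lambda>_. c) (c::real)"
  using has_bochner_integral_mult_right[OF obs_monomial[of \<pi> \<mu> "{#}"], of c]
  by (simp add: monomial_empty cond_moment_def gpow_def one_pCons del: pCons_one)

lemma centres_const: 
  shows "has_bochner_integral (centres_law K p lam) (\<lambda>_. c) (c::real)"
proof -
  interpret prob_space "centres_law K p lam" using lam by (rule prob_space_centres_law)
  show ?thesis unfolding has_bochner_integral_iff by (simp add: prob_space)
qed

section \<open>The risk of a fixed polynomial against the certificate\<close>

context
  fixes D :: nat and cf :: "(entry \<Rightarrow> nat) \<Rightarrow> real" and e0 :: "vertex \<times> vertex"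
begin

abbreviation "MI \<equiv> multi_indices I D"

definition pol :: "tensor \<Rightarrow> real" where
  "pol y = (\<Sum>\<alpha>\<in>MI. cf \<alpha> * monomial (mset_index \<alpha>) y)"

text \<open>This and the next three are conditional expectations given \<open>\<pi>\<close> and
  \<open>\<mu>\<close>, of \<open>pol^2\<close>, \<open>pol\<close>, \<open>pol * W\<close> and
  \<open>(pol - x)^2\<close>. As finite combinations of \<open>cond_moment\<close> they can be
  integrated over the centres by \<open>centres_cond_moment\<close>.\<close>

definition pol2_mean :: "perms \<Rightarrow> centres \<Rightarrow> real" where
  "pol2_mean \<pi> \<mu> = (\<Sum>\<alpha>\<in>MI. \<Sum>\<beta>\<in>MI. cf \<alpha> * cf \<beta> * cond_moment (mset_index \<alpha> + mset_index \<beta>) (mean \<pi> \<mu>))"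

definition pol_mean :: "perms \<Rightarrow> centres \<Rightarrow> real" where
  "pol_mean \<pi> \<mu> = (\<Sum>\<alpha>\<in>MI. cf \<alpha> * cond_moment (mset_index \<alpha>) (mean \<pi> \<mu>))"

definition pol_cert_mean :: "perms \<Rightarrow> centres \<Rightarrow> real" where
  "pol_cert_mean \<pi> \<mu> = (\<Sum>\<alpha>\<in>MI. cf \<alpha> * (\<Sum>B\<in>{B. B \<subseteq># mset_index \<alpha>}. cert e0 B *
      (mfact (mset_index \<alpha>) / mfact (mset_index \<alpha> - B) * cond_moment (mset_index \<alpha> - B) (mean \<pi> \<mu>))))"

definition sq_mean :: "perms \<Rightarrow> centres \<Rightarrow> real" where
  "sq_mean \<pi> \<mu> = pol2_mean \<pi> \<mu> - 2 * match_ind e0 \<pi> * pol_mean \<pi> \<mu> + match_ind e0 \<pi>"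

lemma obs_pol: "has_bochner_integral (obs_law K M p \<sigma> \<pi> \<mu>) pol (pol_mean \<pi> \<mu>)"
  unfolding pol_def[abs_def] pol_mean_def
  by (intro has_bochner_integral_sum has_bochner_integral_mult_right obs_monomial)

lemma obs_pol2: "has_bochner_integral (obs_law K M p \<sigma> \<pi> \<mu>) (\<lambda>y. (pol y)\<^sup>2) (pol2_mean \<pi> \<mu>)"
proof -
  have "(pol y)\<^sup>2 = (\<Sum>\<alpha>\<in>MI. \<Sum>\<beta>\<in>MI. cf \<alpha> * cf \<beta> * monomial (mset_index \<alpha> + mset_index \<beta>) y)" for y
    unfolding pol_def power2_eq_square sum_product monomial_add[symmetric] by (simp only: mult_ac)
  then show ?thesis
    unfolding pol2_mean_def by (simp only:) (intro has_bochner_integral_sum has_bochner_integral_mult_right obs_monomial)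
qed

lemma obs_sq: "has_bochner_integral (obs_law K M p \<sigma> \<pi> \<mu>) (\<lambda>y. (pol y - match_ind e0 \<pi>)\<^sup>2) (sq_mean \<pi> \<mu>)"
proof -
  have i2: "match_ind e0 \<pi> * match_ind e0 \<pi> = match_ind e0 \<pi>" by (simp add: match_ind_def)
  have "(\<lambda>y. (pol y - match_ind e0 \<pi>)\<^sup>2) = (\<lambda>y. (pol y)\<^sup>2 - 2 * match_ind e0 \<pi> * pol y + match_ind e0 \<pi>)"
    by (intro ext) (simp add: power2_diff power2_eq_square i2 algebra_simps)
  moreover have "has_bochner_integral (obs_law K M p \<sigma> \<pi> \<mu>) (\<lambda>y. (pol y)\<^sup>2 - 2 * match_ind e0 \<pi> * pol y + match_ind e0 \<pi>) (sq_mean \<pi> \<mu>)"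
    unfolding sq_mean_def
    by (intro has_bochner_integral_add has_bochner_integral_diff has_bochner_integral_mult_right obs_pol2 obs_pol obs_const)
  ultimately show ?thesis by simp
qed

lemma low_msetsD: "B \<in> low_msets D \<Longrightarrow> set_mset B \<subseteq> I" by (simp add: low_msets_def)

lemma sub_low:
  assumes "\<alpha> \<in> MI" shows "{B \<in> low_msets D. B \<subseteq># mset_index \<alpha>} = {B. B \<subseteq># mset_index \<alpha>}"
proof -
  have "size (mset_index \<alpha>) \<le> D" using assms by (simp add: size_mset_index multi_indices_def)
  then show ?thesis
    using set_mset_index[of \<alpha>] by (auto simp: low_msets_def dest: size_mset_mono mset_subset_eqD)
qed

text \<open>The expansion of \<open>E[(pol - W)^2 | \<pi>, \<mu>] >= 0\<close>. By orthogonality the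
  conditional second moment of \<open>W\<close> is the constant \<open>cert_norm e0 D\<close>,
  whatever \<open>\<pi>\<close> and \<open>\<mu>\<close> are.\<close>

lemma pol2_mean_ge: "2 * pol_cert_mean \<pi> \<mu> - cert_norm e0 D \<le> pol2_mean \<pi> \<mu>"
proof -
  let ?O = "obs_law K M p \<sigma> \<pi> \<mu>" and ?x = "mean \<pi> \<mu>" and ?A = "low_msets D"
  define W where "W y = (\<Sum>B\<in>?A. cert e0 B / \<sigma> ^ (2 * size B) * hermB ?x B y)" for y
  have s0: "\<sigma> ^ n \<noteq> 0" for n using sigma by simp
  have gen1: "(a / s) * (a / s) * (s * m) = a\<^sup>2 * m / s" if "s \<noteq> 0" for a s m :: real
    using that by (simp add: power2_eq_square)
  have gen2: "(a / s) * (s * b * g) = a * (b * g)" if "s \<noteq> 0" for a s b g :: real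
    using that by simp
  have "has_bochner_integral ?O (\<lambda>y. \<Sum>B\<in>?A. \<Sum>C\<in>?A. (cert e0 B / \<sigma> ^ (2 * size B)) * (cert e0 C / \<sigma> ^ (2 * size C)) * (hermB ?x B y * hermB ?x C y))
     (\<Sum>B\<in>?A. \<Sum>C\<in>?A. (cert e0 B / \<sigma> ^ (2 * size B)) * (cert e0 C / \<sigma> ^ (2 * size C)) * (if B = C then \<sigma> ^ (2 * size B) * mfact B else 0))"
    by (intro has_bochner_integral_sum has_bochner_integral_mult_right obs_herm_herm low_msetsD)
  moreover have "(\<Sum>B\<in>?A. \<Sum>C\<in>?A. (cert e0 B / \<sigma> ^ (2 * size B)) * (cert e0 C / \<sigma> ^ (2 * size C)) * (if B = C then \<sigma> ^ (2 * size B) * mfact B else 0))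
     = cert_norm e0 D"
    unfolding cert_norm_def
  proof (intro sum.cong refl)
    fix B assume B: "B \<in> ?A"
    have "(\<Sum>C\<in>?A. (cert e0 B / \<sigma> ^ (2 * size B)) * (cert e0 C / \<sigma> ^ (2 * size C)) * (if B = C then \<sigma> ^ (2 * size B) * mfact B else 0))
      = (\<Sum>C\<in>?A. if B = C then (cert e0 B / \<sigma> ^ (2 * size B)) * (cert e0 C / \<sigma> ^ (2 * size C)) * (\<sigma> ^ (2 * size B) * mfact B) else 0)"
      by (intro sum.cong refl) simp
    also have "\<dots> = (cert e0 B / \<sigma> ^ (2 * size B)) * (cert e0 B / \<sigma> ^ (2 * size B)) * (\<sigma> ^ (2 * size B) * mfact B)"
      using B by (subst sum.delta'[OF finite_low_msets]) simp
    also have "\<dots> = (cert e0 B)\<^sup>2 * mfact B / \<sigma> ^ (2 * size B)"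
      by (rule gen1[OF s0])
    finally show "(\<Sum>C\<in>?A. (cert e0 B / \<sigma> ^ (2 * size B)) * (cert e0 C / \<sigma> ^ (2 * size C)) * (if B = C then \<sigma> ^ (2 * size B) * mfact B else 0))
      = (cert e0 B)\<^sup>2 * mfact B / \<sigma> ^ (2 * size B)" .
  qed
  moreover have "(\<lambda>y. \<Sum>B\<in>?A. \<Sum>C\<in>?A. (cert e0 B / \<sigma> ^ (2 * size B)) * (cert e0 C / \<sigma> ^ (2 * size C)) * (hermB ?x B y * hermB ?x C y)) = (\<lambda>y. (W y)\<^sup>2)"
    unfolding W_def power2_eq_square sum_product by (simp only: mult_ac)
  ultimately have WW: "has_bochner_integral ?O (\<lambda>y. (W y)\<^sup>2) (cert_norm e0 D)" by simp
  have "has_bochner_integral ?O (\<lambda>y. \<Sum>\<alpha>\<in>MI. cf \<alpha> * (\<Sum>B\<in>?A. (cert e0 B / \<sigma> ^ (2 * size B)) * (hermB ?x B y * monomial (mset_index \<alpha>) y)))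
     (\<Sum>\<alpha>\<in>MI. cf \<alpha> * (\<Sum>B\<in>?A. (cert e0 B / \<sigma> ^ (2 * size B)) *
        (if B \<subseteq># mset_index \<alpha> then \<sigma> ^ (2 * size B) * (mfact (mset_index \<alpha>) / mfact (mset_index \<alpha> - B)) * cond_moment (mset_index \<alpha> - B) ?x else 0)))"
    by (intro has_bochner_integral_sum has_bochner_integral_mult_right obs_herm_monomial set_mset_index low_msetsD)
  moreover have "(\<Sum>\<alpha>\<in>MI. cf \<alpha> * (\<Sum>B\<in>?A. (cert e0 B / \<sigma> ^ (2 * size B)) *
        (if B \<subseteq># mset_index \<alpha> then \<sigma> ^ (2 * size B) * (mfact (mset_index \<alpha>) / mfact (mset_index \<alpha> - B)) * cond_moment (mset_index \<alpha> - B) ?x else 0)))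
    = pol_cert_mean \<pi> \<mu>"
    unfolding pol_cert_mean_def
  proof (rule sum.cong[OF refl], rule arg_cong2[where f="(*)", OF refl])
    fix \<alpha> assume a: "\<alpha> \<in> MI"
    have "(\<Sum>B\<in>?A. (cert e0 B / \<sigma> ^ (2 * size B)) *
        (if B \<subseteq># mset_index \<alpha> then \<sigma> ^ (2 * size B) * (mfact (mset_index \<alpha>) / mfact (mset_index \<alpha> - B)) * cond_moment (mset_index \<alpha> - B) ?x else 0))
      = (\<Sum>B\<in>?A. if B \<subseteq># mset_index \<alpha> then cert e0 B * (mfact (mset_index \<alpha>) / mfact (mset_index \<alpha> - B) * cond_moment (mset_index \<alpha> - B) ?x) else 0)"
    proof (intro sum.cong refl)
      fix B
      show "(cert e0 B / \<sigma> ^ (2 * size B)) *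
          (if B \<subseteq># mset_index \<alpha> then \<sigma> ^ (2 * size B) * (mfact (mset_index \<alpha>) / mfact (mset_index \<alpha> - B)) * cond_moment (mset_index \<alpha> - B) ?x else 0)
        = (if B \<subseteq># mset_index \<alpha> then cert e0 B * (mfact (mset_index \<alpha>) / mfact (mset_index \<alpha> - B) * cond_moment (mset_index \<alpha> - B) ?x) else 0)"
        by (cases "B \<subseteq># mset_index \<alpha>") (simp_all only: if_True if_False mult_zero_right gen2[OF s0])
    qed
    also have "\<dots> = (\<Sum>B\<in>{B \<in> ?A. B \<subseteq># mset_index \<alpha>}. cert e0 B * (mfact (mset_index \<alpha>) / mfact (mset_index \<alpha> - B) * cond_moment (mset_index \<alpha> - B) ?x))"
      by (rule sum.inter_filter[symmetric]) simp
    finally show "(\<Sum>B\<in>?A. (cert e0 B / \<sigma> ^ (2 * size B)) *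
        (if B \<subseteq># mset_index \<alpha> then \<sigma> ^ (2 * size B) * (mfact (mset_index \<alpha>) / mfact (mset_index \<alpha> - B)) * cond_moment (mset_index \<alpha> - B) ?x else 0))
      = (\<Sum>B\<in>{B. B \<subseteq># mset_index \<alpha>}. cert e0 B * (mfact (mset_index \<alpha>) / mfact (mset_index \<alpha> - B) * cond_moment (mset_index \<alpha> - B) ?x))"
      by (simp only: sub_low[OF a])
  qed
  moreover have "(\<lambda>y. \<Sum>\<alpha>\<in>MI. cf \<alpha> * (\<Sum>B\<in>?A. (cert e0 B / \<sigma> ^ (2 * size B)) * (hermB ?x B y * monomial (mset_index \<alpha>) y))) = (\<lambda>y. pol y * W y)"
  proof
    fix y
    have "pol y * W y = (\<Sum>\<alpha>\<in>MI. cf \<alpha> * monomial (mset_index \<alpha>) y * W y)"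
      unfolding pol_def by (rule sum_distrib_right)
    also have "\<dots> = (\<Sum>\<alpha>\<in>MI. cf \<alpha> * (\<Sum>B\<in>?A. (cert e0 B / \<sigma> ^ (2 * size B)) * (hermB ?x B y * monomial (mset_index \<alpha>) y)))"
    proof (rule sum.cong[OF refl])
      fix \<alpha>
      have "monomial (mset_index \<alpha>) y * W y = (\<Sum>B\<in>?A. (cert e0 B / \<sigma> ^ (2 * size B)) * (hermB ?x B y * monomial (mset_index \<alpha>) y))"
        unfolding W_def sum_distrib_left by (rule sum.cong[OF refl]) (simp only: mult_ac)
      then show "cf \<alpha> * monomial (mset_index \<alpha>) y * W y
          = cf \<alpha> * (\<Sum>B\<in>?A. (cert e0 B / \<sigma> ^ (2 * size B)) * (hermB ?x B y * monomial (mset_index \<alpha>) y))"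
        by (simp only: mult.assoc)
    qed
    finally show "(\<Sum>\<alpha>\<in>MI. cf \<alpha> * (\<Sum>B\<in>?A. (cert e0 B / \<sigma> ^ (2 * size B)) * (hermB ?x B y * monomial (mset_index \<alpha>) y))) = pol y * W y" ..
  qed
  ultimately have fW: "has_bochner_integral ?O (\<lambda>y. pol y * W y) (pol_cert_mean \<pi> \<mu>)" by simp
  have "has_bochner_integral ?O (\<lambda>y. (pol y)\<^sup>2 - 2 * (pol y * W y) + (W y)\<^sup>2) (pol2_mean \<pi> \<mu> - 2 * pol_cert_mean \<pi> \<mu> + cert_norm e0 D)"
    by (intro has_bochner_integral_add has_bochner_integral_diff has_bochner_integral_mult_right obs_pol2 fW WW)
  moreover have "(\<lambda>y. (pol y)\<^sup>2 - 2 * (pol y * W y) + (W y)\<^sup>2) = (\<lambda>y. (pol y - W y)\<^sup>2)"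
    by (intro ext) (simp add: power2_diff)
  ultimately have "integral\<^sup>L ?O (\<lambda>y. (pol y - W y)\<^sup>2) = pol2_mean \<pi> \<mu> - 2 * pol_cert_mean \<pi> \<mu> + cert_norm e0 D"
    by (simp add: has_bochner_integral_iff)
  moreover have "integral\<^sup>L ?O (\<lambda>y. (pol y - W y)\<^sup>2) \<ge> 0" by (rule Bochner_Integration.integral_nonneg) simp
  ultimately show ?thesis by linarith
qed

lemma sq_mean_nonneg: "sq_mean \<pi> \<mu> \<ge> 0"
proof -
  have "integral\<^sup>L (obs_law K M p \<sigma> \<pi> \<mu>) (\<lambda>y. (pol y - match_ind e0 \<pi>)\<^sup>2) = sq_mean \<pi> \<mu>"
    using obs_sq by (rule has_bochner_integral_integral_eq)
  moreover have "integral\<^sup>L (obs_law K M p \<sigma> \<pi> \<mu>) (\<lambda>y. (pol y - match_ind e0 \<pi>)\<^sup>2) \<ge> 0"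
    by (rule Bochner_Integration.integral_nonneg) simp
  ultimately show ?thesis by simp
qed

lemma integrable_sq_mean:
  assumes \<pi>: "\<pi> \<in> perm_space K M"
  shows "integrable (centres_law K p lam) (sq_mean \<pi>)"
proof -
  have i: "integrable (centres_law K p lam) (\<lambda>\<mu>. cond_moment A (mean \<pi> \<mu>))" if "set_mset A \<subseteq> I" for A
    using centres_cond_moment[OF \<pi> that] by (rule integrable.intros)
  have "integrable (centres_law K p lam) (\<lambda>\<mu>. pol2_mean \<pi> \<mu> - 2 * match_ind e0 \<pi> * pol_mean \<pi> \<mu> + match_ind e0 \<pi>)"
    unfolding pol2_mean_def pol_mean_def
    using set_mset_index
    by (intro Bochner_Integration.integrable_add Bochner_Integration.integrable_diff Bochner_Integration.integrable_sum
        integrable_mult_right i integrable.intros[OF centres_const]) auto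
  then show ?thesis by (simp add: sq_mean_def[abs_def])
qed

text \<open>Conditionally \<open>pol * W\<close> and \<open>x * pol\<close> have different
  expectations; only after averaging over the permutations do they agree, and then the two cross
  terms cancel. What is left is \<open>E[x^2] - E[W^2]\<close>, with \<open>x^2 = x\<close>.\<close>

lemma avg_sq_mean_ge:
  "avg K M (match_ind e0) - cert_norm e0 D \<le> avg K M (\<lambda>\<pi>. \<integral>\<mu>. sq_mean \<pi> \<mu> \<partial>centres_law K p lam)"
proof -
  let ?C = "centres_law K p lam"
  let ?m = mset_index
  let ?f = "\<lambda>\<pi>. \<Sum>\<alpha>\<in>MI. cf \<alpha> * (mfact (?m \<alpha>) * conv (cert e0) (obs_moment \<pi>) (?m \<alpha>))"
  let ?h = "\<lambda>\<pi>. \<Sum>\<alpha>\<in>MI. cf \<alpha> * (mfact (?m \<alpha>) * obs_moment \<pi> (?m \<alpha>))"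
  have "2 * ?f \<pi> - cert_norm e0 D - 2 * match_ind e0 \<pi> * ?h \<pi> + match_ind e0 \<pi> \<le> (\<integral>\<mu>. sq_mean \<pi> \<mu> \<partial>?C)"
    if \<pi>: "\<pi> \<in> perm_space K M" for \<pi>
  proof -
    have fm: "has_bochner_integral ?C (pol_mean \<pi>) (?h \<pi>)"
      unfolding pol_mean_def[abs_def] obs_moment_def
      by (intro has_bochner_integral_sum has_bochner_integral_mult_right centres_cond_moment[OF \<pi>] set_mset_index)
    have "has_bochner_integral ?C (\<lambda>\<mu>. \<Sum>\<alpha>\<in>MI. cf \<alpha> * (\<Sum>B\<in>{B. B \<subseteq># ?m \<alpha>}. cert e0 B *
        (mfact (?m \<alpha>) / mfact (?m \<alpha> - B) * cond_moment (?m \<alpha> - B) (mean \<pi> \<mu>))))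
      (\<Sum>\<alpha>\<in>MI. cf \<alpha> * (\<Sum>B\<in>{B. B \<subseteq># ?m \<alpha>}. cert e0 B * (mfact (?m \<alpha>) / mfact (?m \<alpha> - B) *
        (mfact (?m \<alpha> - B) * obs_moment \<pi> (?m \<alpha> - B)))))"
      unfolding obs_moment_def
    proof (intro has_bochner_integral_sum has_bochner_integral_mult_right centres_cond_moment[OF \<pi>])
      show "set_mset (?m \<alpha> - B) \<subseteq> I" for \<alpha> B using set_mset_index[of \<alpha>] by (meson in_diffD subset_iff)
    qed
    moreover have "(\<Sum>\<alpha>\<in>MI. cf \<alpha> * (\<Sum>B\<in>{B. B \<subseteq># ?m \<alpha>}. cert e0 B * (mfact (?m \<alpha>) / mfact (?m \<alpha> - B) *
        (mfact (?m \<alpha> - B) * obs_moment \<pi> (?m \<alpha> - B))))) = ?f \<pi>"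
      unfolding conv_def by (intro sum.cong refl arg_cong2[where f="(*)"]) (simp add: sum_distrib_left mult_ac)
    ultimately have fc: "has_bochner_integral ?C (pol_cert_mean \<pi>) (?f \<pi>)"
      by (simp only: pol_cert_mean_def[abs_def])
    have "has_bochner_integral ?C (\<lambda>\<mu>. 2 * pol_cert_mean \<pi> \<mu> - cert_norm e0 D - 2 * match_ind e0 \<pi> * pol_mean \<pi> \<mu> + match_ind e0 \<pi>)
       (2 * ?f \<pi> - cert_norm e0 D - 2 * match_ind e0 \<pi> * ?h \<pi> + match_ind e0 \<pi>)"
      by (intro has_bochner_integral_add has_bochner_integral_diff has_bochner_integral_mult_right fm fc centres_const)
    then have e1: "(\<integral>\<mu>. 2 * pol_cert_mean \<pi> \<mu> - cert_norm e0 D - 2 * match_ind e0 \<pi> * pol_mean \<pi> \<mu> + match_ind e0 \<pi> \<partial>?C)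
        = 2 * ?f \<pi> - cert_norm e0 D - 2 * match_ind e0 \<pi> * ?h \<pi> + match_ind e0 \<pi>"
      and e2: "integrable ?C (\<lambda>\<mu>. 2 * pol_cert_mean \<pi> \<mu> - cert_norm e0 D - 2 * match_ind e0 \<pi> * pol_mean \<pi> \<mu> + match_ind e0 \<pi>)"
      unfolding has_bochner_integral_iff by blast+
    have le: "2 * pol_cert_mean \<pi> \<mu> - cert_norm e0 D - 2 * match_ind e0 \<pi> * pol_mean \<pi> \<mu> + match_ind e0 \<pi> \<le> sq_mean \<pi> \<mu>" for \<mu>
      using pol2_mean_ge[of \<pi> \<mu>] by (simp add: sq_mean_def)
    show ?thesis
      unfolding e1[symmetric] by (rule integral_mono[OF e2 integrable_sq_mean[OF \<pi>] le])
  qed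
  then have "avg K M (\<lambda>\<pi>. 2 * ?f \<pi> - cert_norm e0 D - 2 * match_ind e0 \<pi> * ?h \<pi> + match_ind e0 \<pi>)
     \<le> avg K M (\<lambda>\<pi>. \<integral>\<mu>. sq_mean \<pi> \<mu> \<partial>?C)"
    by (rule avg_mono)
  moreover have "avg K M (\<lambda>\<pi>. 2 * ?f \<pi> - cert_norm e0 D - 2 * match_ind e0 \<pi> * ?h \<pi> + match_ind e0 \<pi>)
    = 2 * avg K M ?f - cert_norm e0 D - 2 * avg K M (\<lambda>\<pi>. match_ind e0 \<pi> * ?h \<pi>) + avg K M (match_ind e0)"
    by (simp only: avg_add avg_diff avg_cmult avg_const mult.assoc)
  \<comment> \<open>\<open>?f\<close> and \<open>?h\<close> are the expectations of
    \<open>pol * W\<close> and \<open>pol\<close> given \<open>\<pi>\<close>, so this is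
    \<open>E[W pol] = E[x pol]\<close>, monomial by monomial.\<close>
  moreover have "avg K M ?f = avg K M (\<lambda>\<pi>. match_ind e0 \<pi> * ?h \<pi>)"
  proof -
    have "avg K M ?f = (\<Sum>\<alpha>\<in>MI. cf \<alpha> * (mfact (?m \<alpha>) * avg K M (\<lambda>\<pi>. match_ind e0 \<pi> * obs_moment \<pi> (?m \<alpha>))))"
      by (simp only: avg_sum avg_cmult avg_match_PQ)
    also have "\<dots> = avg K M (\<lambda>\<pi>. \<Sum>\<alpha>\<in>MI. cf \<alpha> * (mfact (?m \<alpha>) * (match_ind e0 \<pi> * obs_moment \<pi> (?m \<alpha>))))"
      by (simp only: avg_sum avg_cmult)
    also have "\<dots> = avg K M (\<lambda>\<pi>. match_ind e0 \<pi> * ?h \<pi>)"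
      by (intro avg_cong) (simp only: sum_distrib_left mult_ac)
    finally show ?thesis .
  qed
  ultimately show ?thesis by linarith
qed

end

end

section \<open>The joint law\<close>

lemma space_perms_law: "space (perms_law K M) = perm_space K M"
  by (simp add: perms_law_def perm_space_def space_PiM space_uniform_count_measure)

text \<open>A finite product of uniform measures gives every point the same mass, so the law is the
  uniform measure on \<open>perm_space K M\<close>.\<close>

lemma nn_integral_perms_law:
  "(\<integral>\<^sup>+\<pi>. f \<pi> \<partial>perms_law K M) = (\<Sum>\<pi>\<in>perm_space K M. ennreal (1 / real (card (perm_space K M))) * f \<pi>)"
proof -
  let ?P = "{\<pi>. \<pi> permutes {1..K}}"
  have finP: "finite ?P" by (intro finite_permutations) simp
  have id: "id \<in> ?P" by (simp add: permutes_id)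
  then have "?P \<noteq> {}" by blast
  then have cP: "card ?P > 0" using finP card_gt_0_iff by blast
  interpret product_prob_space "\<lambda>_::nat. uniform_count_measure ?P"
    using prob_space_uniform_count_measure[OF finP \<open>?P \<noteq> {}\<close>] by (rule product_prob_spaceI)
  have "perms_law K M = uniform_count_measure (perm_space K M)"
  proof (rule measure_eqI_finite)
    show "sets (perms_law K M) = Pow (perm_space K M)" using finite_sets_perms_law(2) space_perms_law by metis
    show "sets (uniform_count_measure (perm_space K M)) = Pow (perm_space K M)" by (simp add: sets_uniform_count_measure)
    fix \<pi> assume \<pi>: "\<pi> \<in> perm_space K M"
    then have "{\<pi>} = (\<Pi>\<^sub>E m\<in>{1..M}. {\<pi> m})"
      using PiE_singleton[of \<pi> "{1..M}"] by (simp add: perm_space_def PiE_iff)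
    then have "emeasure (perms_law K M) {\<pi>} = (\<Prod>m\<in>{1..M}. emeasure (uniform_count_measure ?P) {\<pi> m})"
      unfolding perms_law_def using \<pi>
      by (simp only:) (rule emeasure_PiM, auto simp: sets_uniform_count_measure perm_space_def PiE_iff)
    also have "\<dots> = (\<Prod>m\<in>{1..M}. ennreal (1 / real (card ?P)))"
      using \<pi> finP by (intro prod.cong refl) (subst emeasure_uniform_count_measure, auto simp: perm_space_def PiE_iff)
    also have "\<dots> = ennreal (1 / real (card (perm_space K M)))"
    proof -
      have "card (perm_space K M) = card ?P ^ M" unfolding perm_space_def by (simp add: card_PiE)
      then show ?thesis by (simp add: ennreal_power power_divide)
    qed
    also have "\<dots> = emeasure (uniform_count_measure (perm_space K M)) {\<pi>}"
      using \<pi> by (subst emeasure_uniform_count_measure) auto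
    finally show "emeasure (perms_law K M) {\<pi>} = emeasure (uniform_count_measure (perm_space K M)) {\<pi>}" .
  qed simp
  then show ?thesis
    by (simp add: uniform_count_measure_def nn_integral_point_measure_finite)
qed

context gaussian_model
begin

abbreviation "joint_space \<equiv> perms_law K M \<Otimes>\<^sub>M (centres_law K p lam \<Otimes>\<^sub>M (\<Pi>\<^sub>M i\<in>I. (borel :: real measure)))"

definition kernel :: "perms \<times> centres \<Rightarrow> (perms \<times> centres \<times> tensor) measure" where
  "kernel = (\<lambda>(\<pi>, \<mu>). distr (obs_law K M p \<sigma> \<pi> \<mu>) joint_space (\<lambda>Y. (\<pi>, \<mu>, Y)))"

lemma matching_prior_kernel: "matching_prior K M p lam \<sigma> = (perms_law K M \<Otimes>\<^sub>M centres_law K p lam) \<bind> kernel"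
  by (simp add: matching_prior_def kernel_def)

lemma measurable_kernel: "kernel \<in> (perms_law K M \<Otimes>\<^sub>M centres_law K p lam) \<rightarrow>\<^sub>M subprob_algebra joint_space"
proof -
  let ?P = "perms_law K M \<Otimes>\<^sub>M centres_law K p lam"
  have g: "(\<lambda>(x, Y). (fst x, snd x, Y)) \<in> ?P \<Otimes>\<^sub>M (\<Pi>\<^sub>M i\<in>I. (borel :: real measure)) \<rightarrow>\<^sub>M joint_space" by measurable
  have "(\<lambda>x. distr ((\<lambda>(\<pi>, \<mu>). obs_law K M p \<sigma> \<pi> \<mu>) x) joint_space (\<lambda>Y. (fst x, snd x, Y))) \<in> ?P \<rightarrow>\<^sub>M subprob_algebra joint_space"
    by (rule measurable_distr2[OF g measurable_obs_law[OF sigma]])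
  then show ?thesis by (simp add: split_beta kernel_def)
qed

lemma measurable_monomial [measurable]: "monomial A \<in> borel_measurable (\<Pi>\<^sub>M i\<in>I. (borel :: real measure))"
  unfolding monomial_def[abs_def] by measurable

lemma measurable_on_perms: "f \<in> borel_measurable (perms_law K M)"
  by (rule measurableI) (auto simp: finite_sets_perms_law(2))

text \<open>The integral is first evaluated for extended nonnegative functions, where iterating it
  takes measurability only. Its value is finite, and integrability with respect to the joint law
  follows.\<close>

lemma prior_sq:
  fixes D :: nat and cf :: "(entry \<Rightarrow> nat) \<Rightarrow> real" and e0 :: "vertex \<times> vertex"
  shows "has_bochner_integral (matching_prior K M p lam \<sigma>) (\<lambda>(\<pi>, \<mu>, Y). (pol D cf Y - match_ind e0 \<pi>)\<^sup>2)
    (avg K M (\<lambda>\<pi>. \<integral>\<mu>. sq_mean D cf e0 \<pi> \<mu> \<partial>centres_law K p lam))"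
proof -
  let ?P = "perms_law K M" and ?C = "centres_law K p lam"
  let ?F = "\<lambda>(\<pi>, \<mu>, Y). (pol D cf Y - match_ind e0 \<pi>)\<^sup>2" and ?s = "sq_mean D cf e0"
  interpret C: prob_space ?C using lam by (rule prob_space_centres_law)
  have mi[measurable]: "match_ind e0 \<in> borel_measurable ?P" by (rule measurable_on_perms)
  have mp[measurable]: "pol D cf \<in> borel_measurable (\<Pi>\<^sub>M i\<in>I. (borel :: real measure))"
    unfolding pol_def[abs_def] by measurable
  have F: "?F \<in> borel_measurable joint_space" by measurable
  have inner: "(\<integral>\<^sup>+y. ennreal (?F y) \<partial>kernel (\<pi>, \<mu>)) = ennreal (?s \<pi> \<mu>)"
    if "\<pi> \<in> space ?P" "\<mu> \<in> space ?C" for \<pi> \<mu>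
  proof -
    have m: "(\<lambda>Y. (\<pi>, \<mu>, Y)) \<in> obs_law K M p \<sigma> \<pi> \<mu> \<rightarrow>\<^sub>M joint_space"
      unfolding measurable_cong_sets[OF sets_obs_law refl] using that by simp
    have "(\<integral>\<^sup>+y. ennreal (?F y) \<partial>kernel (\<pi>, \<mu>)) = (\<integral>\<^sup>+Y. ennreal ((pol D cf Y - match_ind e0 \<pi>)\<^sup>2) \<partial>obs_law K M p \<sigma> \<pi> \<mu>)"
      unfolding kernel_def prod.case using F by (subst nn_integral_distr[OF m]) auto
    also have "\<dots> = ennreal (?s \<pi> \<mu>)"
      using obs_sq[of \<pi> \<mu> D cf e0] unfolding has_bochner_integral_iff
      by (subst nn_integral_eq_integral) auto
    finally show ?thesis .
  qed
  \<comment> \<open>The closed form is the integral of a measurable function against the kernel,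
    from which it inherits joint measurability.\<close>
  have meas: "(\<lambda>x. ennreal (?s (fst x) (snd x))) \<in> borel_measurable (?P \<Otimes>\<^sub>M ?C)"
  proof -
    have "(\<lambda>x. \<integral>\<^sup>+y. ennreal (?F y) \<partial>kernel x) \<in> borel_measurable (?P \<Otimes>\<^sub>M ?C)"
      by (rule measurable_compose[OF measurable_kernel]) (rule nn_integral_measurable_subprob_algebra, use F in simp)
    then show ?thesis
      by (rule measurable_cong[THEN iffD1, rotated]) (auto simp: space_pair_measure inner)
  qed
  have "(\<integral>\<^sup>+y. ennreal (?F y) \<partial>matching_prior K M p lam \<sigma>) = (\<integral>\<^sup>+x. \<integral>\<^sup>+y. ennreal (?F y) \<partial>kernel x \<partial>(?P \<Otimes>\<^sub>M ?C))"
    unfolding matching_prior_kernel using F by (intro nn_integral_bind[OF _ measurable_kernel]) simp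
  also have "\<dots> = (\<integral>\<^sup>+x. ennreal (?s (fst x) (snd x)) \<partial>(?P \<Otimes>\<^sub>M ?C))"
    by (intro nn_integral_cong) (auto simp: space_pair_measure inner)
  also have "\<dots> = (\<integral>\<^sup>+\<pi>. \<integral>\<^sup>+\<mu>. ennreal (?s \<pi> \<mu>) \<partial>?C \<partial>?P)"
    using C.nn_integral_fst[OF meas] by simp
  also have "\<dots> = (\<integral>\<^sup>+\<pi>. ennreal (\<integral>\<mu>. ?s \<pi> \<mu> \<partial>?C) \<partial>?P)"
    using integrable_sq_mean[of _ D cf e0] sq_mean_nonneg
    by (intro nn_integral_cong nn_integral_eq_integral) (auto simp: space_perms_law)
  also have "\<dots> = (\<Sum>\<pi>\<in>perm_space K M. ennreal (1 / real (card (perm_space K M))) * ennreal (\<integral>\<mu>. ?s \<pi> \<mu> \<partial>?C))"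
    by (rule nn_integral_perms_law)
  also have "\<dots> = (\<Sum>\<pi>\<in>perm_space K M. ennreal (1 / real (card (perm_space K M)) * (\<integral>\<mu>. ?s \<pi> \<mu> \<partial>?C)))"
    by (intro sum.cong refl ennreal_mult[symmetric]) (auto intro!: Bochner_Integration.integral_nonneg sq_mean_nonneg)
  also have "\<dots> = ennreal (\<Sum>\<pi>\<in>perm_space K M. 1 / real (card (perm_space K M)) * (\<integral>\<mu>. ?s \<pi> \<mu> \<partial>?C))"
    by (rule sum_ennreal) (auto intro!: Bochner_Integration.integral_nonneg sq_mean_nonneg divide_nonneg_nonneg)
  also have "(\<Sum>\<pi>\<in>perm_space K M. 1 / real (card (perm_space K M)) * (\<integral>\<mu>. ?s \<pi> \<mu> \<partial>?C)) = avg K M (\<lambda>\<pi>. \<integral>\<mu>. ?s \<pi> \<mu> \<partial>?C)"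
    by (simp add: avg_def sum_divide_distrib)
  finally have nn: "(\<integral>\<^sup>+y. ennreal (?F y) \<partial>matching_prior K M p lam \<sigma>) = ennreal (avg K M (\<lambda>\<pi>. \<integral>\<mu>. ?s \<pi> \<mu> \<partial>?C))" .
  show ?thesis
  proof (rule has_bochner_integral_nn_integral[OF _ _ _ nn])
    have "perm_space K M \<noteq> {}" using card_perm_space_pos[of K M] by auto
    moreover have "space ?C \<noteq> {}" by (rule C.not_empty)
    ultimately have "space (?P \<Otimes>\<^sub>M ?C) \<noteq> {}" by (simp add: space_pair_measure space_perms_law)
    then have "sets (matching_prior K M p lam \<sigma>) = sets joint_space"
      unfolding matching_prior_kernel by (rule sets_bind_measurable[OF measurable_kernel])
    then show "?F \<in> borel_measurable (matching_prior K M p lam \<sigma>)"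
      using F measurable_cong_sets by blast
    show "0 \<le> avg K M (\<lambda>\<pi>. \<integral>\<mu>. ?s \<pi> \<mu> \<partial>?C)"
      unfolding avg_def by (intro divide_nonneg_nonneg sum_nonneg Bochner_Integration.integral_nonneg sq_mean_nonneg) auto
  qed (auto simp: case_prod_beta)
qed

end

section \<open>The lower bound\<close>

lemma end_inj: "end1 e = end1 e' \<Longrightarrow> end2 e = end2 e' \<Longrightarrow> e = e'"
  by (auto simp: end1_def end2_def prod_eq_iff)

text \<open>Every edge has both ends in \<open>B\<close>, which has at most \<open>2 * l\<close>
  distinct entries, and a coloured edge is determined by its two ends.\<close>

lemma card_fibre_le:
  assumes E: "finite E" and B: "size B = 2 * l"
  shows "card (fibre E B) \<le> ((2 * l)\<^sup>2) ^ l"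
proof -
  let ?E = "{e \<in> E. end1 e \<in># B \<and> end2 e \<in># B}"
  have finE: "finite ?E" using E by simp
  have "fibre E B \<subseteq> multisets_of ?E l"
    using B by (auto simp: fibre_def multisets_of_def ends_def)
  then have "card (fibre E B) \<le> card (multisets_of ?E l)" using finE by (intro card_mono) auto
  also have "\<dots> \<le> card ?E ^ l" by (rule card_multisets_of_le[OF finE])
  also have "\<dots> \<le> ((2 * l)\<^sup>2) ^ l"
  proof (rule power_mono)
    have "card ?E \<le> card (set_mset B \<times> set_mset B)"
    proof (rule card_inj_on_le[of "\<lambda>e. (end1 e, end2 e)"])
      show "inj_on (\<lambda>e. (end1 e, end2 e)) ?E"
        by (rule inj_onI) (rule end_inj, simp_all only: prod.inject)
    qed auto
    also have "\<dots> = card (set_mset B) * card (set_mset B)" by (rule card_cartesian_product)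
    also have "\<dots> \<le> (2 * l) * (2 * l)" using card_set_mset_le_size[of B] B by (intro mult_mono) auto
    finally show "card ?E \<le> (2 * l)\<^sup>2" by (simp add: power2_eq_square)
  qed simp
  finally show ?thesis .
qed

lemma avg_match_ind:
  assumes e0: "e0 \<in> ({1..K} \<times> {1..M}) \<times> ({1..K} \<times> {1..M})" and e0l: "snd (fst e0) \<noteq> snd (snd e0)"
  shows "avg K M (\<lambda>\<pi>. of_bool (label_of \<pi> (fst e0) = label_of \<pi> (snd e0))) = 1 / real K"
proof -
  obtain k m k' m' where e: "e0 = ((k, m), (k', m'))" by (metis prod.collapse)
  show ?thesis using avg_match[of k K k' m M m'] e0 e0l by (simp add: e label_of_def)
qed

context gaussian_model
begin

text \<open>Level zero of \<open>W\<close> is \<open>E[x]\<close>. It accounts for the term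
  \<open>1 / K ^ 2\<close>, so that \<open>1 / K - 1 / K ^ 2\<close>, the variance of
  \<open>x\<close>, is the leading part of the lower bound.\<close>

lemma cert_empty:
  assumes e0: "e0 \<in> ({1..K} \<times> {1..M}) \<times> ({1..K} \<times> {1..M})" and e0l: "snd (fst e0) \<noteq> snd (snd e0)"
  shows "cert e0 {#} = 1 / real K"
proof -
  have "fibre E {#} = {{#}}" by (auto simp: fibre_def ends_def)
  moreover have "cumulant K M e0 ({#} :: cedge multiset) = 1 / real K"
  proof -
    have "sat (label_of \<pi>) {e0} \<longleftrightarrow> label_of \<pi> (fst e0) = label_of \<pi> (snd e0)" for \<pi>
      using sat_insert[of "label_of \<pi>" "fst e0" "snd e0" "{}"] by simp
    then show ?thesis using avg_match_ind[OF e0 e0l] by (simp add: cumulant.simps[of K M e0 "{#}"] match_moment_at_def)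
  qed
  ultimately show ?thesis by (simp add: cert_def push_def)
qed

lemma cert_odd: "odd (size B) \<Longrightarrow> cert e0 B = 0"
proof -
  assume "odd (size B)"
  then have "fibre E B = {}" by (auto simp: fibre_def)
  then show ?thesis by (simp add: cert_def push_def)
qed

text \<open>By Cauchy-Schwarz the square of a sum over a fibre costs the size of the fibre, at most
  \<open>(2 * L) ^ (2 * l)\<close>, and \<open>mfact B\<close> costs as much again; hence the factor
  \<open>(2 * L) ^ 4\<close> per edge. Each multigraph lies in one fibre, so the sums over fibres
  add up to the sum over all multigraphs with \<open>l\<close> edges.\<close>

lemma cert_level_le:
  assumes e0: "e0 \<in> ({1..K} \<times> {1..M}) \<times> ({1..K} \<times> {1..M})" and e0l: "snd (fst e0) \<noteq> snd (snd e0)"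
    and L: "l \<le> L" "1 \<le> L" and K: "2 * (2 * L + 2)\<^sup>2 \<le> K"
  shows "(\<Sum>B\<in>multisets_of I (2 * l). (cert e0 B)\<^sup>2 * mfact B / \<sigma> ^ (2 * size B))
    \<le> 36 / (real K)\<^sup>2 * ((2 * real L) ^ 4 * (lam ^ 4 / 4 / \<sigma> ^ 4) *
       ((32 * real L * (real L + 1)\<^sup>2)\<^sup>2 * (4 * real L + 3)\<^sup>2 * real p * max 1 (real M / real K))) ^ l"
proof -
  let ?c = "lam\<^sup>2 / 2" and ?k = "\<lambda>\<theta>::cedge multiset. (cumulant K M e0 \<theta>)\<^sup>2"
  have s0: "\<sigma> ^ n > 0" for n using sigma by simp
  define a where "a = (2 * real L) ^ (4 * l) * (?c ^ l)\<^sup>2 / \<sigma> ^ (4 * l)"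
  have a0: "a \<ge> 0" using s0 by (simp add: a_def less_imp_le)
  have "(cert e0 B)\<^sup>2 * mfact B / \<sigma> ^ (2 * size B) \<le> a * (\<Sum>\<theta>\<in>fibre E B. ?k \<theta>)" if B: "B \<in> multisets_of I (2 * l)" for B
  proof -
    have sz: "size B = 2 * l" using B by (simp add: multisets_of_def)
    have szt: "size \<theta> = l" if "\<theta> \<in> fibre E B" for \<theta> using that sz by (auto simp: fibre_def)
    have lL: "(2 * real l) ^ n \<le> (2 * real L) ^ n" for n using L by (intro power_mono) auto
    have "(cert e0 B)\<^sup>2 = (\<Sum>\<theta>\<in>fibre E B. ?c ^ l * cumulant K M e0 \<theta>)\<^sup>2"
      unfolding cert_def push_def by (intro arg_cong[where f="\<lambda>x. x\<^sup>2"] sum.cong refl) (simp add: szt)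
    also have "\<dots> \<le> (\<Sum>\<theta>\<in>fibre E B. (?c ^ l * cumulant K M e0 \<theta>)\<^sup>2) * real (card (fibre E B))"
      by (rule sum_squared_le_sum_of_squares)
    also have "\<dots> = ((?c ^ l)\<^sup>2 * (\<Sum>\<theta>\<in>fibre E B. ?k \<theta>)) * real (card (fibre E B))"
      by (simp only: power_mult_distrib sum_distrib_left)
    also have "\<dots> \<le> ((?c ^ l)\<^sup>2 * (\<Sum>\<theta>\<in>fibre E B. ?k \<theta>)) * (2 * real L) ^ (2 * l)"
    proof (rule mult_left_mono)
      have "real (card (fibre E B)) \<le> real (((2 * l)\<^sup>2) ^ l)"
        using card_fibre_le[OF finite_coloured_edges sz, of K M p] by (rule of_nat_mono)
      also have "\<dots> = (2 * real l) ^ (2 * l)" by (simp add: power_mult)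
      finally show "real (card (fibre E B)) \<le> (2 * real L) ^ (2 * l)" using lL[of "2 * l"] by linarith
    qed (simp add: sum_nonneg)
    finally have c2: "(cert e0 B)\<^sup>2 \<le> ((?c ^ l)\<^sup>2 * (\<Sum>\<theta>\<in>fibre E B. ?k \<theta>)) * (2 * real L) ^ (2 * l)" .
    have "mfact B \<le> fact (2 * l)" using mfact_le[of B] sz by simp
    also have "\<dots> \<le> real ((2 * l) ^ (2 * l))"
      using fact_le_power[of "2 * l", where 'a=real] by simp
    also have "\<dots> = (2 * real l) ^ (2 * l)" by simp
    also have "\<dots> \<le> (2 * real L) ^ (2 * l)" by (rule lL)
    finally have m: "mfact B \<le> (2 * real L) ^ (2 * l)" .
    have "(cert e0 B)\<^sup>2 * mfact B \<le> (((?c ^ l)\<^sup>2 * (\<Sum>\<theta>\<in>fibre E B. ?k \<theta>)) * (2 * real L) ^ (2 * l)) * (2 * real L) ^ (2 * l)"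
      using c2 m by (rule mult_mono) (auto intro!: mult_nonneg_nonneg sum_nonneg simp: less_imp_le)
    also have "\<dots> = (2 * real L) ^ (4 * l) * (?c ^ l)\<^sup>2 * (\<Sum>\<theta>\<in>fibre E B. ?k \<theta>)"
    proof -
      have "4 * l = 2 * l + 2 * l" by simp
      then show ?thesis by (simp only: power_add mult_ac)
    qed
    finally have "(cert e0 B)\<^sup>2 * mfact B / \<sigma> ^ (2 * size B) \<le> (2 * real L) ^ (4 * l) * (?c ^ l)\<^sup>2 * (\<Sum>\<theta>\<in>fibre E B. ?k \<theta>) / \<sigma> ^ (2 * size B)"
      using s0 by (intro divide_right_mono) (auto simp: less_imp_le)
    also have "\<dots> = a * (\<Sum>\<theta>\<in>fibre E B. ?k \<theta>)" by (simp add: a_def sz)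
    finally show ?thesis .
  qed
  then have "(\<Sum>B\<in>multisets_of I (2 * l). (cert e0 B)\<^sup>2 * mfact B / \<sigma> ^ (2 * size B))
    \<le> (\<Sum>B\<in>multisets_of I (2 * l). a * (\<Sum>\<theta>\<in>fibre E B. ?k \<theta>))" by (rule sum_mono)
  also have "\<dots> = a * (\<Sum>B\<in>multisets_of I (2 * l). \<Sum>\<theta>\<in>fibre E B. ?k \<theta>)" by (simp only: sum_distrib_left)
  also have "(\<Sum>B\<in>multisets_of I (2 * l). \<Sum>\<theta>\<in>fibre E B. ?k \<theta>) = (\<Sum>B\<in>multisets_of I (2 * l). \<Sum>\<theta>\<in>{\<theta> \<in> multisets_of E l. ends \<theta> = B}. ?k \<theta>)"
  proof (rule sum.cong[OF refl])
    fix B assume "B \<in> multisets_of I (2 * l)"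
    then have "size B = 2 * l" by (simp add: multisets_of_def)
    then have "fibre E B = {\<theta> \<in> multisets_of E l. ends \<theta> = B}"
      by (auto simp: fibre_def multisets_of_def)
    then show "(\<Sum>\<theta>\<in>fibre E B. ?k \<theta>) = (\<Sum>\<theta>\<in>{\<theta> \<in> multisets_of E l. ends \<theta> = B}. ?k \<theta>)" by simp
  qed
  also have "\<dots> = (\<Sum>\<theta>\<in>multisets_of E l. ?k \<theta>)"
  proof (rule sum.group)
    show "ends ` multisets_of E l \<subseteq> multisets_of I (2 * l)"
    proof
      fix B assume "B \<in> ends ` multisets_of E l"
      then obtain \<theta> where t: "set_mset \<theta> \<subseteq> E" "size \<theta> = l" "B = ends \<theta>" by (auto simp: multisets_of_def)
      have "end1 e \<in> I \<and> end2 e \<in> I" if "e \<in> E" for e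
        using that by (auto simp: end1_def end2_def coloured_edges_def entries_def)
      then have "set_mset B \<subseteq> I" using t(1) unfolding t(3) ends_def by auto
      then show "B \<in> multisets_of I (2 * l)" using t by (simp add: multisets_of_def)
    qed
  qed simp_all
  also have "a * (\<Sum>\<theta>\<in>multisets_of E l. ?k \<theta>) \<le> a * (36 / (real K)\<^sup>2 * ((32 * real L * (real L + 1)\<^sup>2)\<^sup>2 * (4 * real L + 3)\<^sup>2 * real p * max 1 (real M / real K)) ^ l)"
    using a0 by (intro mult_left_mono sum_cumulant_sq_le[OF e0 e0l L K])
  also have "\<dots> = 36 / (real K)\<^sup>2 * (a * ((32 * real L * (real L + 1)\<^sup>2)\<^sup>2 * (4 * real L + 3)\<^sup>2 * real p * max 1 (real M / real K)) ^ l)"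
    by simp
  also have "a = ((2 * real L) ^ 4 * (lam ^ 4 / 4 / \<sigma> ^ 4)) ^ l"
  proof -
    have "(?c ^ l)\<^sup>2 = (?c\<^sup>2) ^ l" by (simp only: power_mult[symmetric] mult.commute)
    also have "?c\<^sup>2 = lam ^ 4 / 4" by (simp add: power_divide flip: power_mult)
    finally have "(?c ^ l)\<^sup>2 = (lam ^ 4 / 4) ^ l" .
    then show ?thesis
      by (simp only: a_def power_mult power_mult_distrib power_divide times_divide_eq_right)
  qed
  finally show ?thesis by (simp only: power_mult_distrib mult.assoc)
qed

text \<open>Odd levels vanish, and level zero gives \<open>1 / K ^ 2\<close>. Each of the at most
  \<open>D / 2\<close> remaining levels is bounded by a power of a ratio \<open>x <= 1\<close>,
  hence by its first power.\<close>

lemma cert_norm_le: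
  fixes \<zeta> :: real
  assumes e0: "e0 \<in> ({1..K} \<times> {1..M}) \<times> ({1..K} \<times> {1..M})" and e0l: "snd (fst e0) \<noteq> snd (snd e0)"
    and K: "2 * (D + 2)\<^sup>2 \<le> K"
    and z: "\<zeta> = 64 * real D ^ 40 * (lam ^ 4 / \<sigma> ^ 4) * real p * max 1 (real M / real K)" "\<zeta> < 1"
  shows "cert_norm e0 D \<le> 1 / (real K)\<^sup>2 * (1 + real D * \<zeta>)"
proof -
  let ?T = "\<lambda>B. (cert e0 B)\<^sup>2 * mfact B / \<sigma> ^ (2 * size B)"
  let ?n = "D div 2"
  have s0: "\<sigma> ^ n > 0" for n using sigma by simp
  have T0: "?T B \<ge> 0" for B using s0 by (simp add: less_imp_le)
  have K1: "1 \<le> K" using K by (simp add: power2_eq_square)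
  have z0: "\<zeta> \<ge> 0" unfolding z(1) using lam sigma by simp
  have "cert_norm e0 D = (\<Sum>B\<in>(\<Union>l\<in>{..?n}. multisets_of I (2 * l)). ?T B)"
    unfolding cert_norm_def
  proof (rule sum.mono_neutral_right)
    show "(\<Union>l\<in>{..?n}. multisets_of I (2 * l)) \<subseteq> low_msets D"
      by (auto simp: low_msets_def multisets_of_def)
    show "\<forall>B\<in>low_msets D - (\<Union>l\<in>{..?n}. multisets_of I (2 * l)). ?T B = 0"
    proof
      fix B assume B: "B \<in> low_msets D - (\<Union>l\<in>{..?n}. multisets_of I (2 * l))"
      have "odd (size B)"
      proof
        assume "even (size B)"
        then obtain l where l: "size B = 2 * l" by (elim evenE)
        then have "l \<in> {..?n}" using B by (auto simp: low_msets_def)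
        moreover have "B \<in> multisets_of I (2 * l)" using B l by (auto simp: low_msets_def multisets_of_def)
        ultimately show False using B by blast
      qed
      then show "?T B = 0" by (simp add: cert_odd)
    qed
  qed simp
  also have "\<dots> = (\<Sum>l\<in>{..?n}. \<Sum>B\<in>multisets_of I (2 * l). ?T B)"
    by (rule sum.UNION_disjoint) (auto simp: multisets_of_def[of _ "_ * _"] intro: finite_multisets_of[unfolded multisets_of_def])
  also have "\<dots> = (\<Sum>B\<in>multisets_of I (2 * 0). ?T B) + (\<Sum>l\<in>{1..?n}. \<Sum>B\<in>multisets_of I (2 * l). ?T B)"
  proof -
    have "{..?n} = insert 0 {1..?n}" by auto
    then show ?thesis by simp
  qed
  also have "(\<Sum>B\<in>multisets_of I (2 * 0). ?T B) = 1 / (real K)\<^sup>2"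
  proof -
    have "multisets_of I (2 * 0) = {{#}}" by (auto simp: multisets_of_def)
    then show ?thesis using cert_empty[OF e0 e0l] by (simp add: power_divide)
  qed
  also have "(\<Sum>l\<in>{1..?n}. \<Sum>B\<in>multisets_of I (2 * l). ?T B) \<le> (\<Sum>l\<in>{1..?n}. 1 / (real K)\<^sup>2 * \<zeta>)"
  proof (rule sum_mono)
    fix l assume "l \<in> {1..?n}"
    then have l: "1 \<le> l" "l \<le> ?n" by auto
    then have L1: "1 \<le> ?n" by simp
    then have D2: "2 \<le> D" by simp
    have LD: "2 * real ?n \<le> real D" by linarith
    have "(2 * ?n + 2)\<^sup>2 \<le> (D + 2)\<^sup>2" by (rule power_mono) auto
    then have KL: "2 * (2 * ?n + 2)\<^sup>2 \<le> K" using K by linarith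
    define x where "x = (2 * real ?n) ^ 4 * (lam ^ 4 / 4 / \<sigma> ^ 4) *
       ((32 * real ?n * (real ?n + 1)\<^sup>2)\<^sup>2 * (4 * real ?n + 3)\<^sup>2 * real p * max 1 (real M / real K))"
    have x0: "x \<ge> 0" unfolding x_def using lam sigma by simp
    \<comment> \<open>With \<open>2 * ?n <= D\<close> the polynomial factors amount to at most
      \<open>1024 * D ^ 12\<close>. Because \<open>D >= 2\<close>, the surplus \<open>D ^ 28\<close>
      of \<open>D ^ 40\<close> absorbs the constants:
      \<open>36 * 1024 <= 64 * 2 ^ 28\<close>.\<close>
    have le: "36 * x \<le> \<zeta>"
    proof -
      define \<tau> where "\<tau> = lam ^ 4 / \<sigma> ^ 4 * real p * max 1 (real M / real K)"
      have \<tau>0: "\<tau> \<ge> 0" unfolding \<tau>_def using lam sigma by simp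
      have d1: "(2 * real ?n) ^ 4 \<le> real D ^ 4" using LD by (intro power_mono) auto
      have d2: "(32 * real ?n * (real ?n + 1)\<^sup>2)\<^sup>2 \<le> (16 * real D ^ 3)\<^sup>2"
      proof (rule power_mono)
        have h1: "32 * real ?n \<le> 16 * real D" using LD by linarith
        have "real ?n + 1 \<le> real D" using LD L1 by linarith
        then have h2: "(real ?n + 1)\<^sup>2 \<le> (real D)\<^sup>2" by (intro power_mono) auto
        have "(32 * real ?n) * (real ?n + 1)\<^sup>2 \<le> (16 * real D) * (real D)\<^sup>2"
          by (rule mult_mono[OF h1 h2]) simp_all
        then show "32 * real ?n * (real ?n + 1)\<^sup>2 \<le> 16 * real D ^ 3" by (simp add: power2_eq_square power3_eq_cube)
      qed simp
      have d3: "(4 * real ?n + 3)\<^sup>2 \<le> (4 * real D)\<^sup>2" 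
      proof (rule power_mono)
        show "4 * real ?n + 3 \<le> 4 * real D" using LD D2 by linarith
      qed simp
      have "x = ((2 * real ?n) ^ 4 * (32 * real ?n * (real ?n + 1)\<^sup>2)\<^sup>2 * (4 * real ?n + 3)\<^sup>2) * (\<tau> / 4)"
        unfolding x_def \<tau>_def by simp
      also have "\<dots> \<le> (real D ^ 4 * (16 * real D ^ 3)\<^sup>2 * (4 * real D)\<^sup>2) * (\<tau> / 4)"
        by (intro mult_right_mono mult_mono d1 d2 d3) (use \<tau>0 in simp_all)
      also have "\<dots> = 1024 * real D ^ 12 * \<tau>" by (simp add: power_mult_distrib power_mult[symmetric] power_add[symmetric])
      finally have "36 * x \<le> 36864 * (real D ^ 12 * \<tau>)" by (simp add: mult_ac)
      also have "\<dots> \<le> (64 * real D ^ 28) * (real D ^ 12 * \<tau>)"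
      proof (rule mult_right_mono)
        have "(2::real) ^ 28 \<le> real D ^ 28" using D2 by (intro power_mono) auto
        then show "36864 \<le> 64 * real D ^ 28" by simp
      qed (use \<tau>0 in simp)
      also have "\<dots> = \<zeta>" unfolding z(1) \<tau>_def by (simp add: power_add[symmetric] mult_ac)
      finally show ?thesis .
    qed
    have x1: "x \<le> 1" using le x0 z by linarith
    have "(\<Sum>B\<in>multisets_of I (2 * l). ?T B) \<le> 36 / (real K)\<^sup>2 * x ^ l"
      unfolding x_def by (rule cert_level_le[OF e0 e0l l(2) L1 KL])
    also have "\<dots> \<le> 36 / (real K)\<^sup>2 * x ^ 1"
      using x0 x1 l by (intro mult_left_mono power_decreasing) auto
    also have "\<dots> = 1 / (real K)\<^sup>2 * (36 * x)" by simp
    also have "\<dots> \<le> 1 / (real K)\<^sup>2 * \<zeta>" by (intro mult_left_mono le) simp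
    finally show "(\<Sum>B\<in>multisets_of I (2 * l). ?T B) \<le> 1 / (real K)\<^sup>2 * \<zeta>" .
  qed
  also have "(\<Sum>l\<in>{1..?n}. 1 / (real K)\<^sup>2 * \<zeta>) \<le> 1 / (real K)\<^sup>2 * (real D * \<zeta>)"
  proof -
    have "real ?n * \<zeta> \<le> real D * \<zeta>" using z0 by (intro mult_right_mono) auto
    then have "1 / (real K)\<^sup>2 * (real ?n * \<zeta>) \<le> 1 / (real K)\<^sup>2 * (real D * \<zeta>)" by (rule mult_left_mono) simp
    then show ?thesis by simp
  qed
  finally show ?thesis by (simp add: distrib_left)
qed

lemma entry_risk:
  assumes f: "is_poly_deg_le I D f"
  shows "\<exists>r. has_bochner_integral (matching_prior K M p lam \<sigma>) (\<lambda>(\<pi>, \<mu>, Y). (f Y - match_ind e0 \<pi>)\<^sup>2) r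
    \<and> avg K M (match_ind e0) - cert_norm e0 D \<le> r"
proof -
  obtain cf where cf: "\<And>y. f y = (\<Sum>\<alpha>\<in>multi_indices I D. cf \<alpha> * (\<Prod>i\<in>I. y i ^ \<alpha> i))"
    using f by (auto simp: is_poly_deg_le_def)
  have "monomial (mset_index \<alpha>) y = (\<Prod>i\<in>I. y i ^ \<alpha> i)" for \<alpha> y
    unfolding monomial_def by (intro prod.cong refl) (simp add: count_mset_index)
  then have "f = pol D cf" by (intro ext) (simp add: cf pol_def)
  then show ?thesis using prior_sq[of D cf e0] avg_sq_mean_ge[of e0 D cf] by blast
qed

end

theorem theorem2p2:
  fixes K M p D :: nat and \<sigma> Delta lam \<zeta> :: real
  assumes "K \<ge> 1" and "M \<ge> 2" and "p \<ge> 1"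
    and "\<sigma> > 0" and "Delta > 0"
    and "lam = sqrt (Delta\<^sup>2 * \<sigma>\<^sup>2 / real p)"
    and "K \<ge> 2 * (D + 2)\<^sup>2"
    and "\<zeta> = 64 * real D ^ 40 * (lam ^ 4 / \<sigma> ^ 4) * real p * max 1 (real M / real K)"
    and "\<zeta> < 1"
  shows "MMSE K M p lam \<sigma> D \<ge>
    1 / real K - 1 / (real K)\<^sup>2 *
      (1 + 64 * (real D + 1) * real D ^ 36 * (\<zeta> / (1 - sqrt \<zeta>)))"
proof -
  have lam: "lam > 0" using assms by simp
  interpret gaussian_model K M p \<sigma> lam using assms(4) lam by unfold_locales
  let ?N = "{1..K} \<times> {1..M}" and ?k = "real K" and ?m = "real M"
  let ?b = "1 / ?k - 1 / ?k\<^sup>2 * (1 + real D * \<zeta>)"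
  let ?Pr = "matching_prior K M p lam \<sigma>"
  have \<zeta>0: "\<zeta> \<ge> 0" using lam assms(4) unfolding assms(8) by simp
  have M0: "?m * (?m - 1) * ?k\<^sup>2 > 0" using assms(1,2) by simp
  have risk: "estimation_risk K M p lam \<sigma> G \<ge> ?b" if G: "G \<in> low_degree_estimators K M p D" for G
  proof -
    have "\<exists>r. has_bochner_integral ?Pr (\<lambda>(\<pi>, \<mu>, Y). (G Y (fst e) (snd e) - match_ind e \<pi>)\<^sup>2) r
      \<and> avg K M (match_ind e) - cert_norm e D \<le> r" if "e \<in> ?N \<times> ?N" for e
    proof (rule entry_risk)
      have e: "fst e \<in> ?N" "snd e \<in> ?N" using that mem_Times_iff[of e ?N ?N] by blast+
      have "\<forall>i\<in>?N. \<forall>j\<in>?N. is_poly_deg_le (entries K M p) D (\<lambda>Y. G Y i j)"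
        using G unfolding low_degree_estimators_def by (rule CollectD)
      from bspec[OF bspec[OF this e(1)] e(2)]
      show "is_poly_deg_le (entries K M p) D (\<lambda>Y. G Y (fst e) (snd e))" .
    qed
    then obtain r where r: "\<And>e. e \<in> ?N \<times> ?N \<Longrightarrow> has_bochner_integral ?Pr (\<lambda>(\<pi>, \<mu>, Y). (G Y (fst e) (snd e) - match_ind e \<pi>)\<^sup>2) (r e)"
      and rge: "\<And>e. e \<in> ?N \<times> ?N \<Longrightarrow> avg K M (match_ind e) - cert_norm e D \<le> r e"
      by metis
    have r0: "r e \<ge> 0" if "e \<in> ?N \<times> ?N" for e
    proof -
      have "r e = integral\<^sup>L ?Pr (\<lambda>(\<pi>, \<mu>, Y). (G Y (fst e) (snd e) - match_ind e \<pi>)\<^sup>2)"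
        using r[OF that] by (simp add: has_bochner_integral_iff)
      also have "\<dots> \<ge> 0" by (rule Bochner_Integration.integral_nonneg) (simp add: case_prod_beta)
      finally show ?thesis .
    qed
    have rb: "r e \<ge> ?b" if e: "e \<in> ?N \<times> ?N" "snd (fst e) \<noteq> snd (snd e)" for e
    proof -
      have "avg K M (match_ind e) = 1 / ?k"
        using avg_match_ind[OF e] by (simp add: match_ind_def[abs_def])
      moreover have "cert_norm e D \<le> 1 / ?k\<^sup>2 * (1 + real D * \<zeta>)"
        by (rule cert_norm_le[OF e assms(7,8,9)])
      ultimately show ?thesis using rge[OF e(1)] by linarith
    qed
    have hb: "has_bochner_integral ?Pr (\<lambda>q. \<Sum>e\<in>?N \<times> ?N. (\<lambda>(\<pi>, \<mu>, Y). (G Y (fst e) (snd e) - match_ind e \<pi>)\<^sup>2) q) (\<Sum>e\<in>?N \<times> ?N. r e)"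
      by (intro has_bochner_integral_sum r)
    have eq: "(\<lambda>q. \<Sum>e\<in>?N \<times> ?N. (\<lambda>(\<pi>, \<mu>, Y). (G Y (fst e) (snd e) - match_ind e \<pi>)\<^sup>2) q)
      = (\<lambda>(\<pi>, \<mu>, Y). (frob_norm ?N (\<lambda>i j. G Y i j - Gamma_star \<pi> i j))\<^sup>2)"
    proof -
      have G: "match_ind e \<pi> = Gamma_star \<pi> (fst e) (snd e)" for e \<pi>
        by (simp add: match_ind_def Gamma_star_def label_of_def case_prod_beta)
      show ?thesis
        unfolding frob_norm_def L2_set_def by (intro ext) (simp add: case_prod_beta sum_nonneg G)
    qed
    have int: "(\<integral>(\<pi>, \<mu>, Y). (frob_norm ?N (\<lambda>i j. G Y i j - Gamma_star \<pi> i j))\<^sup>2 \<partial>?Pr) = (\<Sum>e\<in>?N \<times> ?N. r e)"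
      using has_bochner_integral_integral_eq[OF hb] unfolding eq .
    \<comment> \<open>The pairs of vertices on different layers; their number is exactly the
      normalisation of the risk. Entries within a layer add a nonnegative amount and are
      dropped.\<close>
    let ?O = "{e \<in> ?N \<times> ?N. snd (fst e) \<noteq> snd (snd e)}"
    have cardO: "real (card ?O) = ?m * (?m - 1) * ?k\<^sup>2"
    proof -
      have "bij_betw (\<lambda>((k, m), (k', m')). ((k, k'), (m, m'))) ?O (({1..K} \<times> {1..K}) \<times> {q \<in> {1..M} \<times> {1..M}. fst q \<noteq> snd q})"
        by (rule bij_betwI[where g="\<lambda>((k, k'), (m, m')). ((k, m), (k', m'))"]) auto
      then have "card ?O = card (({1..K} \<times> {1..K}) \<times> {q \<in> {1..M} \<times> {1..M}. fst q \<noteq> snd q})"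
        by (rule bij_betw_same_card)
      also have "{q \<in> {1..M} \<times> {1..M}. fst q \<noteq> snd q} = {1..M} \<times> {1..M} - (\<lambda>m. (m, m)) ` {1..M}" by auto
      also have "card (({1..K} \<times> {1..K}) \<times> ({1..M} \<times> {1..M} - (\<lambda>m. (m, m)) ` {1..M})) = K * K * (M * M - M)"
      proof -
        have "card ((\<lambda>m. (m, m)) ` {1..M}) = M" by (subst card_image) (auto simp: inj_on_def)
        moreover have "(\<lambda>m. (m, m)) ` {1..M} \<subseteq> {1..M} \<times> {1..M}" by auto
        ultimately have "card ({1..M} \<times> {1..M} - (\<lambda>m. (m, m)) ` {1..M}) = M * M - M"
          by (simp add: card_Diff_subset card_cartesian_product)
        then show ?thesis by (simp only: card_cartesian_product) simp
      qed
      finally have "card ?O = K * K * (M * M - M)" .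
      moreover have "M \<le> M * M" using assms(2) by simp
      ultimately have "real (card ?O) = ?k * ?k * (?m * ?m - ?m)" by (simp add: of_nat_diff)
      then show ?thesis by (simp add: power2_eq_square algebra_simps)
    qed
    have "?m * (?m - 1) * ?k\<^sup>2 * ?b = (\<Sum>e\<in>?O. ?b)" by (simp only: sum_constant cardO)
    also have "\<dots> \<le> (\<Sum>e\<in>?O. r e)" by (intro sum_mono rb) auto
    also have "\<dots> \<le> (\<Sum>e\<in>?N \<times> ?N. r e)" using r0 by (intro sum_mono2) auto
    finally have le: "1 / (?m * (?m - 1) * ?k\<^sup>2) * (?m * (?m - 1) * ?k\<^sup>2 * ?b) \<le> 1 / (?m * (?m - 1) * ?k\<^sup>2) * (\<Sum>e\<in>?N \<times> ?N. r e)"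
      using M0 by (intro mult_left_mono) auto
    have c: "1 / n * (n * b) = b" if "n > 0" for n b :: real using that by simp
    show ?thesis unfolding estimation_risk_def int using le unfolding c[OF M0] .
  qed
  have "is_poly_deg_le (entries K M p) D (\<lambda>_. 0)"
    unfolding is_poly_deg_le_def by (rule exI[of _ "\<lambda>_. 0"]) simp
  then have "(\<lambda>_ _ _. 0) \<in> low_degree_estimators K M p D" by (simp add: low_degree_estimators_def)
  then have ne: "low_degree_estimators K M p D \<noteq> {}" by blast
  have main: "MMSE K M p lam \<sigma> D \<ge> ?b"
    unfolding MMSE_def by (rule cINF_greatest[OF ne risk])
  \<comment> \<open>The bound obtained so far is stronger than the one claimed. For
    \<open>D = 0\<close> the factor \<open>D ^ 36\<close> vanishes, but so does the left
    side.\<close>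
  have "real D * \<zeta> \<le> 64 * (real D + 1) * real D ^ 36 * (\<zeta> / (1 - sqrt \<zeta>))"
  proof (cases "D = 0")
    case False
    have s: "0 < 1 - sqrt \<zeta>" "1 - sqrt \<zeta> \<le> 1" using assms(9) \<zeta>0 by auto
    have "(1::real) \<le> real D ^ 36" using False by simp
    then have a: "real D * 1 \<le> (64 * (real D + 1)) * real D ^ 36" by (intro mult_mono) auto
    have b: "\<zeta> \<le> \<zeta> / (1 - sqrt \<zeta>)"
      using s \<zeta>0 divide_left_mono[of "1 - sqrt \<zeta>" 1 \<zeta>] by simp
    have "(real D * 1) * \<zeta> \<le> (64 * (real D + 1)) * real D ^ 36 * (\<zeta> / (1 - sqrt \<zeta>))"
      by (rule mult_mono[OF a b]) (use \<zeta>0 in simp_all)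
    then show ?thesis by simp
  qed (use assms(8) in simp)
  then have "1 / ?k\<^sup>2 * (1 + real D * \<zeta>) \<le> 1 / ?k\<^sup>2 * (1 + 64 * (real D + 1) * real D ^ 36 * (\<zeta> / (1 - sqrt \<zeta>)))"
    by (intro mult_left_mono) auto
  then show ?thesis using main by linarith
qed

end
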